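(* Let $\mathcal{C}$ be a semi-monoidal 2-category and $(I,\alpha)$ a unit object in $\mathcal{C}$. Then there is a canonical invertible 2-cell $$\mathring{A}: I\alpha \,\#\, \alpha \Rightarrow \alpha I \,\#\, \alpha ,$$ namely $\mathring{A}=A\,\#\,\alpha$, where $A: I\alpha\Rightarrow\alpha I$ is the 2-cell described in the context (which does not depend on the choice of left and right constraints), and it satisfies the pentagon equation: the composite $$(I\mathring{A}\,\#\,\alpha)\bullet(I\alpha I\,\#\,\mathring{A})\bullet(\mathring{A}I\,\#\,\alpha)$$ of 2-cells $II\alpha\# I\alpha\#\alpha\Rightarrow I\alpha I\# I\alpha\#\alpha\Rightarrow I\alpha I\#\alpha I\#\alpha\Rightarrow \alpha II\#\alpha I\#\alpha$ equals the composite $$(II\alpha\,\#\,\mathring{A})\bullet(\alpha II\,\#\,\mathring{A})$$ of 2-cells $II\alpha\# I\alpha\#\alpha\Rightarrow II\alpha\#\alpha I\#\alpha=\alpha II\# I\alpha\#\alpha\Rightarrow\alpha II\#\alpha I\#\alpha$.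
   Context: A semi-monoidal 2-category $\mathcal{C}$ is a strict 2-category with a strict 2-functor $\mathcal{C}\times\mathcal{C}\to\mathcal{C}$, $(X,Y)\mapsto XY$ (tensor product, written by juxtaposition), strictly associative: $(XY)Z=X(YZ)$. No unit is assumed. $\#$ denotes composition of arrows and horizontal composition of 2-cells (including whiskering), written in left-to-right (diagrammatic) order; $\bullet$ denotes vertical composition of 2-cells, also left to right ($S\bullet T$ is $S$ followed by $T$). The name of an object (arrow) also denotes its identity arrow (identity 2-cell); e.g. $I\alpha=\mathrm{id}_I\otimes\alpha$. An equi-arrow is an arrow admitting a pseudo-inverse (an arrow in the opposite direction with both composites isomorphic to identities, the comparison 2-cells satisfying the triangle equations). An object $I$ is cancellable if the 2-functors $X\mapsto IX$ and $X\mapsto XI$ from $\mathcal{C}$ to $\mathcal{C}$ are fully faithful, i.e. induce equivalences on hom categories. A unit object is a pair $(I,\alpha)$ with $I$ cancellable and $\alpha: II\to I$ an equi-arrow. Left and right constraints for $(I,\alpha)$: for each object $X$, equi-arrows $\lambda_X: IX\to X$, $\rho_X: XI\to X$ and invertible 2-cells $L_X: I\lambda_X\Rightarrow\alpha X$, $R_X: X\alpha\Rightarrow\rho_X I$; such choices always exist. Given such choices, $A: I\alpha\Rightarrow\alpha I$ is the unique 2-cell such that $$(IL_I^{-1}\,\#\,R_I)\bullet(R_I^{-1}I\,\#\,L_I)=I\alpha I\,\#\,A ,$$ where the left-hand side is $I\alpha I\# I\alpha\Rightarrow II\lambda_I\#\rho_I I=\rho_I II\# I\lambda_I\Rightarrow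 I\alpha I\#\alpha I$ (it is uniquely determined since $I\alpha I$ is an equi-arrow). *)

theory Defs
  imports Main
begin

section \<open>Categories, functors and equivalences\<close>

text \<open>Composition is written in diagrammatic order throughout: \<open>Cmp C f g\<close> is \<open>f\<close> followed by \<open>g\<close>.
  All laws are relativised to the carriers; the values of the operations on arguments outside the
  carriers, or on non-composable ones, are arbitrary.\<close>

record ('o, 'm) cat =
  Ob  :: "'o set"
  Mor :: "'m set"
  Dom :: "'m \<Rightarrow> 'o"
  Cod :: "'m \<Rightarrow> 'o"
  Idt :: "'o \<Rightarrow> 'm"
  Cmp :: "'m \<Rightarrow> 'm \<Rightarrow> 'm"

locale category =
  fixes C :: "('o, 'm, 'x) cat_scheme"
  assumes Dom_closed: "f \<in> Mor C \<Longrightarrow> Dom C f \<in> Ob C"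
    and Cod_closed: "f \<in> Mor C \<Longrightarrow> Cod C f \<in> Ob C"
    and Idt_closed: "X \<in> Ob C \<Longrightarrow> Idt C X \<in> Mor C"
    and Dom_Idt: "X \<in> Ob C \<Longrightarrow> Dom C (Idt C X) = X"
    and Cod_Idt: "X \<in> Ob C \<Longrightarrow> Cod C (Idt C X) = X"
    and Cmp_closed: "\<lbrakk>f \<in> Mor C; g \<in> Mor C; Cod C f = Dom C g\<rbrakk> \<Longrightarrow> Cmp C f g \<in> Mor C"
    and Dom_Cmp: "\<lbrakk>f \<in> Mor C; g \<in> Mor C; Cod C f = Dom C g\<rbrakk> \<Longrightarrow> Dom C (Cmp C f g) = Dom C f"
    and Cod_Cmp: "\<lbrakk>f \<in> Mor C; g \<in> Mor C; Cod C f = Dom C g\<rbrakk> \<Longrightarrow> Cod C (Cmp C f g) = Cod C g"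
    and Idt_left: "f \<in> Mor C \<Longrightarrow> Cmp C (Idt C (Dom C f)) f = f"
    and Idt_right: "f \<in> Mor C \<Longrightarrow> Cmp C f (Idt C (Cod C f)) = f"
    and Cmp_assoc: "\<lbrakk>f \<in> Mor C; g \<in> Mor C; h \<in> Mor C; Cod C f = Dom C g; Cod C g = Dom C h\<rbrakk>
      \<Longrightarrow> Cmp C (Cmp C f g) h = Cmp C f (Cmp C g h)"

definition mutually_inverse :: "('o, 'm, 'x) cat_scheme \<Rightarrow> 'm \<Rightarrow> 'm \<Rightarrow> bool" where
  "mutually_inverse C f g \<longleftrightarrow>
     f \<in> Mor C \<and> g \<in> Mor C \<and> Dom C g = Cod C f \<and> Cod C g = Dom C f \<and>
     Cmp C f g = Idt C (Dom C f) \<and> Cmp C g f = Idt C (Cod C f)"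

definition is_iso :: "('o, 'm, 'x) cat_scheme \<Rightarrow> 'm \<Rightarrow> bool" where
  "is_iso C f \<longleftrightarrow> (\<exists>g. mutually_inverse C f g)"

definition inverse_mor :: "('o, 'm, 'x) cat_scheme \<Rightarrow> 'm \<Rightarrow> 'm" where
  "inverse_mor C f = (THE g. mutually_inverse C f g)"

definition is_functor ::
  "('o, 'm, 'x) cat_scheme \<Rightarrow> ('p, 'n, 'y) cat_scheme \<Rightarrow> ('o \<Rightarrow> 'p) \<Rightarrow> ('m \<Rightarrow> 'n) \<Rightarrow> bool" where
  "is_functor C D FO FM \<longleftrightarrow>
     (\<forall>X\<in>Ob C. FO X \<in> Ob D \<and> FM (Idt C X) = Idt D (FO X)) \<and>
     (\<forall>f\<in>Mor C. FM f \<in> Mor D \<and> Dom D (FM f) = FO (Dom C f) \<and> Cod D (FM f) = FO (Cod C f)) \<and>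
     (\<forall>f\<in>Mor C. \<forall>g\<in>Mor C. Cod C f = Dom C g \<longrightarrow> FM (Cmp C f g) = Cmp D (FM f) (FM g))"

definition is_natural_iso ::
  "('o, 'm, 'x) cat_scheme \<Rightarrow> ('p, 'n, 'y) cat_scheme \<Rightarrow> ('o \<Rightarrow> 'p) \<Rightarrow> ('m \<Rightarrow> 'n) \<Rightarrow>
   ('o \<Rightarrow> 'p) \<Rightarrow> ('m \<Rightarrow> 'n) \<Rightarrow> ('o \<Rightarrow> 'n) \<Rightarrow> bool" where
  "is_natural_iso C D FO FM GO GM \<tau> \<longleftrightarrow>
     (\<forall>X\<in>Ob C. is_iso D (\<tau> X) \<and> Dom D (\<tau> X) = FO X \<and> Cod D (\<tau> X) = GO X) \<and>
     (\<forall>f\<in>Mor C. Cmp D (FM f) (\<tau> (Cod C f)) = Cmp D (\<tau> (Dom C f)) (GM f))"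

definition is_equivalence ::
  "('o, 'm, 'x) cat_scheme \<Rightarrow> ('p, 'n, 'y) cat_scheme \<Rightarrow> ('o \<Rightarrow> 'p) \<Rightarrow> ('m \<Rightarrow> 'n) \<Rightarrow> bool" where
  "is_equivalence C D FO FM \<longleftrightarrow>
     is_functor C D FO FM \<and>
     (\<exists>GO GM \<eta> \<epsilon>. is_functor D C GO GM \<and>
        is_natural_iso C C id id (GO \<circ> FO) (GM \<circ> FM) \<eta> \<and>
        is_natural_iso D D (FO \<circ> GO) (FM \<circ> GM) id id \<epsilon>)"

section \<open>Strict 2-categories\<close>

text \<open>Here \<open>\<sharp>\<^sub>1\<close> composes arrows, \<open>\<sharp>\<^sub>2\<close> is horizontal and \<open>\<bullet>\<close> vertical composition of 2-cells;
  \<open>\<one>\<^sub>1 X\<close> is the identity arrow of an object and \<open>\<one>\<^sub>2 f\<close> the identity 2-cell of an arrow.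
  Whiskering of \<open>S\<close> by \<open>f\<close> is \<open>\<one>\<^sub>2 f \<sharp>\<^sub>2 S\<close>, resp. \<open>S \<sharp>\<^sub>2 \<one>\<^sub>2 f\<close>.\<close>

record ('o, 'a, 'c) two_cat =
  Obj  :: "'o set"
  Arr  :: "'a set"
  Cell :: "'c set"
  asrc :: "'a \<Rightarrow> 'o"
  atrg :: "'a \<Rightarrow> 'o"
  csrc :: "'c \<Rightarrow> 'a"
  ctrg :: "'c \<Rightarrow> 'a"
  ide1 :: "'o \<Rightarrow> 'a"  (\<open>\<one>\<^sub>1\<index> _\<close> [90] 90)
  ide2 :: "'a \<Rightarrow> 'c"  (\<open>\<one>\<^sub>2\<index> _\<close> [90] 90)
  acomp :: "'a \<Rightarrow> 'a \<Rightarrow> 'a"  (infixl \<open>\<sharp>\<^sub>1\<index>\<close> 70)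
  hcomp :: "'c \<Rightarrow> 'c \<Rightarrow> 'c"  (infixl \<open>\<sharp>\<^sub>2\<index>\<close> 70)
  vcomp :: "'c \<Rightarrow> 'c \<Rightarrow> 'c"  (infixl \<open>\<bullet>\<index>\<close> 65)

definition arrow_cat :: "('o, 'a, 'c, 'x) two_cat_scheme \<Rightarrow> ('o, 'a) cat" where
  "arrow_cat C = \<lparr>Ob = Obj C, Mor = Arr C, Dom = asrc C, Cod = atrg C,
     Idt = ide1 C, Cmp = acomp C\<rparr>"

definition vertical_cat :: "('o, 'a, 'c, 'x) two_cat_scheme \<Rightarrow> ('a, 'c) cat" where
  "vertical_cat C = \<lparr>Ob = Arr C, Mor = Cell C, Dom = csrc C, Cod = ctrg C,
     Idt = ide2 C, Cmp = vcomp C\<rparr>"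

definition horizontal_cat :: "('o, 'a, 'c, 'x) two_cat_scheme \<Rightarrow> ('o, 'c) cat" where
  "horizontal_cat C = \<lparr>Ob = Obj C, Mor = Cell C, Dom = (\<lambda>S. asrc C (csrc C S)),
     Cod = (\<lambda>S. atrg C (csrc C S)), Idt = (\<lambda>X. ide2 C (ide1 C X)), Cmp = hcomp C\<rparr>"

locale two_category =
  fixes C :: "('o, 'a, 'c, 'x) two_cat_scheme" (structure)
  assumes arrow_category: "category (arrow_cat C)"
    and vertical_category: "category (vertical_cat C)"
    and horizontal_category: "category (horizontal_cat C)"
    and globular_src: "S \<in> Cell C \<Longrightarrow> asrc C (ctrg C S) = asrc C (csrc C S)"
    and globular_trg: "S \<in> Cell C \<Longrightarrow> atrg C (ctrg C S) = atrg C (csrc C S)"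
    and csrc_hcomp: "\<lbrakk>S \<in> Cell C; T \<in> Cell C; atrg C (csrc C S) = asrc C (csrc C T)\<rbrakk>
      \<Longrightarrow> csrc C (S \<sharp>\<^sub>2 T) = csrc C S \<sharp>\<^sub>1 csrc C T"
    and ctrg_hcomp: "\<lbrakk>S \<in> Cell C; T \<in> Cell C; atrg C (csrc C S) = asrc C (csrc C T)\<rbrakk>
      \<Longrightarrow> ctrg C (S \<sharp>\<^sub>2 T) = ctrg C S \<sharp>\<^sub>1 ctrg C T"
    and ide2_acomp: "\<lbrakk>f \<in> Arr C; g \<in> Arr C; atrg C f = asrc C g\<rbrakk>
      \<Longrightarrow> \<one>\<^sub>2 (f \<sharp>\<^sub>1 g) = \<one>\<^sub>2 f \<sharp>\<^sub>2 \<one>\<^sub>2 g"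
    and interchange: "\<lbrakk>S \<in> Cell C; S' \<in> Cell C; T \<in> Cell C; T' \<in> Cell C;
        ctrg C S = csrc C S'; ctrg C T = csrc C T'; atrg C (csrc C S) = asrc C (csrc C T)\<rbrakk>
      \<Longrightarrow> (S \<bullet> S') \<sharp>\<^sub>2 (T \<bullet> T') = (S \<sharp>\<^sub>2 T) \<bullet> (S' \<sharp>\<^sub>2 T')"

definition arrs :: "('o, 'a, 'c, 'x) two_cat_scheme \<Rightarrow> 'o \<Rightarrow> 'o \<Rightarrow> 'a set" where
  "arrs C X Y = {f \<in> Arr C. asrc C f = X \<and> atrg C f = Y}"

definition cells :: "('o, 'a, 'c, 'x) two_cat_scheme \<Rightarrow> 'a \<Rightarrow> 'a \<Rightarrow> 'c set" where
  "cells C f g = {S \<in> Cell C. csrc C S = f \<and> ctrg C S = g}"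

definition hom_cat :: "('o, 'a, 'c, 'x) two_cat_scheme \<Rightarrow> 'o \<Rightarrow> 'o \<Rightarrow> ('a, 'c) cat" where
  "hom_cat C X Y = (vertical_cat C)
     \<lparr>Ob := arrs C X Y, Mor := {S \<in> Cell C. csrc C S \<in> arrs C X Y \<and> ctrg C S \<in> arrs C X Y}\<rparr>"

definition invertible_cell :: "('o, 'a, 'c, 'x) two_cat_scheme \<Rightarrow> 'c \<Rightarrow> bool" where
  "invertible_cell C S \<longleftrightarrow> is_iso (vertical_cat C) S"

definition inverse_cell :: "('o, 'a, 'c, 'x) two_cat_scheme \<Rightarrow> 'c \<Rightarrow> 'c" where
  "inverse_cell C S = inverse_mor (vertical_cat C) S"

definition pseudo_inverse :: "('o, 'a, 'c, 'x) two_cat_scheme \<Rightarrow> 'a \<Rightarrow> 'a \<Rightarrow> bool" where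
  "pseudo_inverse C f g \<longleftrightarrow>
     f \<in> Arr C \<and> g \<in> arrs C (atrg C f) (asrc C f) \<and>
     (\<exists>\<eta> \<epsilon>.
        \<eta> \<in> cells C (ide1 C (asrc C f)) (acomp C f g) \<and> invertible_cell C \<eta> \<and>
        \<epsilon> \<in> cells C (acomp C g f) (ide1 C (atrg C f)) \<and> invertible_cell C \<epsilon> \<and>
        vcomp C (hcomp C \<eta> (ide2 C f)) (hcomp C (ide2 C f) \<epsilon>) = ide2 C f \<and>
        vcomp C (hcomp C (ide2 C g) \<eta>) (hcomp C \<epsilon> (ide2 C g)) = ide2 C g)"

definition equi_arrow :: "('o, 'a, 'c, 'x) two_cat_scheme \<Rightarrow> 'a \<Rightarrow> bool" where
  "equi_arrow C f \<longleftrightarrow> (\<exists>g. pseudo_inverse C f g)"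

definition strict_2functor ::
  "('o, 'a, 'c, 'x) two_cat_scheme \<Rightarrow> ('p, 'b, 'd, 'y) two_cat_scheme \<Rightarrow>
   ('o \<Rightarrow> 'p) \<Rightarrow> ('a \<Rightarrow> 'b) \<Rightarrow> ('c \<Rightarrow> 'd) \<Rightarrow> bool" where
  "strict_2functor C D F0 F1 F2 \<longleftrightarrow>
     is_functor (arrow_cat C) (arrow_cat D) F0 F1 \<and>
     is_functor (vertical_cat C) (vertical_cat D) F1 F2 \<and>
     is_functor (horizontal_cat C) (horizontal_cat D) F0 F2"

definition fully_faithful_2functor ::
  "('o, 'a, 'c, 'x) two_cat_scheme \<Rightarrow> ('p, 'b, 'd, 'y) two_cat_scheme \<Rightarrow>
   ('o \<Rightarrow> 'p) \<Rightarrow> ('a \<Rightarrow> 'b) \<Rightarrow> ('c \<Rightarrow> 'd) \<Rightarrow> bool" where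
  "fully_faithful_2functor C D F0 F1 F2 \<longleftrightarrow>
     strict_2functor C D F0 F1 F2 \<and>
     (\<forall>X\<in>Obj C. \<forall>Y\<in>Obj C. is_equivalence (hom_cat C X Y) (hom_cat D (F0 X) (F0 Y)) F1 F2)"

definition prod_two_cat ::
  "('o, 'a, 'c, 'x) two_cat_scheme \<Rightarrow> ('p, 'b, 'd, 'y) two_cat_scheme \<Rightarrow>
   ('o \<times> 'p, 'a \<times> 'b, 'c \<times> 'd) two_cat" where
  "prod_two_cat C D = \<lparr>
     Obj = Obj C \<times> Obj D,
     Arr = Arr C \<times> Arr D,
     Cell = Cell C \<times> Cell D,
     asrc = map_prod (asrc C) (asrc D),
     atrg = map_prod (atrg C) (atrg D),
     csrc = map_prod (csrc C) (csrc D),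
     ctrg = map_prod (ctrg C) (ctrg D),
     ide1 = map_prod (ide1 C) (ide1 D),
     ide2 = map_prod (ide2 C) (ide2 D),
     acomp = (\<lambda>(f, f') (g, g'). (acomp C f g, acomp D f' g')),
     hcomp = (\<lambda>(S, S') (T, T'). (hcomp C S T, hcomp D S' T')),
     vcomp = (\<lambda>(S, S') (T, T'). (vcomp C S T, vcomp D S' T'))\<rparr>"

section \<open>Semi-monoidal 2-categories and unit objects\<close>

record ('o, 'a, 'c) semi_monoidal_2cat = "('o, 'a, 'c) two_cat" +
  tens0 :: "'o \<Rightarrow> 'o \<Rightarrow> 'o"  (infixl \<open>\<otimes>\<^sub>0\<index>\<close> 80)
  tens1 :: "'a \<Rightarrow> 'a \<Rightarrow> 'a"  (infixl \<open>\<otimes>\<^sub>1\<index>\<close> 80)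
  tens2 :: "'c \<Rightarrow> 'c \<Rightarrow> 'c"  (infixl \<open>\<otimes>\<^sub>2\<index>\<close> 80)

locale semi_monoidal_2category = two_category C
  for C :: "('o, 'a, 'c, 'x) semi_monoidal_2cat_scheme" (structure) +
  assumes tensor_2functor: "strict_2functor (prod_two_cat C C) C
      (\<lambda>(X, Y). X \<otimes>\<^sub>0 Y) (\<lambda>(f, g). f \<otimes>\<^sub>1 g) (\<lambda>(S, T). S \<otimes>\<^sub>2 T)"
    and tens0_assoc: "\<lbrakk>X \<in> Obj C; Y \<in> Obj C; Z \<in> Obj C\<rbrakk>
      \<Longrightarrow> (X \<otimes>\<^sub>0 Y) \<otimes>\<^sub>0 Z = X \<otimes>\<^sub>0 (Y \<otimes>\<^sub>0 Z)"
    and tens1_assoc: "\<lbrakk>f \<in> Arr C; g \<in> Arr C; h \<in> Arr C\<rbrakk>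
      \<Longrightarrow> (f \<otimes>\<^sub>1 g) \<otimes>\<^sub>1 h = f \<otimes>\<^sub>1 (g \<otimes>\<^sub>1 h)"
    and tens2_assoc: "\<lbrakk>S \<in> Cell C; T \<in> Cell C; U \<in> Cell C\<rbrakk>
      \<Longrightarrow> (S \<otimes>\<^sub>2 T) \<otimes>\<^sub>2 U = S \<otimes>\<^sub>2 (T \<otimes>\<^sub>2 U)"

definition cancellable :: "('o, 'a, 'c, 'x) semi_monoidal_2cat_scheme \<Rightarrow> 'o \<Rightarrow> bool" where
  "cancellable C I \<longleftrightarrow> I \<in> Obj C \<and>
     fully_faithful_2functor C C
       (\<lambda>X. tens0 C I X) (\<lambda>f. tens1 C (ide1 C I) f) (\<lambda>S. tens2 C (ide2 C (ide1 C I)) S) \<and>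
     fully_faithful_2functor C C
       (\<lambda>X. tens0 C X I) (\<lambda>f. tens1 C f (ide1 C I)) (\<lambda>S. tens2 C S (ide2 C (ide1 C I)))"

definition unit_object :: "('o, 'a, 'c, 'x) semi_monoidal_2cat_scheme \<Rightarrow> 'o \<Rightarrow> 'a \<Rightarrow> bool" where
  "unit_object C I \<alpha> \<longleftrightarrow>
     cancellable C I \<and> \<alpha> \<in> arrs C (tens0 C I I) I \<and> equi_arrow C \<alpha>"

definition left_constraints ::
  "('o, 'a, 'c, 'x) semi_monoidal_2cat_scheme \<Rightarrow> 'o \<Rightarrow> 'a \<Rightarrow> ('o \<Rightarrow> 'a) \<Rightarrow> ('o \<Rightarrow> 'c) \<Rightarrow> bool" where
  "left_constraints C I \<alpha> l L \<longleftrightarrow> (\<forall>X\<in>Obj C.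
     l X \<in> arrs C (tens0 C I X) X \<and> equi_arrow C (l X) \<and>
     L X \<in> cells C (tens1 C (ide1 C I) (l X)) (tens1 C \<alpha> (ide1 C X)) \<and> invertible_cell C (L X))"

definition right_constraints ::
  "('o, 'a, 'c, 'x) semi_monoidal_2cat_scheme \<Rightarrow> 'o \<Rightarrow> 'a \<Rightarrow> ('o \<Rightarrow> 'a) \<Rightarrow> ('o \<Rightarrow> 'c) \<Rightarrow> bool" where
  "right_constraints C I \<alpha> r R \<longleftrightarrow> (\<forall>X\<in>Obj C.
     r X \<in> arrs C (tens0 C X I) X \<and> equi_arrow C (r X) \<and>
     R X \<in> cells C (tens1 C (ide1 C X) \<alpha>) (tens1 C (r X) (ide1 C I)) \<and> invertible_cell C (R X))"

text \<open>For left constraints \<open>l, L\<close> and right constraints \<open>r, R\<close>, the arrows \<open>l I\<close> and \<open>r I\<close> do not occur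
  explicitly in the equation below: they only enter through the arrow
  \<open>\<one>\<^sub>1 (I \<otimes>\<^sub>0 I) \<otimes>\<^sub>1 l I \<sharp>\<^sub>1 r I \<otimes>\<^sub>1 \<one>\<^sub>1 I = r I \<otimes>\<^sub>1 \<one>\<^sub>1 (I \<otimes>\<^sub>0 I) \<sharp>\<^sub>1 \<one>\<^sub>1 I \<otimes>\<^sub>1 l I\<close>
  at which the vertical composition takes place. The two sides agree by functoriality of the tensor
  product.\<close>

definition is_associator_cell ::
  "('o, 'a, 'c, 'x) semi_monoidal_2cat_scheme \<Rightarrow> 'o \<Rightarrow> 'a \<Rightarrow> ('o \<Rightarrow> 'c) \<Rightarrow> ('o \<Rightarrow> 'c) \<Rightarrow> 'c \<Rightarrow> bool"
  where
  "is_associator_cell C I \<alpha> L R A \<longleftrightarrow>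
     A \<in> cells C (tens1 C (ide1 C I) \<alpha>) (tens1 C \<alpha> (ide1 C I)) \<and>
     vcomp C
       (hcomp C (tens2 C (ide2 C (ide1 C I)) (inverse_cell C (L I))) (R I))
       (hcomp C (tens2 C (inverse_cell C (R I)) (ide2 C (ide1 C I))) (L I))
     = hcomp C (ide2 C (tens1 C (tens1 C (ide1 C I) \<alpha>) (ide1 C I))) A"

end

theory Submission
  imports Defs
begin

text \<open>Choosing constraints, one finds some invertible 2-cell \<open>I\<alpha> \<Rightarrow> \<alpha>I\<close>, so that \<open>\<alpha>\<close> itself can serve
  as left constraint. The naturality cell of the left constraint at \<open>\<alpha>\<close> has the form \<open>V \<sharp> \<alpha>\<close>, where
  \<open>V : I\<alpha> \<Rightarrow> \<alpha>I\<close> satisfies \<open>(IV \<sharp> I\<alpha>) \<bullet> (VI \<sharp> I\<alpha>) = II\<alpha> \<sharp> V\<close>. Functoriality of naturality cells yields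
  the pentagon for \<open>V\<close>. Cancelling against the displayed equation leaves
  \<open>I\<alpha>I \<sharp> V = (VI \<sharp> I\<alpha>) \<bullet> (IV \<sharp> \<alpha>I)\<close>, which is the defining equation of \<open>A\<close> for the constraints
  \<open>\<lambda> = \<rho> = \<alpha>\<close>, \<open>L = R = V\<close>. Any other constraints at \<open>I\<close> have the form \<open>L = Iu \<bullet> V\<close>, \<open>R = V \<bullet> vI\<close>, and
  \<open>u\<close>, \<open>v\<close> cancel by interchange; hence \<open>A = V\<close> always.\<close>

section \<open>Categories and equivalences\<close>

text \<open>Give I, II, III the left constraints \<alpha>, \<alpha>I, \<alpha>II with 2-cells V, VI,
  VII as L. The naturality cell N_f : If # \<lambda>_Y \<Rightarrow> \<lambda>_X # f of an arrow f :
  X \<rightarrow> Y is then characterised by I(N_f) \<bullet> (L_X # If) = IIf # L_Y. For f =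
  \<alpha> this is exactly the equation imposed on V, with N_f = V # \<alpha>. The cell at \<alpha>I
  is the one at \<alpha> tensored with I, and the cell at I\<alpha> is an identity by interchange.
  The pentagon says that the composite cells along I\<alpha> # \<alpha> and \<alpha>I # \<alpha> are
  compatible with the 2-cell V # \<alpha> between these two arrows. No transformation \<lambda> is
  constructed. An identity between such cells is tensored with I, followed by an invertible L_X,
  checked through the characterisation, and the additions are cancelled. Hence the arrows on up to
  five copies of I, and hence the preparation: tensoring with I and whiskering by an equi-arrow must
  be faithful on 2-cells and must lift invertible 2-cells.\<close>

context category
begin

lemma iso_Mor: "is_iso C f \<Longrightarrow> f \<in> Mor C"
  by (auto simp: is_iso_def mutually_inverse_def)

lemma inverse_unique:
  assumes "mutually_inverse C f g" "mutually_inverse C f h"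
  shows "g = h"
proof -
  have f: "f \<in> Mor C" "g \<in> Mor C" "h \<in> Mor C"
    and d: "Dom C g = Cod C f" "Cod C g = Dom C f" "Dom C h = Cod C f" "Cod C h = Dom C f"
    and e: "Cmp C g f = Idt C (Cod C f)" "Cmp C f h = Idt C (Dom C f)"
    using assms by (auto simp: mutually_inverse_def)
  have "g = Cmp C g (Cmp C f h)"
    using Idt_right[of g] f d e by simp
  also have "\<dots> = Cmp C (Cmp C g f) h"
    using Cmp_assoc[of g f h] f d by simp
  also have "\<dots> = h"
    using Idt_left[of h] f d e by simp
  finally show ?thesis .
qed

lemma inverse_mor_inverse:
  assumes "is_iso C f"
  shows "mutually_inverse C f (inverse_mor C f)"
  using assms unfolding is_iso_def inverse_mor_def
  by (metis inverse_unique theI)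

lemma inverse_mor_eqI: "mutually_inverse C f g \<Longrightarrow> inverse_mor C f = g"
  using inverse_unique inverse_mor_inverse is_iso_def by metis

lemma iso_cancel_right:
  assumes "is_iso C u" "f \<in> Mor C" "g \<in> Mor C" "Cod C f = Dom C u" "Cod C g = Dom C u"
    and "Cmp C f u = Cmp C g u"
  shows "f = g"
proof -
  obtain v where v: "v \<in> Mor C" "u \<in> Mor C" "Dom C v = Cod C u" "Cod C v = Dom C u"
    "Cmp C u v = Idt C (Dom C u)"
    using assms(1) by (auto simp: is_iso_def mutually_inverse_def)
  show ?thesis
    using Cmp_assoc[of f u v] Cmp_assoc[of g u v] Idt_right[of f] Idt_right[of g] v assms
    by metis
qed

lemma iso_cancel_left:
  assumes "is_iso C u" "f \<in> Mor C" "g \<in> Mor C" "Dom C f = Cod C u" "Dom C g = Cod C u"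
    and "Cmp C u f = Cmp C u g"
  shows "f = g"
proof -
  obtain v where v: "v \<in> Mor C" "u \<in> Mor C" "Dom C v = Cod C u" "Cod C v = Dom C u"
    "Cmp C v u = Idt C (Cod C u)"
    using assms(1) by (auto simp: is_iso_def mutually_inverse_def)
  show ?thesis
    using Cmp_assoc[of v u f] Cmp_assoc[of v u g] Idt_left[of f] Idt_left[of g] v assms
    by metis
qed

end

locale cat_equivalence = C: category C + D: category D
  for C :: "('o, 'm, 'x) cat_scheme" and D :: "('p, 'n, 'y) cat_scheme" +
  fixes FO FM
  assumes equivalence: "is_equivalence C D FO FM"
begin

text \<open>By naturality of the unit, an arrow followed by an isomorphism is determined by its
  image under \<open>GM \<circ> FM\<close>.\<close>

lemma faithful:
  assumes "f \<in> Mor C" "g \<in> Mor C" "Dom C f = Dom C g" "Cod C f = Cod C g" "FM f = FM g"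
  shows "f = g"
proof -
  obtain GO GM \<eta> where n: "is_natural_iso C C id id (GO \<circ> FO) (GM \<circ> FM) \<eta>"
    using equivalence by (auto simp: is_equivalence_def)
  have nat: "Cmp C f (\<eta> (Cod C f)) = Cmp C (\<eta> (Dom C f)) (GM (FM f))" if "f \<in> Mor C" for f
    using n that by (auto simp: is_natural_iso_def)
  have "is_iso C (\<eta> (Cod C f))" "Dom C (\<eta> (Cod C f)) = Cod C f"
    using n C.Cod_closed[OF assms(1)] by (auto simp: is_natural_iso_def)
  then show ?thesis
    using C.iso_cancel_right[of "\<eta> (Cod C f)" f g] nat assms by metis
qed

lemma essentially_surjective:
  assumes "Y \<in> Ob D"
  obtains X e where "X \<in> Ob C" "is_iso D e" "Dom D e = FO X" "Cod D e = Y"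
proof -
  obtain GO GM \<epsilon> where "is_functor D C GO GM" "is_natural_iso D D (FO \<circ> GO) (FM \<circ> GM) id id \<epsilon>"
    using equivalence by (auto simp: is_equivalence_def)
  then have "GO Y \<in> Ob C" "is_iso D (\<epsilon> Y)" "Dom D (\<epsilon> Y) = FO (GO Y)" "Cod D (\<epsilon> Y) = Y"
    using assms by (auto simp: is_functor_def is_natural_iso_def)
  then show ?thesis
    using that by blast
qed

lemma full:
  assumes "X \<in> Ob C" "Y \<in> Ob C" "h \<in> Mor D" "Dom D h = FO X" "Cod D h = FO Y"
  obtains f where "f \<in> Mor C" "Dom C f = X" "Cod C f = Y" "FM f = h"
proof -
  obtain GO GM \<eta> \<epsilon> where F: "is_functor C D FO FM" and G: "is_functor D C GO GM"
    and n: "is_natural_iso C C id id (GO \<circ> FO) (GM \<circ> FM) \<eta>"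
    and e: "is_natural_iso D D (FO \<circ> GO) (FM \<circ> GM) id id \<epsilon>"
    using equivalence by (auto simp: is_equivalence_def)
  have \<eta>: "is_iso C (\<eta> Z)" "Dom C (\<eta> Z) = Z" "Cod C (\<eta> Z) = GO (FO Z)" "\<eta> Z \<in> Mor C"
    if "Z \<in> Ob C" for Z
    using n that C.iso_Mor by (auto simp: is_natural_iso_def)
  have \<epsilon>: "is_iso D (\<epsilon> Z)" "Dom D (\<epsilon> Z) = FO (GO Z)" "Cod D (\<epsilon> Z) = Z" "\<epsilon> Z \<in> Mor D"
    if "Z \<in> Ob D" for Z
    using e that D.iso_Mor by (auto simp: is_natural_iso_def)
  obtain v where v: "v \<in> Mor C" "Dom C v = GO (FO Y)" "Cod C v = Y"
    "Cmp C v (\<eta> Y) = Idt C (GO (FO Y))"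
    using \<eta>[OF assms(2)] by (auto simp: is_iso_def mutually_inverse_def)
  have Gh: "GM h \<in> Mor C" "Dom C (GM h) = GO (FO X)" "Cod C (GM h) = GO (FO Y)"
    using G assms by (auto simp: is_functor_def)
  \<comment> \<open>The transpose of h: its image under the quasi-inverse, conjugated by the unit,
    with v inverse to \<open>\<eta> Y\<close>.\<close>
  define f where "f = Cmp C (\<eta> X) (Cmp C (GM h) v)"
  have hv: "Cmp C (GM h) v \<in> Mor C" "Dom C (Cmp C (GM h) v) = GO (FO X)"
    "Cod C (Cmp C (GM h) v) = Y"
    using Gh v C.Cmp_closed C.Dom_Cmp C.Cod_Cmp by auto
  have f: "f \<in> Mor C" "Dom C f = X" "Cod C f = Y"
    unfolding f_def using hv \<eta>[OF assms(1)] C.Cmp_closed C.Dom_Cmp C.Cod_Cmp by auto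
  have Ff: "FM f \<in> Mor D" "Dom D (FM f) = FO X" "Cod D (FM f) = FO Y"
    using F f by (auto simp: is_functor_def)
  have GFf: "GM (FM f) \<in> Mor C" "Dom C (GM (FM f)) = GO (FO X)" "Cod C (GM (FM f)) = GO (FO Y)"
    using G Ff by (auto simp: is_functor_def)
  have "Cmp C (\<eta> X) (GM (FM f)) = Cmp C f (\<eta> Y)"
    using n f by (auto simp: is_natural_iso_def)
  also have "\<dots> = Cmp C (\<eta> X) (Cmp C (Cmp C (GM h) v) (\<eta> Y))"
    unfolding f_def using C.Cmp_assoc \<eta> hv assms by auto
  also have "Cmp C (Cmp C (GM h) v) (\<eta> Y) = GM h"
    using C.Cmp_assoc[of "GM h" v "\<eta> Y"] \<eta> v Gh assms C.Idt_right[of "GM h"] by auto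
  finally have "Cmp C (\<eta> X) (GM (FM f)) = Cmp C (\<eta> X) (GM h)" .
  then have G_eq: "GM (FM f) = GM h"
    using C.iso_cancel_left[of "\<eta> X" "GM (FM f)" "GM h"] \<eta> assms GFf Gh by auto
  \<comment> \<open>Naturality of the counit shows that the quasi-inverse is faithful too, so
    \<open>G_eq\<close> determines \<open>FM f\<close>.\<close>
  have nat: "Cmp D (FM (GM k)) (\<epsilon> (Cod D k)) = Cmp D (\<epsilon> (Dom D k)) k" if "k \<in> Mor D" for k
    using e that by (auto simp: is_natural_iso_def)
  have "FO X \<in> Ob D"
    using F assms by (auto simp: is_functor_def)
  then have "FM f = h"
    using D.iso_cancel_left[of "\<epsilon> (FO X)" "FM f" h] \<epsilon> nat[of "FM f"] nat[of h] G_eq Ff assms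
    by auto
  then show ?thesis
    using that f by blast
qed

end

section \<open>Cells and whiskering in a 2-category\<close>

lemmas cell_simps = cells_def arrs_def

context two_category
begin

lemmas asrc_Obj [simp] = category.Dom_closed[OF arrow_category, unfolded arrow_cat_def, simplified]
lemmas atrg_Obj [simp] = category.Cod_closed[OF arrow_category, unfolded arrow_cat_def, simplified]
lemmas ide1_Arr [simp] = category.Idt_closed[OF arrow_category, unfolded arrow_cat_def, simplified]
lemmas asrc_ide1 [simp] = category.Dom_Idt[OF arrow_category, unfolded arrow_cat_def, simplified]
lemmas atrg_ide1 [simp] = category.Cod_Idt[OF arrow_category, unfolded arrow_cat_def, simplified]
lemmas acomp_Arr [simp] = category.Cmp_closed[OF arrow_category, unfolded arrow_cat_def, simplified]
lemmas asrc_acomp [simp] = category.Dom_Cmp[OF arrow_category, unfolded arrow_cat_def, simplified]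
lemmas atrg_acomp [simp] = category.Cod_Cmp[OF arrow_category, unfolded arrow_cat_def, simplified]
lemmas ide1_acomp = category.Idt_left[OF arrow_category, unfolded arrow_cat_def, simplified]
lemmas acomp_ide1 = category.Idt_right[OF arrow_category, unfolded arrow_cat_def, simplified]
lemmas acomp_assoc [simp] = category.Cmp_assoc[OF arrow_category, unfolded arrow_cat_def, simplified]

lemmas csrc_Arr [simp] = category.Dom_closed[OF vertical_category, unfolded vertical_cat_def, simplified]
lemmas ctrg_Arr [simp] = category.Cod_closed[OF vertical_category, unfolded vertical_cat_def, simplified]
lemmas ide2_Cell [simp] = category.Idt_closed[OF vertical_category, unfolded vertical_cat_def, simplified]
lemmas csrc_ide2 [simp] = category.Dom_Idt[OF vertical_category, unfolded vertical_cat_def, simplified]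
lemmas ctrg_ide2 [simp] = category.Cod_Idt[OF vertical_category, unfolded vertical_cat_def, simplified]
lemmas vcomp_Cell [simp] = category.Cmp_closed[OF vertical_category, unfolded vertical_cat_def, simplified]
lemmas csrc_vcomp [simp] = category.Dom_Cmp[OF vertical_category, unfolded vertical_cat_def, simplified]
lemmas ctrg_vcomp [simp] = category.Cod_Cmp[OF vertical_category, unfolded vertical_cat_def, simplified]
lemmas ide2_vcomp = category.Idt_left[OF vertical_category, unfolded vertical_cat_def, simplified]
lemmas vcomp_ide2 = category.Idt_right[OF vertical_category, unfolded vertical_cat_def, simplified]
lemmas vcomp_assoc = category.Cmp_assoc[OF vertical_category, unfolded vertical_cat_def, simplified]

lemmas hcomp_Cell [simp] = category.Cmp_closed[OF horizontal_category, unfolded horizontal_cat_def, simplified]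
lemmas ide_hcomp = category.Idt_left[OF horizontal_category, unfolded horizontal_cat_def, simplified]
lemmas hcomp_ide = category.Idt_right[OF horizontal_category, unfolded horizontal_cat_def, simplified]
lemmas hcomp_assoc = category.Cmp_assoc[OF horizontal_category, unfolded horizontal_cat_def, simplified]

declare globular_src [simp] globular_trg [simp] csrc_hcomp [simp] ctrg_hcomp [simp]

lemma ide1_acomp' [simp]: "\<lbrakk>f \<in> Arr C; asrc C f = X\<rbrakk> \<Longrightarrow> \<one>\<^sub>1 X \<sharp>\<^sub>1 f = f"
  and acomp_ide1' [simp]: "\<lbrakk>f \<in> Arr C; atrg C f = X\<rbrakk> \<Longrightarrow> f \<sharp>\<^sub>1 \<one>\<^sub>1 X = f"
  and ide2_vcomp' [simp]: "\<lbrakk>S \<in> Cell C; csrc C S = f\<rbrakk> \<Longrightarrow> \<one>\<^sub>2 f \<bullet> S = S"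
  and vcomp_ide2' [simp]: "\<lbrakk>S \<in> Cell C; ctrg C S = f\<rbrakk> \<Longrightarrow> S \<bullet> \<one>\<^sub>2 f = S"
  and ide_hcomp' [simp]: "\<lbrakk>S \<in> Cell C; asrc C (csrc C S) = X\<rbrakk> \<Longrightarrow> \<one>\<^sub>2 (\<one>\<^sub>1 X) \<sharp>\<^sub>2 S = S"
  and hcomp_ide' [simp]: "\<lbrakk>S \<in> Cell C; atrg C (csrc C S) = X\<rbrakk> \<Longrightarrow> S \<sharp>\<^sub>2 \<one>\<^sub>2 (\<one>\<^sub>1 X) = S"
  using ide1_acomp acomp_ide1 ide2_vcomp vcomp_ide2 ide_hcomp hcomp_ide by auto

lemma hom_category: "category (hom_cat C X Y)"
  by unfold_locales (auto simp: hom_cat_def vertical_cat_def arrs_def vcomp_assoc)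

section \<open>Invertible 2-cells\<close>

lemma invertible_cellI:
  assumes "S \<in> cells C f g" "T \<in> cells C g f" "S \<bullet> T = \<one>\<^sub>2 f" "T \<bullet> S = \<one>\<^sub>2 g"
  shows "invertible_cell C S" "inverse_cell C S = T"
proof -
  have "mutually_inverse (vertical_cat C) S T"
    using assms by (auto simp: mutually_inverse_def vertical_cat_def cells_def)
  then show "invertible_cell C S" "inverse_cell C S = T"
    using category.inverse_mor_eqI[OF vertical_category]
    by (auto simp: invertible_cell_def inverse_cell_def is_iso_def)
qed

lemma inverse_cell:
  assumes "invertible_cell C S" "S \<in> cells C f g"
  shows "inverse_cell C S \<in> cells C g f" "S \<bullet> inverse_cell C S = \<one>\<^sub>2 f"
    "inverse_cell C S \<bullet> S = \<one>\<^sub>2 g"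
  using category.inverse_mor_inverse[OF vertical_category, of S] assms
  by (auto simp: mutually_inverse_def vertical_cat_def cells_def invertible_cell_def inverse_cell_def)

lemma invertible_cellE:
  assumes "invertible_cell C S" "S \<in> cells C f g"
  obtains T where "T \<in> cells C g f" "S \<bullet> T = \<one>\<^sub>2 f" "T \<bullet> S = \<one>\<^sub>2 g"
  using inverse_cell[OF assms] by blast

lemma invertible_ide2: "f \<in> Arr C \<Longrightarrow> invertible_cell C (\<one>\<^sub>2 f)"
  by (rule invertible_cellI[of _ f f "\<one>\<^sub>2 f"]) (auto simp: cells_def)

lemma invertible_vcomp:
  assumes "invertible_cell C S" "invertible_cell C T" "S \<in> cells C f g" "T \<in> cells C g h"
  shows "invertible_cell C (S \<bullet> T)"
proof -
  obtain S' T' where *: "S' \<in> cells C g f" "S \<bullet> S' = \<one>\<^sub>2 f" "S' \<bullet> S = \<one>\<^sub>2 g"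
    "T' \<in> cells C h g" "T \<bullet> T' = \<one>\<^sub>2 g" "T' \<bullet> T = \<one>\<^sub>2 h"
    using assms by (metis invertible_cellE)
  have "(S \<bullet> T) \<bullet> (T' \<bullet> S') = S \<bullet> ((T \<bullet> T') \<bullet> S')" "(T' \<bullet> S') \<bullet> (S \<bullet> T) = T' \<bullet> ((S' \<bullet> S) \<bullet> T)"
    using *(1,4) assms(3,4) by (auto simp: cells_def vcomp_assoc)
  then have "(S \<bullet> T) \<bullet> (T' \<bullet> S') = \<one>\<^sub>2 f" "(T' \<bullet> S') \<bullet> (S \<bullet> T) = \<one>\<^sub>2 h"
    unfolding * using * assms(3,4) by (simp_all add: cells_def)
  then show ?thesis
    using *(1,4) assms(3,4) by (intro invertible_cellI[of _ f h "T' \<bullet> S'"]) (auto simp: cells_def)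
qed

lemma invertible_hcomp:
  assumes "invertible_cell C S" "invertible_cell C T" "S \<in> cells C f g" "T \<in> cells C h k"
    "atrg C f = asrc C h"
  shows "invertible_cell C (S \<sharp>\<^sub>2 T)"
proof -
  obtain S' T' where *: "S' \<in> cells C g f" "S \<bullet> S' = \<one>\<^sub>2 f" "S' \<bullet> S = \<one>\<^sub>2 g"
    "T' \<in> cells C k h" "T \<bullet> T' = \<one>\<^sub>2 h" "T' \<bullet> T = \<one>\<^sub>2 k"
    using assms by (metis invertible_cellE)
  have [simp]: "asrc C g = asrc C f" "atrg C g = atrg C f" "asrc C k = asrc C h" "atrg C k = atrg C h"
    using assms globular_src[of S] globular_trg[of S] globular_src[of T] globular_trg[of T]
    by (auto simp: cells_def)
  have "(S \<sharp>\<^sub>2 T) \<bullet> (S' \<sharp>\<^sub>2 T') = (S \<bullet> S') \<sharp>\<^sub>2 (T \<bullet> T')"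
    "(S' \<sharp>\<^sub>2 T') \<bullet> (S \<sharp>\<^sub>2 T) = (S' \<bullet> S) \<sharp>\<^sub>2 (T' \<bullet> T)"
    using *(1,4) assms(3-5) by (auto simp: cells_def interchange)
  then show ?thesis
    unfolding * using *(1,4) assms(3-5)
    by (intro invertible_cellI[of _ "f \<sharp>\<^sub>1 h" "g \<sharp>\<^sub>1 k" "S' \<sharp>\<^sub>2 T'"]) (auto simp: cells_def ide2_acomp)
qed

lemma invertible_cancel_right:
  assumes "invertible_cell C U" "S \<in> cells C f g" "T \<in> cells C f g" "U \<in> cells C g h"
    "S \<bullet> U = T \<bullet> U"
  shows "S = T"
  using category.iso_cancel_right[OF vertical_category, of U S T] assms
  by (auto simp: vertical_cat_def invertible_cell_def cells_def)

lemma invertible_cancel_left: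
  assumes "invertible_cell C U" "S \<in> cells C g h" "T \<in> cells C g h" "U \<in> cells C f g"
    "U \<bullet> S = U \<bullet> T"
  shows "S = T"
  using category.iso_cancel_left[OF vertical_category, of U S T] assms
  by (auto simp: vertical_cat_def invertible_cell_def cells_def)

lemma whisker_left_vcomp:
  assumes "f \<in> Arr C" "S \<in> Cell C" "T \<in> Cell C" "ctrg C S = csrc C T" "atrg C f = asrc C (csrc C S)"
  shows "\<one>\<^sub>2 f \<sharp>\<^sub>2 (S \<bullet> T) = (\<one>\<^sub>2 f \<sharp>\<^sub>2 S) \<bullet> (\<one>\<^sub>2 f \<sharp>\<^sub>2 T)"
  using interchange[of "\<one>\<^sub>2 f" "\<one>\<^sub>2 f" S T] assms by simp

lemma whisker_right_vcomp:
  assumes "f \<in> Arr C" "S \<in> Cell C" "T \<in> Cell C" "ctrg C S = csrc C T" "atrg C (csrc C S) = asrc C f"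
  shows "(S \<bullet> T) \<sharp>\<^sub>2 \<one>\<^sub>2 f = (S \<sharp>\<^sub>2 \<one>\<^sub>2 f) \<bullet> (T \<sharp>\<^sub>2 \<one>\<^sub>2 f)"
  using interchange[of S T "\<one>\<^sub>2 f" "\<one>\<^sub>2 f"] assms by simp

text \<open>Interchange with identities on either side. Equating the two readings of S # T gives the
  rule for sliding one 2-cell past another.\<close>

lemma hcomp_eq_left_right:
  assumes "S \<in> cells C f g" "T \<in> cells C h k" "atrg C f = asrc C h"
  shows "(S \<sharp>\<^sub>2 \<one>\<^sub>2 h) \<bullet> (\<one>\<^sub>2 g \<sharp>\<^sub>2 T) = S \<sharp>\<^sub>2 T"
    and "(\<one>\<^sub>2 f \<sharp>\<^sub>2 T) \<bullet> (S \<sharp>\<^sub>2 \<one>\<^sub>2 k) = S \<sharp>\<^sub>2 T"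
  using interchange[of S "\<one>\<^sub>2 g" "\<one>\<^sub>2 h" T] interchange[of "\<one>\<^sub>2 f" S T "\<one>\<^sub>2 k"] assms
  by (auto simp: cells_def)

section \<open>Whiskering by an equi-arrow is fully faithful on 2-cells\<close>

lemma equi_arrowE:
  assumes "equi_arrow C f"
  obtains g \<eta> \<epsilon> where "f \<in> Arr C" "g \<in> arrs C (atrg C f) (asrc C f)"
    "\<eta> \<in> cells C (\<one>\<^sub>1 (asrc C f)) (f \<sharp>\<^sub>1 g)" "invertible_cell C \<eta>"
    "\<epsilon> \<in> cells C (g \<sharp>\<^sub>1 f) (\<one>\<^sub>1 (atrg C f))" "invertible_cell C \<epsilon>"
  using assms by (auto simp: equi_arrow_def pseudo_inverse_def)

text \<open>The invertible \<open>\<epsilon>\<close> slides past S, so S can be recovered from (g #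
  f) # S, which depends only on f # S. The single comparison cell makes the statement applicable to
  f and, through an inverse of the unit, to its pseudo-inverse.\<close>

lemma faithful_whisker_left_aux:
  assumes "f \<in> Arr C" "g \<in> arrs C (atrg C f) (asrc C f)" "invertible_cell C \<epsilon>"
    "\<epsilon> \<in> cells C (g \<sharp>\<^sub>1 f) (\<one>\<^sub>1 (atrg C f))"
    "S \<in> cells C h k" "T \<in> cells C h k" "asrc C h = atrg C f"
    "\<one>\<^sub>2 f \<sharp>\<^sub>2 S = \<one>\<^sub>2 f \<sharp>\<^sub>2 T"
  shows "S = T"
proof -
  note [simp] = assms(1,7)
  have hk: "h \<in> Arr C" "k \<in> Arr C" "asrc C k = atrg C f"
    using assms(5) globular_src[of S] by (auto simp: cells_def)
  have eq: "\<one>\<^sub>2 (g \<sharp>\<^sub>1 f) \<sharp>\<^sub>2 U = \<one>\<^sub>2 g \<sharp>\<^sub>2 (\<one>\<^sub>2 f \<sharp>\<^sub>2 U)" if "U \<in> cells C h k" for U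
    using assms(2) that by (auto simp: cell_simps ide2_acomp hcomp_assoc)
  have nat: "(\<epsilon> \<sharp>\<^sub>2 \<one>\<^sub>2 h) \<bullet> U = (\<one>\<^sub>2 (g \<sharp>\<^sub>1 f) \<sharp>\<^sub>2 U) \<bullet> (\<epsilon> \<sharp>\<^sub>2 \<one>\<^sub>2 k)" if "U \<in> cells C h k" for U
    using hcomp_eq_left_right[OF assms(4) that] assms(2) that hk
    by (auto simp: cell_simps)
  have "(\<epsilon> \<sharp>\<^sub>2 \<one>\<^sub>2 h) \<bullet> S = (\<epsilon> \<sharp>\<^sub>2 \<one>\<^sub>2 h) \<bullet> T"
    using nat eq assms by metis
  moreover have "invertible_cell C (\<epsilon> \<sharp>\<^sub>2 \<one>\<^sub>2 h)" "\<epsilon> \<sharp>\<^sub>2 \<one>\<^sub>2 h \<in> cells C (g \<sharp>\<^sub>1 f \<sharp>\<^sub>1 h) h"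
    using assms(2,3,4) hk invertible_hcomp[OF assms(3) invertible_ide2[OF hk(1)] assms(4), of h h]
    by (auto simp: cell_simps)
  ultimately show ?thesis
    using invertible_cancel_left assms by blast
qed

lemma faithful_whisker_right_aux:
  assumes "f \<in> Arr C" "g \<in> arrs C (atrg C f) (asrc C f)" "invertible_cell C \<eta>"
    "\<eta> \<in> cells C (\<one>\<^sub>1 (asrc C f)) (f \<sharp>\<^sub>1 g)"
    "S \<in> cells C h k" "T \<in> cells C h k" "atrg C h = asrc C f"
    "S \<sharp>\<^sub>2 \<one>\<^sub>2 f = T \<sharp>\<^sub>2 \<one>\<^sub>2 f"
  shows "S = T"
proof -
  note [simp] = assms(1,7)
  have hk: "h \<in> Arr C" "k \<in> Arr C" "atrg C k = asrc C f"
    using assms(5) globular_trg[of S] by (auto simp: cells_def)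
  have eq: "U \<sharp>\<^sub>2 \<one>\<^sub>2 (f \<sharp>\<^sub>1 g) = (U \<sharp>\<^sub>2 \<one>\<^sub>2 f) \<sharp>\<^sub>2 \<one>\<^sub>2 g" if "U \<in> cells C h k" for U
    using assms(2) that by (auto simp: cell_simps ide2_acomp hcomp_assoc)
  have nat: "U \<bullet> (\<one>\<^sub>2 k \<sharp>\<^sub>2 \<eta>) = (\<one>\<^sub>2 h \<sharp>\<^sub>2 \<eta>) \<bullet> (U \<sharp>\<^sub>2 \<one>\<^sub>2 (f \<sharp>\<^sub>1 g))" if "U \<in> cells C h k" for U
    using hcomp_eq_left_right[OF that assms(4)] assms(2) that hk
    by (auto simp: cell_simps)
  have "S \<bullet> (\<one>\<^sub>2 k \<sharp>\<^sub>2 \<eta>) = T \<bullet> (\<one>\<^sub>2 k \<sharp>\<^sub>2 \<eta>)"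
    using nat eq assms by metis
  moreover have "invertible_cell C (\<one>\<^sub>2 k \<sharp>\<^sub>2 \<eta>)" "\<one>\<^sub>2 k \<sharp>\<^sub>2 \<eta> \<in> cells C k (k \<sharp>\<^sub>1 f \<sharp>\<^sub>1 g)"
    using assms(2,3,4) hk invertible_hcomp[OF invertible_ide2[OF hk(2)] assms(3) _ assms(4), of k k]
    by (auto simp: cell_simps)
  ultimately show ?thesis
    using invertible_cancel_right assms by blast
qed

lemma equi_whisker_left_inj:
  assumes "equi_arrow C f" "S \<in> cells C h k" "T \<in> cells C h k" "asrc C h = atrg C f"
    "\<one>\<^sub>2 f \<sharp>\<^sub>2 S = \<one>\<^sub>2 f \<sharp>\<^sub>2 T"
  shows "S = T"
  using assms by (elim equi_arrowE) (rule faithful_whisker_left_aux)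

lemma equi_whisker_right_inj:
  assumes "equi_arrow C f" "S \<in> cells C h k" "T \<in> cells C h k" "atrg C h = asrc C f"
    "S \<sharp>\<^sub>2 \<one>\<^sub>2 f = T \<sharp>\<^sub>2 \<one>\<^sub>2 f"
  shows "S = T"
  using assms by (elim equi_arrowE) (rule faithful_whisker_right_aux)

text \<open>The candidate \<open>T\<close> satisfies \<open>g \<sharp> (f \<sharp> T) = g \<sharp> S\<close>, and whiskering by the pseudo-inverse \<open>g\<close>
  is faithful as well.\<close>

lemma equi_whisker_left_surj:
  assumes "equi_arrow C f" "S \<in> cells C (f \<sharp>\<^sub>1 h) (f \<sharp>\<^sub>1 k)"
    "h \<in> arrs C (atrg C f) Y" "k \<in> arrs C (atrg C f) Y"
  obtains T where "T \<in> cells C h k" "\<one>\<^sub>2 f \<sharp>\<^sub>2 T = S"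
proof -
  obtain g \<eta> \<epsilon> where f: "f \<in> Arr C" and g: "g \<in> arrs C (atrg C f) (asrc C f)"
    and \<eta>: "\<eta> \<in> cells C (\<one>\<^sub>1 (asrc C f)) (f \<sharp>\<^sub>1 g)" "invertible_cell C \<eta>"
    and \<epsilon>: "\<epsilon> \<in> cells C (g \<sharp>\<^sub>1 f) (\<one>\<^sub>1 (atrg C f))" "invertible_cell C \<epsilon>"
    using equi_arrowE[OF assms(1)] by blast
  obtain \<epsilon>' where \<epsilon>': "\<epsilon>' \<in> cells C (\<one>\<^sub>1 (atrg C f)) (g \<sharp>\<^sub>1 f)" "\<epsilon> \<bullet> \<epsilon>' = \<one>\<^sub>2 (g \<sharp>\<^sub>1 f)"
    "\<epsilon>' \<bullet> \<epsilon> = \<one>\<^sub>2 (\<one>\<^sub>1 (atrg C f))"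
    using invertible_cellE[OF \<epsilon>(2,1)] by blast
  obtain \<eta>' where \<eta>': "\<eta>' \<in> cells C (f \<sharp>\<^sub>1 g) (\<one>\<^sub>1 (asrc C f))" "\<eta> \<bullet> \<eta>' = \<one>\<^sub>2 (\<one>\<^sub>1 (asrc C f))"
    "\<eta>' \<bullet> \<eta> = \<one>\<^sub>2 (f \<sharp>\<^sub>1 g)"
    using invertible_cellE[OF \<eta>(2,1)] by blast
  note defs = f g \<epsilon>(1) \<epsilon>'(1) assms(2-4)
  \<comment> \<open>The formula is forced: T is the conjugate by \<open>\<epsilon>\<close> of (g #
    f) # T, and this last cell has to be g # S.\<close>
  define T where "T = (\<epsilon>' \<sharp>\<^sub>2 \<one>\<^sub>2 h) \<bullet> ((\<one>\<^sub>2 g \<sharp>\<^sub>2 S) \<bullet> (\<epsilon> \<sharp>\<^sub>2 \<one>\<^sub>2 k))"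
  have T: "T \<in> cells C h k"
    using defs unfolding T_def by (auto simp: cell_simps)
  have hh: "(\<epsilon> \<sharp>\<^sub>2 \<one>\<^sub>2 h) \<bullet> (\<epsilon>' \<sharp>\<^sub>2 \<one>\<^sub>2 h) = \<one>\<^sub>2 (g \<sharp>\<^sub>1 f \<sharp>\<^sub>1 h)"
  proof -
    have "(\<epsilon> \<sharp>\<^sub>2 \<one>\<^sub>2 h) \<bullet> (\<epsilon>' \<sharp>\<^sub>2 \<one>\<^sub>2 h) = (\<epsilon> \<bullet> \<epsilon>') \<sharp>\<^sub>2 \<one>\<^sub>2 h"
      using interchange[of \<epsilon> \<epsilon>' "\<one>\<^sub>2 h" "\<one>\<^sub>2 h"] defs by (auto simp: cell_simps)
    then show ?thesis
      unfolding \<epsilon>'(2) using defs by (auto simp: cell_simps ide2_acomp hcomp_assoc)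
  qed
  have "(\<one>\<^sub>2 (g \<sharp>\<^sub>1 f) \<sharp>\<^sub>2 T) \<bullet> (\<epsilon> \<sharp>\<^sub>2 \<one>\<^sub>2 k) = (\<epsilon> \<sharp>\<^sub>2 \<one>\<^sub>2 h) \<bullet> T"
    using hcomp_eq_left_right[OF \<epsilon>(1) T] T defs by (auto simp: cell_simps)
  also have "\<dots> = ((\<epsilon> \<sharp>\<^sub>2 \<one>\<^sub>2 h) \<bullet> (\<epsilon>' \<sharp>\<^sub>2 \<one>\<^sub>2 h)) \<bullet> ((\<one>\<^sub>2 g \<sharp>\<^sub>2 S) \<bullet> (\<epsilon> \<sharp>\<^sub>2 \<one>\<^sub>2 k))"
    unfolding T_def using defs by (auto simp: cell_simps vcomp_assoc)
  also have "\<dots> = (\<one>\<^sub>2 g \<sharp>\<^sub>2 S) \<bullet> (\<epsilon> \<sharp>\<^sub>2 \<one>\<^sub>2 k)"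
    unfolding hh using defs by (auto simp: cell_simps)
  finally have 1: "(\<one>\<^sub>2 (g \<sharp>\<^sub>1 f) \<sharp>\<^sub>2 T) \<bullet> (\<epsilon> \<sharp>\<^sub>2 \<one>\<^sub>2 k) = (\<one>\<^sub>2 g \<sharp>\<^sub>2 S) \<bullet> (\<epsilon> \<sharp>\<^sub>2 \<one>\<^sub>2 k)" .
  have k: "k \<in> Arr C"
    using defs by (auto simp: cell_simps)
  have "invertible_cell C (\<epsilon> \<sharp>\<^sub>2 \<one>\<^sub>2 k)"
    using invertible_hcomp[OF \<epsilon>(2) invertible_ide2[OF k] \<epsilon>(1), of k k] defs by (auto simp: cell_simps)
  then have "\<one>\<^sub>2 (g \<sharp>\<^sub>1 f) \<sharp>\<^sub>2 T = \<one>\<^sub>2 g \<sharp>\<^sub>2 S"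
    using invertible_cancel_right[OF _ _ _ _ 1, of "g \<sharp>\<^sub>1 f \<sharp>\<^sub>1 h" "g \<sharp>\<^sub>1 f \<sharp>\<^sub>1 k" k] defs T
    by (auto simp: cell_simps)
  then have gT: "\<one>\<^sub>2 g \<sharp>\<^sub>2 (\<one>\<^sub>2 f \<sharp>\<^sub>2 T) = \<one>\<^sub>2 g \<sharp>\<^sub>2 S"
    using defs T by (auto simp: cell_simps ide2_acomp hcomp_assoc)
  have "\<one>\<^sub>2 f \<sharp>\<^sub>2 T = S"
  proof (rule faithful_whisker_left_aux[OF _ _ _ _ _ _ _ gT])
    show "invertible_cell C \<eta>'"
      using invertible_cellI(1)[OF \<eta>'(1) \<eta>(1)] \<eta>' by blast
    show "\<eta>' \<in> cells C (f \<sharp>\<^sub>1 g) (\<one>\<^sub>1 (atrg C g))"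
      using \<eta>' g by (auto simp: arrs_def)
    show "\<one>\<^sub>2 f \<sharp>\<^sub>2 T \<in> cells C (f \<sharp>\<^sub>1 h) (f \<sharp>\<^sub>1 k)"
      using T defs by (auto simp: cell_simps)
  qed (use defs in \<open>auto simp: cell_simps\<close>)
  then show ?thesis
    using T that by blast
qed

text \<open>The mirror image: T is the conjugate of S # g by \<open>\<eta>\<close>, and the whisker
  by g is cancelled by means of \<open>\<epsilon>'\<close>.\<close>

lemma equi_whisker_right_surj:
  assumes "equi_arrow C f" "S \<in> cells C (h \<sharp>\<^sub>1 f) (k \<sharp>\<^sub>1 f)"
    "h \<in> arrs C X (asrc C f)" "k \<in> arrs C X (asrc C f)"
  obtains T where "T \<in> cells C h k" "T \<sharp>\<^sub>2 \<one>\<^sub>2 f = S"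
proof -
  obtain g \<eta> \<epsilon> where f: "f \<in> Arr C" and g: "g \<in> arrs C (atrg C f) (asrc C f)"
    and \<eta>: "\<eta> \<in> cells C (\<one>\<^sub>1 (asrc C f)) (f \<sharp>\<^sub>1 g)" "invertible_cell C \<eta>"
    and \<epsilon>: "\<epsilon> \<in> cells C (g \<sharp>\<^sub>1 f) (\<one>\<^sub>1 (atrg C f))" "invertible_cell C \<epsilon>"
    using equi_arrowE[OF assms(1)] by blast
  obtain \<eta>' where \<eta>': "\<eta>' \<in> cells C (f \<sharp>\<^sub>1 g) (\<one>\<^sub>1 (asrc C f))" "\<eta> \<bullet> \<eta>' = \<one>\<^sub>2 (\<one>\<^sub>1 (asrc C f))"
    "\<eta>' \<bullet> \<eta> = \<one>\<^sub>2 (f \<sharp>\<^sub>1 g)"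
    using invertible_cellE[OF \<eta>(2,1)] by blast
  obtain \<epsilon>' where \<epsilon>': "\<epsilon>' \<in> cells C (\<one>\<^sub>1 (atrg C f)) (g \<sharp>\<^sub>1 f)" "\<epsilon> \<bullet> \<epsilon>' = \<one>\<^sub>2 (g \<sharp>\<^sub>1 f)"
    "\<epsilon>' \<bullet> \<epsilon> = \<one>\<^sub>2 (\<one>\<^sub>1 (atrg C f))"
    using invertible_cellE[OF \<epsilon>(2,1)] by blast
  note defs = f g \<eta>(1) \<eta>'(1) assms(2-4)
  define T where "T = (\<one>\<^sub>2 h \<sharp>\<^sub>2 \<eta>) \<bullet> ((S \<sharp>\<^sub>2 \<one>\<^sub>2 g) \<bullet> (\<one>\<^sub>2 k \<sharp>\<^sub>2 \<eta>'))"
  have T: "T \<in> cells C h k"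
    using defs unfolding T_def by (auto simp: cell_simps)
  have kk: "(\<one>\<^sub>2 k \<sharp>\<^sub>2 \<eta>') \<bullet> (\<one>\<^sub>2 k \<sharp>\<^sub>2 \<eta>) = \<one>\<^sub>2 (k \<sharp>\<^sub>1 f \<sharp>\<^sub>1 g)"
  proof -
    have "(\<one>\<^sub>2 k \<sharp>\<^sub>2 \<eta>') \<bullet> (\<one>\<^sub>2 k \<sharp>\<^sub>2 \<eta>) = \<one>\<^sub>2 k \<sharp>\<^sub>2 (\<eta>' \<bullet> \<eta>)"
      using interchange[of "\<one>\<^sub>2 k" "\<one>\<^sub>2 k" \<eta>' \<eta>] defs by (auto simp: cell_simps)
    then show ?thesis
      unfolding \<eta>'(3) using defs by (auto simp: cell_simps ide2_acomp hcomp_assoc)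
  qed
  have "(\<one>\<^sub>2 h \<sharp>\<^sub>2 \<eta>) \<bullet> (T \<sharp>\<^sub>2 \<one>\<^sub>2 (f \<sharp>\<^sub>1 g)) = T \<bullet> (\<one>\<^sub>2 k \<sharp>\<^sub>2 \<eta>)"
    using hcomp_eq_left_right[OF T \<eta>(1)] T defs by (auto simp: cell_simps)
  also have "\<dots> = (\<one>\<^sub>2 h \<sharp>\<^sub>2 \<eta>) \<bullet> ((S \<sharp>\<^sub>2 \<one>\<^sub>2 g) \<bullet> ((\<one>\<^sub>2 k \<sharp>\<^sub>2 \<eta>') \<bullet> (\<one>\<^sub>2 k \<sharp>\<^sub>2 \<eta>)))"
    unfolding T_def using defs by (auto simp: cell_simps vcomp_assoc)
  also have "\<dots> = (\<one>\<^sub>2 h \<sharp>\<^sub>2 \<eta>) \<bullet> (S \<sharp>\<^sub>2 \<one>\<^sub>2 g)"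
    unfolding kk using defs by (auto simp: cell_simps)
  finally have 1: "(\<one>\<^sub>2 h \<sharp>\<^sub>2 \<eta>) \<bullet> (T \<sharp>\<^sub>2 \<one>\<^sub>2 (f \<sharp>\<^sub>1 g)) = (\<one>\<^sub>2 h \<sharp>\<^sub>2 \<eta>) \<bullet> (S \<sharp>\<^sub>2 \<one>\<^sub>2 g)" .
  have h: "h \<in> Arr C"
    using defs by (auto simp: cell_simps)
  have "invertible_cell C (\<one>\<^sub>2 h \<sharp>\<^sub>2 \<eta>)"
    using invertible_hcomp[OF invertible_ide2[OF h] \<eta>(2) _ \<eta>(1), of h h] defs by (auto simp: cell_simps)
  then have "T \<sharp>\<^sub>2 \<one>\<^sub>2 (f \<sharp>\<^sub>1 g) = S \<sharp>\<^sub>2 \<one>\<^sub>2 g"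
    using invertible_cancel_left[OF _ _ _ _ 1, of "h \<sharp>\<^sub>1 f \<sharp>\<^sub>1 g" "k \<sharp>\<^sub>1 f \<sharp>\<^sub>1 g" h] defs T
    by (auto simp: cell_simps)
  then have gT: "(T \<sharp>\<^sub>2 \<one>\<^sub>2 f) \<sharp>\<^sub>2 \<one>\<^sub>2 g = S \<sharp>\<^sub>2 \<one>\<^sub>2 g"
    using defs T by (auto simp: cell_simps ide2_acomp hcomp_assoc)
  have "T \<sharp>\<^sub>2 \<one>\<^sub>2 f = S"
  proof (rule faithful_whisker_right_aux[OF _ _ _ _ _ _ _ gT])
    show "invertible_cell C \<epsilon>'"
      using invertible_cellI(1)[OF \<epsilon>'(1) \<epsilon>(1)] \<epsilon>' by blast
    show "\<epsilon>' \<in> cells C (\<one>\<^sub>1 (asrc C g)) (g \<sharp>\<^sub>1 f)"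
      using \<epsilon>' g by (auto simp: arrs_def)
    show "T \<sharp>\<^sub>2 \<one>\<^sub>2 f \<in> cells C (h \<sharp>\<^sub>1 f) (k \<sharp>\<^sub>1 f)"
      using T defs by (auto simp: cell_simps)
  qed (use defs in \<open>auto simp: cell_simps\<close>)
  then show ?thesis
    using T that by blast
qed

text \<open>S and its inverse both lift, and the composites of the lifts are identities because
  whiskering by f is injective on 2-cells.\<close>

lemma equi_whisker_left_lift_invertible:
  assumes "equi_arrow C f" "S \<in> cells C (f \<sharp>\<^sub>1 h) (f \<sharp>\<^sub>1 k)"
    "h \<in> arrs C (atrg C f) Y" "k \<in> arrs C (atrg C f) Y" "invertible_cell C S"
  obtains T where "T \<in> cells C h k" "\<one>\<^sub>2 f \<sharp>\<^sub>2 T = S" "invertible_cell C T"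
proof -
  obtain S' where S': "S' \<in> cells C (f \<sharp>\<^sub>1 k) (f \<sharp>\<^sub>1 h)" "S \<bullet> S' = \<one>\<^sub>2 (f \<sharp>\<^sub>1 h)" "S' \<bullet> S = \<one>\<^sub>2 (f \<sharp>\<^sub>1 k)"
    using invertible_cellE assms by metis
  obtain T where T: "T \<in> cells C h k" "\<one>\<^sub>2 f \<sharp>\<^sub>2 T = S"
    using equi_whisker_left_surj assms by metis
  obtain T' where T': "T' \<in> cells C k h" "\<one>\<^sub>2 f \<sharp>\<^sub>2 T' = S'"
    using equi_whisker_left_surj S' assms by metis
  have f: "f \<in> Arr C"
    using assms(1) by (auto elim: equi_arrowE)
  have "\<one>\<^sub>2 f \<sharp>\<^sub>2 (T \<bullet> T') = \<one>\<^sub>2 f \<sharp>\<^sub>2 \<one>\<^sub>2 h" "\<one>\<^sub>2 f \<sharp>\<^sub>2 (T' \<bullet> T) = \<one>\<^sub>2 f \<sharp>\<^sub>2 \<one>\<^sub>2 k"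
    using S'(2,3) T T' f assms(3,4) by (simp_all add: cell_simps whisker_left_vcomp ide2_acomp)
  moreover have "T \<bullet> T' \<in> cells C h h" "\<one>\<^sub>2 h \<in> cells C h h" "asrc C h = atrg C f"
    "T' \<bullet> T \<in> cells C k k" "\<one>\<^sub>2 k \<in> cells C k k" "asrc C k = atrg C f"
    using T(1) T'(1) assms(3,4) by (auto simp: cell_simps)
  ultimately have "T \<bullet> T' = \<one>\<^sub>2 h" "T' \<bullet> T = \<one>\<^sub>2 k"
    using equi_whisker_left_inj[OF assms(1)] by blast+
  then show ?thesis
    using that T T'(1) invertible_cellI(1) by blast
qed

lemma equi_whisker_right_lift_invertible:
  assumes "equi_arrow C f" "S \<in> cells C (h \<sharp>\<^sub>1 f) (k \<sharp>\<^sub>1 f)"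
    "h \<in> arrs C X (asrc C f)" "k \<in> arrs C X (asrc C f)" "invertible_cell C S"
  obtains T where "T \<in> cells C h k" "T \<sharp>\<^sub>2 \<one>\<^sub>2 f = S" "invertible_cell C T"
proof -
  obtain S' where S': "S' \<in> cells C (k \<sharp>\<^sub>1 f) (h \<sharp>\<^sub>1 f)" "S \<bullet> S' = \<one>\<^sub>2 (h \<sharp>\<^sub>1 f)" "S' \<bullet> S = \<one>\<^sub>2 (k \<sharp>\<^sub>1 f)"
    using invertible_cellE assms by metis
  obtain T where T: "T \<in> cells C h k" "T \<sharp>\<^sub>2 \<one>\<^sub>2 f = S"
    using equi_whisker_right_surj assms by metis
  obtain T' where T': "T' \<in> cells C k h" "T' \<sharp>\<^sub>2 \<one>\<^sub>2 f = S'"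
    using equi_whisker_right_surj S' assms by metis
  have f: "f \<in> Arr C"
    using assms(1) by (auto elim: equi_arrowE)
  have "(T \<bullet> T') \<sharp>\<^sub>2 \<one>\<^sub>2 f = \<one>\<^sub>2 h \<sharp>\<^sub>2 \<one>\<^sub>2 f" "(T' \<bullet> T) \<sharp>\<^sub>2 \<one>\<^sub>2 f = \<one>\<^sub>2 k \<sharp>\<^sub>2 \<one>\<^sub>2 f"
    using S'(2,3) T T' f assms(3,4) by (simp_all add: cell_simps whisker_right_vcomp ide2_acomp)
  moreover have "T \<bullet> T' \<in> cells C h h" "\<one>\<^sub>2 h \<in> cells C h h" "atrg C h = asrc C f"
    "T' \<bullet> T \<in> cells C k k" "\<one>\<^sub>2 k \<in> cells C k k" "atrg C k = asrc C f"
    using T(1) T'(1) assms(3,4) by (auto simp: cell_simps)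
  ultimately have "T \<bullet> T' = \<one>\<^sub>2 h" "T' \<bullet> T = \<one>\<^sub>2 k"
    using equi_whisker_right_inj[OF assms(1)] by blast+
  then show ?thesis
    using that T T'(1) invertible_cellI(1) by blast
qed

text \<open>A fully faithful 2-functor reaches an equi-arrow and its pseudo-inverse only up to
  invertible 2-cells. Replacing both arrows by isomorphic ones has to preserve the triangle
  equations, so the comparison cells are conjugated by the given isomorphisms.\<close>

lemma pseudo_inverse_transport:
  assumes kh: "pseudo_inverse C k h"
    and U: "U \<in> cells C f k" "invertible_cell C U"
    and W: "W \<in> cells C g h" "invertible_cell C W"
  shows "pseudo_inverse C f g"
proof -
  obtain \<eta> \<epsilon> where k: "k \<in> Arr C" "h \<in> arrs C (atrg C k) (asrc C k)"
    and \<eta>: "\<eta> \<in> cells C (\<one>\<^sub>1 (asrc C k)) (k \<sharp>\<^sub>1 h)" "invertible_cell C \<eta>"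
    and \<epsilon>: "\<epsilon> \<in> cells C (h \<sharp>\<^sub>1 k) (\<one>\<^sub>1 (atrg C k))" "invertible_cell C \<epsilon>"
    and t: "(\<eta> \<sharp>\<^sub>2 \<one>\<^sub>2 k) \<bullet> (\<one>\<^sub>2 k \<sharp>\<^sub>2 \<epsilon>) = \<one>\<^sub>2 k" "(\<one>\<^sub>2 h \<sharp>\<^sub>2 \<eta>) \<bullet> (\<epsilon> \<sharp>\<^sub>2 \<one>\<^sub>2 h) = \<one>\<^sub>2 h"
    using kh by (auto simp: pseudo_inverse_def)
  obtain U' where U': "U' \<in> cells C k f" "U \<bullet> U' = \<one>\<^sub>2 f" "U' \<bullet> U = \<one>\<^sub>2 k"
    using invertible_cellE[OF U(2,1)] .
  obtain W' where W': "W' \<in> cells C h g" "W \<bullet> W' = \<one>\<^sub>2 g" "W' \<bullet> W = \<one>\<^sub>2 h"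
    using invertible_cellE[OF W(2,1)] .
  have invs: "invertible_cell C U'" "invertible_cell C W'"
    using invertible_cellI U U' W W' by blast+
  have fg: "f \<in> arrs C (asrc C k) (atrg C k)" "g \<in> arrs C (atrg C k) (asrc C k)"
    using U(1) W(1) k globular_src[of U] globular_trg[of U] globular_src[of W] globular_trg[of W]
    by (auto simp: cell_simps)
  define \<eta>0 where "\<eta>0 = \<eta> \<bullet> (U' \<sharp>\<^sub>2 W')"
  define \<epsilon>0 where "\<epsilon>0 = (W \<sharp>\<^sub>2 U) \<bullet> \<epsilon>"
  note defs = k fg \<eta>(1) \<epsilon>(1) U(1) U'(1) W(1) W'(1)
  have \<eta>0: "\<eta>0 \<in> cells C (\<one>\<^sub>1 (asrc C k)) (f \<sharp>\<^sub>1 g)" "invertible_cell C \<eta>0"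
    unfolding \<eta>0_def using defs invs \<eta>
      invertible_vcomp[OF \<eta>(2) invertible_hcomp[OF invs U'(1) W'(1)] \<eta>(1), of "f \<sharp>\<^sub>1 g"]
    by (auto simp: cell_simps)
  have \<epsilon>0: "\<epsilon>0 \<in> cells C (g \<sharp>\<^sub>1 f) (\<one>\<^sub>1 (atrg C k))" "invertible_cell C \<epsilon>0"
    unfolding \<epsilon>0_def using defs invs \<epsilon>
      invertible_vcomp[OF invertible_hcomp[OF W(2) U(2) W(1) U(1)] \<epsilon>(2) _ \<epsilon>(1), of "g \<sharp>\<^sub>1 f"]
    by (auto simp: cell_simps)
  have "(\<eta>0 \<sharp>\<^sub>2 \<one>\<^sub>2 f) \<bullet> (\<one>\<^sub>2 f \<sharp>\<^sub>2 \<epsilon>0) =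
      (\<eta> \<sharp>\<^sub>2 \<one>\<^sub>2 f) \<bullet> (((U' \<sharp>\<^sub>2 (W' \<sharp>\<^sub>2 \<one>\<^sub>2 f)) \<bullet> (\<one>\<^sub>2 f \<sharp>\<^sub>2 (W \<sharp>\<^sub>2 U))) \<bullet> (\<one>\<^sub>2 f \<sharp>\<^sub>2 \<epsilon>))"
    unfolding \<eta>0_def \<epsilon>0_def using defs
    by (auto simp: cell_simps whisker_left_vcomp whisker_right_vcomp vcomp_assoc hcomp_assoc)
  \<comment> \<open>In the middle \<open>W'\<close> meets \<open>W\<close> and cancels. The
    remaining \<open>U'\<close> and \<open>U\<close> act on different factors and are put in the
    opposite order, so that \<open>U\<close> can slide past \<open>\<eta>\<close> and
    \<open>U'\<close> past \<open>\<epsilon>\<close>, leaving the triangle for k and h between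
    them.\<close>
  also have "(U' \<sharp>\<^sub>2 (W' \<sharp>\<^sub>2 \<one>\<^sub>2 f)) \<bullet> (\<one>\<^sub>2 f \<sharp>\<^sub>2 (W \<sharp>\<^sub>2 U)) = U' \<sharp>\<^sub>2 ((W' \<bullet> W) \<sharp>\<^sub>2 U)"
    using defs interchange[of U' "\<one>\<^sub>2 f" "W' \<sharp>\<^sub>2 \<one>\<^sub>2 f" "W \<sharp>\<^sub>2 U"] interchange[of W' W "\<one>\<^sub>2 f" U]
    by (auto simp: cell_simps)
  also have "\<dots> = (\<one>\<^sub>2 k \<sharp>\<^sub>2 (\<one>\<^sub>2 h \<sharp>\<^sub>2 U)) \<bullet> (U' \<sharp>\<^sub>2 \<one>\<^sub>2 (h \<sharp>\<^sub>1 k))"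
    unfolding W' using defs hcomp_eq_left_right(2)[OF U'(1), of "\<one>\<^sub>2 h \<sharp>\<^sub>2 U" "h \<sharp>\<^sub>1 f" "h \<sharp>\<^sub>1 k"]
    by (auto simp: cell_simps)
  also have "(\<eta> \<sharp>\<^sub>2 \<one>\<^sub>2 f) \<bullet> (((\<one>\<^sub>2 k \<sharp>\<^sub>2 (\<one>\<^sub>2 h \<sharp>\<^sub>2 U)) \<bullet> (U' \<sharp>\<^sub>2 \<one>\<^sub>2 (h \<sharp>\<^sub>1 k))) \<bullet> (\<one>\<^sub>2 f \<sharp>\<^sub>2 \<epsilon>)) =
      ((\<eta> \<sharp>\<^sub>2 \<one>\<^sub>2 f) \<bullet> (\<one>\<^sub>2 (k \<sharp>\<^sub>1 h) \<sharp>\<^sub>2 U)) \<bullet> ((U' \<sharp>\<^sub>2 \<one>\<^sub>2 (h \<sharp>\<^sub>1 k)) \<bullet> (\<one>\<^sub>2 f \<sharp>\<^sub>2 \<epsilon>))"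
    using defs by (auto simp: cell_simps vcomp_assoc hcomp_assoc ide2_acomp)
  also have "(\<eta> \<sharp>\<^sub>2 \<one>\<^sub>2 f) \<bullet> (\<one>\<^sub>2 (k \<sharp>\<^sub>1 h) \<sharp>\<^sub>2 U) = U \<bullet> (\<eta> \<sharp>\<^sub>2 \<one>\<^sub>2 k)"
    using defs hcomp_eq_left_right[OF \<eta>(1) U(1)] by (auto simp: cell_simps)
  also have "(U' \<sharp>\<^sub>2 \<one>\<^sub>2 (h \<sharp>\<^sub>1 k)) \<bullet> (\<one>\<^sub>2 f \<sharp>\<^sub>2 \<epsilon>) = (\<one>\<^sub>2 k \<sharp>\<^sub>2 \<epsilon>) \<bullet> U'"
    using defs hcomp_eq_left_right[OF U'(1) \<epsilon>(1)] by (auto simp: cell_simps)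
  also have "(U \<bullet> (\<eta> \<sharp>\<^sub>2 \<one>\<^sub>2 k)) \<bullet> ((\<one>\<^sub>2 k \<sharp>\<^sub>2 \<epsilon>) \<bullet> U') = U \<bullet> (((\<eta> \<sharp>\<^sub>2 \<one>\<^sub>2 k) \<bullet> (\<one>\<^sub>2 k \<sharp>\<^sub>2 \<epsilon>)) \<bullet> U')"
    using defs by (auto simp: cell_simps vcomp_assoc)
  also have "\<dots> = \<one>\<^sub>2 f"
    unfolding t using defs U'(2) by (auto simp: cell_simps)
  finally have t1: "(\<eta>0 \<sharp>\<^sub>2 \<one>\<^sub>2 f) \<bullet> (\<one>\<^sub>2 f \<sharp>\<^sub>2 \<epsilon>0) = \<one>\<^sub>2 f" .
  have "(\<one>\<^sub>2 g \<sharp>\<^sub>2 \<eta>0) \<bullet> (\<epsilon>0 \<sharp>\<^sub>2 \<one>\<^sub>2 g) =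
      (\<one>\<^sub>2 g \<sharp>\<^sub>2 \<eta>) \<bullet> (((\<one>\<^sub>2 g \<sharp>\<^sub>2 (U' \<sharp>\<^sub>2 W')) \<bullet> (W \<sharp>\<^sub>2 (U \<sharp>\<^sub>2 \<one>\<^sub>2 g))) \<bullet> (\<epsilon> \<sharp>\<^sub>2 \<one>\<^sub>2 g))"
    unfolding \<eta>0_def \<epsilon>0_def using defs
    by (auto simp: cell_simps whisker_left_vcomp whisker_right_vcomp vcomp_assoc hcomp_assoc)
  also have "(\<one>\<^sub>2 g \<sharp>\<^sub>2 (U' \<sharp>\<^sub>2 W')) \<bullet> (W \<sharp>\<^sub>2 (U \<sharp>\<^sub>2 \<one>\<^sub>2 g)) = W \<sharp>\<^sub>2 ((U' \<bullet> U) \<sharp>\<^sub>2 W')"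
    using defs interchange[of "\<one>\<^sub>2 g" W "U' \<sharp>\<^sub>2 W'" "U \<sharp>\<^sub>2 \<one>\<^sub>2 g"] interchange[of U' U W' "\<one>\<^sub>2 g"]
    by (auto simp: cell_simps)
  also have "\<dots> = (W \<sharp>\<^sub>2 \<one>\<^sub>2 (k \<sharp>\<^sub>1 h)) \<bullet> (\<one>\<^sub>2 h \<sharp>\<^sub>2 (\<one>\<^sub>2 k \<sharp>\<^sub>2 W'))"
    unfolding U' using defs hcomp_eq_left_right(1)[OF W(1), of "\<one>\<^sub>2 k \<sharp>\<^sub>2 W'" "k \<sharp>\<^sub>1 h" "k \<sharp>\<^sub>1 g"]
    by (auto simp: cell_simps)
  also have "(\<one>\<^sub>2 g \<sharp>\<^sub>2 \<eta>) \<bullet> (((W \<sharp>\<^sub>2 \<one>\<^sub>2 (k \<sharp>\<^sub>1 h)) \<bullet> (\<one>\<^sub>2 h \<sharp>\<^sub>2 (\<one>\<^sub>2 k \<sharp>\<^sub>2 W'))) \<bullet> (\<epsilon> \<sharp>\<^sub>2 \<one>\<^sub>2 g)) =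
      ((\<one>\<^sub>2 g \<sharp>\<^sub>2 \<eta>) \<bullet> (W \<sharp>\<^sub>2 \<one>\<^sub>2 (k \<sharp>\<^sub>1 h))) \<bullet> ((\<one>\<^sub>2 (h \<sharp>\<^sub>1 k) \<sharp>\<^sub>2 W') \<bullet> (\<epsilon> \<sharp>\<^sub>2 \<one>\<^sub>2 g))"
    using defs by (auto simp: cell_simps vcomp_assoc hcomp_assoc ide2_acomp)
  also have "(\<one>\<^sub>2 g \<sharp>\<^sub>2 \<eta>) \<bullet> (W \<sharp>\<^sub>2 \<one>\<^sub>2 (k \<sharp>\<^sub>1 h)) = W \<bullet> (\<one>\<^sub>2 h \<sharp>\<^sub>2 \<eta>)"
    using defs hcomp_eq_left_right[OF W(1) \<eta>(1)] by (auto simp: cell_simps)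
  also have "(\<one>\<^sub>2 (h \<sharp>\<^sub>1 k) \<sharp>\<^sub>2 W') \<bullet> (\<epsilon> \<sharp>\<^sub>2 \<one>\<^sub>2 g) = (\<epsilon> \<sharp>\<^sub>2 \<one>\<^sub>2 h) \<bullet> W'"
    using defs hcomp_eq_left_right[OF \<epsilon>(1) W'(1)] by (auto simp: cell_simps)
  also have "(W \<bullet> (\<one>\<^sub>2 h \<sharp>\<^sub>2 \<eta>)) \<bullet> ((\<epsilon> \<sharp>\<^sub>2 \<one>\<^sub>2 h) \<bullet> W') = W \<bullet> (((\<one>\<^sub>2 h \<sharp>\<^sub>2 \<eta>) \<bullet> (\<epsilon> \<sharp>\<^sub>2 \<one>\<^sub>2 h)) \<bullet> W')"
    using defs by (auto simp: cell_simps vcomp_assoc)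
  also have "\<dots> = \<one>\<^sub>2 g"
    unfolding t using defs W'(2) by (auto simp: cell_simps)
  finally have t2: "(\<one>\<^sub>2 g \<sharp>\<^sub>2 \<eta>0) \<bullet> (\<epsilon>0 \<sharp>\<^sub>2 \<one>\<^sub>2 g) = \<one>\<^sub>2 g" .
  have "f \<in> Arr C" "asrc C f = asrc C k" "atrg C f = atrg C k"
    using fg by (auto simp: arrs_def)
  then show ?thesis
    unfolding pseudo_inverse_def using \<eta>0 \<epsilon>0 t1 t2 fg by metis
qed

text \<open>The cells \<open>V, V1, V0, W2, W1, W0\<close> stand for \<open>V, IV, VI, IIV, IVI, VII\<close>, with \<open>V : I\<alpha> \<Rightarrow> \<alpha>I\<close>.
  Followed by \<open>W0 \<sharp> t1 \<sharp> u1\<close>, both sides become \<open>(s3 \<sharp> t2 \<sharp> V) \<bullet> (s0 \<sharp> V1 \<sharp> u1)\<close>.\<close>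

lemma pentagon_core:
  assumes s: "s3 \<in> arrs C P Q" "s2 \<in> arrs C P Q" "s1 \<in> arrs C P Q" "s0 \<in> arrs C P Q"
    and t: "t2 \<in> arrs C Q R" "t1 \<in> arrs C Q R" "t0 \<in> arrs C Q R"
    and u: "u1 \<in> arrs C R T" "u0 \<in> arrs C R T"
    and V: "V \<in> cells C u1 u0"
    and V1: "V1 \<in> cells C t2 t1" and V0: "V0 \<in> cells C t1 t0"
    and W2: "W2 \<in> cells C s3 s2" and W1: "W1 \<in> cells C s2 s1" and W0: "W0 \<in> cells C s1 s0"
    and st: "s3 \<sharp>\<^sub>1 t1 = s1 \<sharp>\<^sub>1 t2" "s3 \<sharp>\<^sub>1 t0 = s0 \<sharp>\<^sub>1 t2" "s2 \<sharp>\<^sub>1 t0 = s0 \<sharp>\<^sub>1 t1"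
    and tu: "t2 \<sharp>\<^sub>1 u0 = t0 \<sharp>\<^sub>1 u1"
    and inv: "invertible_cell C W0"
    and HV: "(V1 \<sharp>\<^sub>2 \<one>\<^sub>2 u1) \<bullet> (V0 \<sharp>\<^sub>2 \<one>\<^sub>2 u1) = \<one>\<^sub>2 t2 \<sharp>\<^sub>2 V"
    and HW: "(W1 \<sharp>\<^sub>2 \<one>\<^sub>2 t1) \<bullet> (W0 \<sharp>\<^sub>2 \<one>\<^sub>2 t1) = \<one>\<^sub>2 s2 \<sharp>\<^sub>2 V0"
    and ex: "W2 \<sharp>\<^sub>2 \<one>\<^sub>2 t0 = \<one>\<^sub>2 s0 \<sharp>\<^sub>2 V1" "W0 \<sharp>\<^sub>2 \<one>\<^sub>2 t2 = \<one>\<^sub>2 s3 \<sharp>\<^sub>2 V0"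
  shows "((W2 \<sharp>\<^sub>2 \<one>\<^sub>2 t2) \<bullet> ((\<one>\<^sub>2 s2 \<sharp>\<^sub>2 V1) \<bullet> (W1 \<sharp>\<^sub>2 \<one>\<^sub>2 t1))) \<sharp>\<^sub>2 \<one>\<^sub>2 u1 =
    ((\<one>\<^sub>2 s3 \<sharp>\<^sub>2 V1) \<bullet> (\<one>\<^sub>2 s1 \<sharp>\<^sub>2 V1)) \<sharp>\<^sub>2 \<one>\<^sub>2 u1" (is "?L = ?R")
proof -
  note [simp] = cell_simps vcomp_assoc hcomp_assoc
  note cells = s t u V V1 V0 W2 W1 W0
  \<comment> \<open>Composites of arrows are nested to the right, so each equation of
    \<open>st\<close> is also wanted with a further arrow behind it.\<close>
  have st': "s3 \<sharp>\<^sub>1 (t1 \<sharp>\<^sub>1 f) = s1 \<sharp>\<^sub>1 (t2 \<sharp>\<^sub>1 f)" "s3 \<sharp>\<^sub>1 (t0 \<sharp>\<^sub>1 f) = s0 \<sharp>\<^sub>1 (t2 \<sharp>\<^sub>1 f)"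
    "s2 \<sharp>\<^sub>1 (t0 \<sharp>\<^sub>1 f) = s0 \<sharp>\<^sub>1 (t1 \<sharp>\<^sub>1 f)" if "f \<in> arrs C R T" for f
    using arg_cong[OF st(1), of "\<lambda>h. h \<sharp>\<^sub>1 f"] arg_cong[OF st(2), of "\<lambda>h. h \<sharp>\<^sub>1 f"]
      arg_cong[OF st(3), of "\<lambda>h. h \<sharp>\<^sub>1 f"] that cells by simp_all
  note eqs [simp] = st st' tu
  have a: "(W1 \<sharp>\<^sub>2 (\<one>\<^sub>2 t1 \<sharp>\<^sub>2 \<one>\<^sub>2 u1)) \<bullet> (W0 \<sharp>\<^sub>2 (\<one>\<^sub>2 t1 \<sharp>\<^sub>2 \<one>\<^sub>2 u1)) = \<one>\<^sub>2 s2 \<sharp>\<^sub>2 (V0 \<sharp>\<^sub>2 \<one>\<^sub>2 u1)"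
    using arg_cong[OF HW, of "\<lambda>S. S \<sharp>\<^sub>2 \<one>\<^sub>2 u1"] cells by (simp add: whisker_right_vcomp)
  have b: "(\<one>\<^sub>2 s2 \<sharp>\<^sub>2 (V1 \<sharp>\<^sub>2 \<one>\<^sub>2 u1)) \<bullet> (\<one>\<^sub>2 s2 \<sharp>\<^sub>2 (V0 \<sharp>\<^sub>2 \<one>\<^sub>2 u1)) = \<one>\<^sub>2 s2 \<sharp>\<^sub>2 (\<one>\<^sub>2 t2 \<sharp>\<^sub>2 V)"
    using arg_cong[OF HV, of "\<lambda>S. \<one>\<^sub>2 s2 \<sharp>\<^sub>2 S"] cells by (simp add: whisker_left_vcomp)
  have c: "(W2 \<sharp>\<^sub>2 (\<one>\<^sub>2 t2 \<sharp>\<^sub>2 \<one>\<^sub>2 u1)) \<bullet> (\<one>\<^sub>2 s2 \<sharp>\<^sub>2 (\<one>\<^sub>2 t2 \<sharp>\<^sub>2 V)) =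
      (\<one>\<^sub>2 s3 \<sharp>\<^sub>2 (\<one>\<^sub>2 t2 \<sharp>\<^sub>2 V)) \<bullet> (W2 \<sharp>\<^sub>2 (\<one>\<^sub>2 t2 \<sharp>\<^sub>2 \<one>\<^sub>2 u0))"
    using hcomp_eq_left_right[OF W2, of "\<one>\<^sub>2 t2 \<sharp>\<^sub>2 V" "t2 \<sharp>\<^sub>1 u1" "t2 \<sharp>\<^sub>1 u0"] cells
    by (simp add: ide2_acomp del: eqs)
  have "\<one>\<^sub>2 t2 \<sharp>\<^sub>2 \<one>\<^sub>2 u0 = \<one>\<^sub>2 t0 \<sharp>\<^sub>2 \<one>\<^sub>2 u1"
    using arg_cong[OF tu, of "\<lambda>f. \<one>\<^sub>2 f"] cells by (simp add: ide2_acomp del: eqs)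
  \<comment> \<open>Since t2 # u0 = t0 # u1, the cell \<open>W2\<close> may be read as whiskered by
    t0, where \<open>ex(1)\<close> turns it into \<open>V1\<close>.\<close>
  then have d: "W2 \<sharp>\<^sub>2 (\<one>\<^sub>2 t2 \<sharp>\<^sub>2 \<one>\<^sub>2 u0) = \<one>\<^sub>2 s0 \<sharp>\<^sub>2 (V1 \<sharp>\<^sub>2 \<one>\<^sub>2 u1)"
    using arg_cong[OF ex(1), of "\<lambda>S. S \<sharp>\<^sub>2 \<one>\<^sub>2 u1"] cells by simp
  have e: "(\<one>\<^sub>2 s1 \<sharp>\<^sub>2 (V1 \<sharp>\<^sub>2 \<one>\<^sub>2 u1)) \<bullet> (W0 \<sharp>\<^sub>2 (\<one>\<^sub>2 t1 \<sharp>\<^sub>2 \<one>\<^sub>2 u1)) =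
      (W0 \<sharp>\<^sub>2 (\<one>\<^sub>2 t2 \<sharp>\<^sub>2 \<one>\<^sub>2 u1)) \<bullet> (\<one>\<^sub>2 s0 \<sharp>\<^sub>2 (V1 \<sharp>\<^sub>2 \<one>\<^sub>2 u1))"
    using hcomp_eq_left_right[OF W0, of "V1 \<sharp>\<^sub>2 \<one>\<^sub>2 u1" "t2 \<sharp>\<^sub>1 u1" "t1 \<sharp>\<^sub>1 u1"] cells
    by (simp add: ide2_acomp del: eqs)
  have f: "W0 \<sharp>\<^sub>2 (\<one>\<^sub>2 t2 \<sharp>\<^sub>2 \<one>\<^sub>2 u1) = \<one>\<^sub>2 s3 \<sharp>\<^sub>2 (V0 \<sharp>\<^sub>2 \<one>\<^sub>2 u1)"
    using arg_cong[OF ex(2), of "\<lambda>S. S \<sharp>\<^sub>2 \<one>\<^sub>2 u1"] cells by simp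
  have g: "(\<one>\<^sub>2 s3 \<sharp>\<^sub>2 (V1 \<sharp>\<^sub>2 \<one>\<^sub>2 u1)) \<bullet> (\<one>\<^sub>2 s3 \<sharp>\<^sub>2 (V0 \<sharp>\<^sub>2 \<one>\<^sub>2 u1)) = \<one>\<^sub>2 s3 \<sharp>\<^sub>2 (\<one>\<^sub>2 t2 \<sharp>\<^sub>2 V)"
    using arg_cong[OF HV, of "\<lambda>S. \<one>\<^sub>2 s3 \<sharp>\<^sub>2 S"] cells by (simp add: whisker_left_vcomp)
  \<comment> \<open>\<open>Z\<close> is the constraint 2-cell VII followed by t1 # u1. It completes
    \<open>W1\<close> to the left-hand side of \<open>HW\<close>; moved past \<open>V1\<close>, it
    supplies the \<open>V0\<close> that \<open>HV\<close> asks for.\<close>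
  define Z where "Z = W0 \<sharp>\<^sub>2 (\<one>\<^sub>2 t1 \<sharp>\<^sub>2 \<one>\<^sub>2 u1)"
  have Z: "Z \<in> cells C (s1 \<sharp>\<^sub>1 t1 \<sharp>\<^sub>1 u1) (s0 \<sharp>\<^sub>1 t1 \<sharp>\<^sub>1 u1)"
    unfolding Z_def using cells by simp
  have "?L \<bullet> Z = (W2 \<sharp>\<^sub>2 (\<one>\<^sub>2 t2 \<sharp>\<^sub>2 \<one>\<^sub>2 u1)) \<bullet> ((\<one>\<^sub>2 s2 \<sharp>\<^sub>2 (V1 \<sharp>\<^sub>2 \<one>\<^sub>2 u1)) \<bullet>
      ((W1 \<sharp>\<^sub>2 (\<one>\<^sub>2 t1 \<sharp>\<^sub>2 \<one>\<^sub>2 u1)) \<bullet> (W0 \<sharp>\<^sub>2 (\<one>\<^sub>2 t1 \<sharp>\<^sub>2 \<one>\<^sub>2 u1))))"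
    unfolding Z_def using cells by (simp add: whisker_right_vcomp)
  also have "\<dots> = (\<one>\<^sub>2 s3 \<sharp>\<^sub>2 (\<one>\<^sub>2 t2 \<sharp>\<^sub>2 V)) \<bullet> (\<one>\<^sub>2 s0 \<sharp>\<^sub>2 (V1 \<sharp>\<^sub>2 \<one>\<^sub>2 u1))"
    unfolding a b c d ..
  finally have L: "?L \<bullet> Z = (\<one>\<^sub>2 s3 \<sharp>\<^sub>2 (\<one>\<^sub>2 t2 \<sharp>\<^sub>2 V)) \<bullet> (\<one>\<^sub>2 s0 \<sharp>\<^sub>2 (V1 \<sharp>\<^sub>2 \<one>\<^sub>2 u1))" .
  have "?R \<bullet> Z = (\<one>\<^sub>2 s3 \<sharp>\<^sub>2 (V1 \<sharp>\<^sub>2 \<one>\<^sub>2 u1)) \<bullet>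
      ((\<one>\<^sub>2 s1 \<sharp>\<^sub>2 (V1 \<sharp>\<^sub>2 \<one>\<^sub>2 u1)) \<bullet> (W0 \<sharp>\<^sub>2 (\<one>\<^sub>2 t1 \<sharp>\<^sub>2 \<one>\<^sub>2 u1)))"
    unfolding Z_def using cells by (simp add: whisker_right_vcomp)
  also have "\<dots> = ((\<one>\<^sub>2 s3 \<sharp>\<^sub>2 (V1 \<sharp>\<^sub>2 \<one>\<^sub>2 u1)) \<bullet> (\<one>\<^sub>2 s3 \<sharp>\<^sub>2 (V0 \<sharp>\<^sub>2 \<one>\<^sub>2 u1))) \<bullet>
      (\<one>\<^sub>2 s0 \<sharp>\<^sub>2 (V1 \<sharp>\<^sub>2 \<one>\<^sub>2 u1))"
    unfolding e f using cells by simp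
  also have "\<dots> = ?L \<bullet> Z"
    unfolding g L ..
  finally have "?L \<bullet> Z = ?R \<bullet> Z" ..
  moreover have "invertible_cell C Z"
    unfolding Z_def using invertible_hcomp[OF inv invertible_ide2 W0, of "t1 \<sharp>\<^sub>1 u1" "t1 \<sharp>\<^sub>1 u1" "t1 \<sharp>\<^sub>1 u1"]
      cells by (simp add: ide2_acomp)
  ultimately show ?thesis
    using cells Z by (intro invertible_cancel_right[of Z ?L "s3 \<sharp>\<^sub>1 t2 \<sharp>\<^sub>1 u1" "s1 \<sharp>\<^sub>1 t1 \<sharp>\<^sub>1 u1" ?R]) auto
qed

end

section \<open>Fully faithful 2-functors\<close>

locale two_functor = C: two_category C + D: two_category D
  for C :: "('o, 'a, 'c, 'x) two_cat_scheme" (structure)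
    and D :: "('p, 'b, 'd, 'y) two_cat_scheme" (structure) +
  fixes F0 F1 F2
  assumes two_functor: "strict_2functor C D F0 F1 F2"
begin

lemma F_simps [simp]:
  shows F0_Obj: "X \<in> Obj C \<Longrightarrow> F0 X \<in> Obj D"
    and F1_ide1: "X \<in> Obj C \<Longrightarrow> F1 (\<one>\<^sub>1 X) = \<one>\<^sub>1\<^bsub>D\<^esub> (F0 X)"
    and F1_Arr: "f \<in> Arr C \<Longrightarrow> F1 f \<in> Arr D"
    and asrc_F1: "f \<in> Arr C \<Longrightarrow> asrc D (F1 f) = F0 (asrc C f)"
    and atrg_F1: "f \<in> Arr C \<Longrightarrow> atrg D (F1 f) = F0 (atrg C f)"
    and F1_acomp: "\<lbrakk>f \<in> Arr C; g \<in> Arr C; atrg C f = asrc C g\<rbrakk> \<Longrightarrow> F1 (f \<sharp>\<^sub>1 g) = F1 f \<sharp>\<^sub>1\<^bsub>D\<^esub> F1 g"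
    and F2_ide2: "f \<in> Arr C \<Longrightarrow> F2 (\<one>\<^sub>2 f) = \<one>\<^sub>2\<^bsub>D\<^esub> (F1 f)"
    and F2_Cell: "S \<in> Cell C \<Longrightarrow> F2 S \<in> Cell D"
    and csrc_F2: "S \<in> Cell C \<Longrightarrow> csrc D (F2 S) = F1 (csrc C S)"
    and ctrg_F2: "S \<in> Cell C \<Longrightarrow> ctrg D (F2 S) = F1 (ctrg C S)"
    and F2_vcomp: "\<lbrakk>S \<in> Cell C; T \<in> Cell C; ctrg C S = csrc C T\<rbrakk> \<Longrightarrow> F2 (S \<bullet> T) = F2 S \<bullet>\<^bsub>D\<^esub> F2 T"
    and F2_hcomp: "\<lbrakk>S \<in> Cell C; T \<in> Cell C; atrg C (csrc C S) = asrc C (csrc C T)\<rbrakk>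
      \<Longrightarrow> F2 (S \<sharp>\<^sub>2 T) = F2 S \<sharp>\<^sub>2\<^bsub>D\<^esub> F2 T"
  using two_functor
  by (auto simp: strict_2functor_def is_functor_def arrow_cat_def vertical_cat_def horizontal_cat_def)

lemma F2_cells: "S \<in> cells C f g \<Longrightarrow> F2 S \<in> cells D (F1 f) (F1 g)"
  by (auto simp: cells_def)

lemma F2_invertible:
  assumes "invertible_cell C S" "S \<in> cells C f g"
  shows "invertible_cell D (F2 S)"
proof -
  obtain T where T: "T \<in> cells C g f" "S \<bullet> T = \<one>\<^sub>2 f" "T \<bullet> S = \<one>\<^sub>2 g"
    using C.invertible_cellE[OF assms] by blast
  have "F2 S \<bullet>\<^bsub>D\<^esub> F2 T = F2 (S \<bullet> T)" "F2 T \<bullet>\<^bsub>D\<^esub> F2 S = F2 (T \<bullet> S)"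
    using T(1) assms(2) by (auto simp: cells_def)
  moreover have "f \<in> Arr C" "g \<in> Arr C"
    using assms(2) by (auto simp: cells_def)
  ultimately show ?thesis
    using D.invertible_cellI(1)[OF F2_cells[OF assms(2)] F2_cells[OF T(1)]] T(2,3) by simp
qed

lemma equi_arrow_F1:
  assumes "equi_arrow C f"
  shows "equi_arrow D (F1 f)"
proof -
  obtain g \<eta> \<epsilon> where f: "f \<in> Arr C" "g \<in> arrs C (atrg C f) (asrc C f)"
    and \<eta>: "\<eta> \<in> cells C (\<one>\<^sub>1 (asrc C f)) (f \<sharp>\<^sub>1 g)" "invertible_cell C \<eta>"
    and \<epsilon>: "\<epsilon> \<in> cells C (g \<sharp>\<^sub>1 f) (\<one>\<^sub>1 (atrg C f))" "invertible_cell C \<epsilon>"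
    and t: "(\<eta> \<sharp>\<^sub>2 \<one>\<^sub>2 f) \<bullet> (\<one>\<^sub>2 f \<sharp>\<^sub>2 \<epsilon>) = \<one>\<^sub>2 f" "(\<one>\<^sub>2 g \<sharp>\<^sub>2 \<eta>) \<bullet> (\<epsilon> \<sharp>\<^sub>2 \<one>\<^sub>2 g) = \<one>\<^sub>2 g"
    using assms by (auto simp: equi_arrow_def pseudo_inverse_def)
  have "F2 ((\<eta> \<sharp>\<^sub>2 \<one>\<^sub>2 f) \<bullet> (\<one>\<^sub>2 f \<sharp>\<^sub>2 \<epsilon>)) =
      (F2 \<eta> \<sharp>\<^sub>2\<^bsub>D\<^esub> \<one>\<^sub>2\<^bsub>D\<^esub> (F1 f)) \<bullet>\<^bsub>D\<^esub> (\<one>\<^sub>2\<^bsub>D\<^esub> (F1 f) \<sharp>\<^sub>2\<^bsub>D\<^esub> F2 \<epsilon>)"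
    "F2 ((\<one>\<^sub>2 g \<sharp>\<^sub>2 \<eta>) \<bullet> (\<epsilon> \<sharp>\<^sub>2 \<one>\<^sub>2 g)) =
      (\<one>\<^sub>2\<^bsub>D\<^esub> (F1 g) \<sharp>\<^sub>2\<^bsub>D\<^esub> F2 \<eta>) \<bullet>\<^bsub>D\<^esub> (F2 \<epsilon> \<sharp>\<^sub>2\<^bsub>D\<^esub> \<one>\<^sub>2\<^bsub>D\<^esub> (F1 g))"
    using f \<eta>(1) \<epsilon>(1) by (auto simp: cell_simps)
  then have t': "(F2 \<eta> \<sharp>\<^sub>2\<^bsub>D\<^esub> \<one>\<^sub>2\<^bsub>D\<^esub> (F1 f)) \<bullet>\<^bsub>D\<^esub> (\<one>\<^sub>2\<^bsub>D\<^esub> (F1 f) \<sharp>\<^sub>2\<^bsub>D\<^esub> F2 \<epsilon>) = \<one>\<^sub>2\<^bsub>D\<^esub> (F1 f)"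
    "(\<one>\<^sub>2\<^bsub>D\<^esub> (F1 g) \<sharp>\<^sub>2\<^bsub>D\<^esub> F2 \<eta>) \<bullet>\<^bsub>D\<^esub> (F2 \<epsilon> \<sharp>\<^sub>2\<^bsub>D\<^esub> \<one>\<^sub>2\<^bsub>D\<^esub> (F1 g)) = \<one>\<^sub>2\<^bsub>D\<^esub> (F1 g)"
    unfolding t using f by (auto simp: arrs_def)
  have "F2 \<eta> \<in> cells D (\<one>\<^sub>1\<^bsub>D\<^esub> (asrc D (F1 f))) (F1 f \<sharp>\<^sub>1\<^bsub>D\<^esub> F1 g)"
    "F2 \<epsilon> \<in> cells D (F1 g \<sharp>\<^sub>1\<^bsub>D\<^esub> F1 f) (\<one>\<^sub>1\<^bsub>D\<^esub> (atrg D (F1 f)))"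
    "F1 f \<in> Arr D" "F1 g \<in> arrs D (atrg D (F1 f)) (asrc D (F1 f))"
    using f \<eta>(1) \<epsilon>(1) by (auto simp: cell_simps)
  then show ?thesis
    using t' F2_invertible[OF \<eta>(2,1)] F2_invertible[OF \<epsilon>(2,1)]
    unfolding equi_arrow_def pseudo_inverse_def by blast
qed

end

locale fully_faithful_two_functor = C: two_category C + D: two_category D
  for C :: "('o, 'a, 'c, 'x) two_cat_scheme" (structure)
    and D :: "('p, 'b, 'd, 'y) two_cat_scheme" (structure) +
  fixes F0 F1 F2
  assumes fully_faithful: "fully_faithful_2functor C D F0 F1 F2"

sublocale fully_faithful_two_functor \<subseteq> two_functor
  using fully_faithful by unfold_locales (auto simp: fully_faithful_2functor_def)

context fully_faithful_two_functor
begin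

section \<open>Lifting arrows, 2-cells and equi-arrows along a fully faithful 2-functor\<close>

lemma hom_equivalence:
  assumes "X \<in> Obj C" "Y \<in> Obj C"
  shows "cat_equivalence (hom_cat C X Y) (hom_cat D (F0 X) (F0 Y)) F1 F2"
  using assms fully_faithful C.hom_category D.hom_category
  by (auto simp: fully_faithful_2functor_def cat_equivalence_def cat_equivalence_axioms_def)

lemma lift_arrow:
  assumes "k \<in> arrs D (F0 X) (F0 Y)" "X \<in> Obj C" "Y \<in> Obj C"
  obtains f U where "f \<in> arrs C X Y" "U \<in> cells D (F1 f) k" "invertible_cell D U"
proof -
  have "k \<in> Ob (hom_cat D (F0 X) (F0 Y))"
    using assms by (simp add: hom_cat_def)
  then obtain f U where "f \<in> Ob (hom_cat C X Y)" and U: "is_iso (hom_cat D (F0 X) (F0 Y)) U"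
    "Dom (hom_cat D (F0 X) (F0 Y)) U = F1 f" "Cod (hom_cat D (F0 X) (F0 Y)) U = k"
    using cat_equivalence.essentially_surjective[OF hom_equivalence] assms by metis
  then have "f \<in> arrs C X Y" "U \<in> cells D (F1 f) k" "is_iso (vertical_cat D) U"
    by (auto simp: hom_cat_def vertical_cat_def is_iso_def mutually_inverse_def cells_def)
  then show ?thesis
    using that by (auto simp: invertible_cell_def)
qed

lemma lift_cell:
  assumes "S \<in> cells D (F1 f) (F1 g)" "f \<in> arrs C X Y" "g \<in> arrs C X Y"
  obtains T where "T \<in> cells C f g" "F2 T = S"
proof -
  have "X \<in> Obj C" "Y \<in> Obj C"
    using assms C.asrc_Obj C.atrg_Obj by (auto simp: arrs_def)
  then obtain T where "T \<in> Mor (hom_cat C X Y)" "Dom (hom_cat C X Y) T = f"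
    "Cod (hom_cat C X Y) T = g" "F2 T = S"
    using assms
    by (auto intro: cat_equivalence.full[OF hom_equivalence, of X Y f g S]
        simp: hom_cat_def vertical_cat_def cell_simps)
  then show ?thesis
    using that by (auto simp: hom_cat_def vertical_cat_def cells_def)
qed

lemma F2_inj:
  assumes "F2 S = F2 T" "S \<in> cells C f g" "T \<in> cells C f g"
  shows "S = T"
proof -
  have "f \<in> Arr C" "f \<in> arrs C (asrc C f) (atrg C f)" "g \<in> arrs C (asrc C f) (atrg C f)"
    using assms(2) C.globular_src[of S] C.globular_trg[of S] by (auto simp: cell_simps)
  then show ?thesis
    using cat_equivalence.faithful[OF hom_equivalence, of "asrc C f" "atrg C f" S T] assms
    by (auto simp: hom_cat_def vertical_cat_def cells_def)
qed

lemma lift_invertible_cell: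
  assumes "S \<in> cells D (F1 f) (F1 g)" "invertible_cell D S" "f \<in> arrs C X Y" "g \<in> arrs C X Y"
  obtains T where "T \<in> cells C f g" "F2 T = S" "invertible_cell C T"
proof -
  obtain S' where S': "S' \<in> cells D (F1 g) (F1 f)" "S \<bullet>\<^bsub>D\<^esub> S' = \<one>\<^sub>2\<^bsub>D\<^esub> (F1 f)"
    "S' \<bullet>\<^bsub>D\<^esub> S = \<one>\<^sub>2\<^bsub>D\<^esub> (F1 g)"
    using D.invertible_cellE assms by metis
  obtain T where T: "T \<in> cells C f g" "F2 T = S"
    using lift_cell assms by metis
  obtain T' where T': "T' \<in> cells C g f" "F2 T' = S'"
    using lift_cell S' assms by metis
  have fg: "f \<in> Arr C" "g \<in> Arr C"
    using assms by (auto simp: arrs_def)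
  have "F2 (T \<bullet> T') = F2 (\<one>\<^sub>2 f)" "F2 (T' \<bullet> T) = F2 (\<one>\<^sub>2 g)"
    using S'(2,3) T T' fg by (auto simp: cells_def)
  then have "T \<bullet> T' = \<one>\<^sub>2 f" "T' \<bullet> T = \<one>\<^sub>2 g"
    using T T' fg by (auto intro!: F2_inj[of "T \<bullet> T'" _ f f] F2_inj[of "T' \<bullet> T" _ g g] simp: cells_def)
  then show ?thesis
    using that[OF T] C.invertible_cellI T T' by metis
qed

text \<open>The comparison cells lift by fullness on hom categories; faithfulness reduces each
  triangle equation to its image.\<close>

lemma pseudo_inverse_reflect:
  assumes "pseudo_inverse D (F1 f) (F1 g)" "f \<in> arrs C X Y" "g \<in> arrs C Y X"
  shows "pseudo_inverse C f g"
proof -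
  note fg = assms(2,3)
  have XY [simp]: "X \<in> Obj C" "Y \<in> Obj C"
    using fg C.asrc_Obj by (auto simp: arrs_def)
  obtain \<eta>D \<epsilon>D where \<eta>D: "\<eta>D \<in> cells D (\<one>\<^sub>1\<^bsub>D\<^esub> (F0 X)) (F1 f \<sharp>\<^sub>1\<^bsub>D\<^esub> F1 g)" "invertible_cell D \<eta>D"
    and \<epsilon>D: "\<epsilon>D \<in> cells D (F1 g \<sharp>\<^sub>1\<^bsub>D\<^esub> F1 f) (\<one>\<^sub>1\<^bsub>D\<^esub> (F0 Y))" "invertible_cell D \<epsilon>D"
    and t: "(\<eta>D \<sharp>\<^sub>2\<^bsub>D\<^esub> \<one>\<^sub>2\<^bsub>D\<^esub> (F1 f)) \<bullet>\<^bsub>D\<^esub> (\<one>\<^sub>2\<^bsub>D\<^esub> (F1 f) \<sharp>\<^sub>2\<^bsub>D\<^esub> \<epsilon>D) = \<one>\<^sub>2\<^bsub>D\<^esub> (F1 f)"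
    "(\<one>\<^sub>2\<^bsub>D\<^esub> (F1 g) \<sharp>\<^sub>2\<^bsub>D\<^esub> \<eta>D) \<bullet>\<^bsub>D\<^esub> (\<epsilon>D \<sharp>\<^sub>2\<^bsub>D\<^esub> \<one>\<^sub>2\<^bsub>D\<^esub> (F1 g)) = \<one>\<^sub>2\<^bsub>D\<^esub> (F1 g)"
    using assms by (auto simp: pseudo_inverse_def arrs_def)
  have "\<eta>D \<in> cells D (F1 (\<one>\<^sub>1 X)) (F1 (f \<sharp>\<^sub>1 g))" "\<epsilon>D \<in> cells D (F1 (g \<sharp>\<^sub>1 f)) (F1 (\<one>\<^sub>1 Y))"
    using \<eta>D(1) \<epsilon>D(1) fg by (auto simp: arrs_def)
  moreover have "\<one>\<^sub>1 X \<in> arrs C X X" "f \<sharp>\<^sub>1 g \<in> arrs C X X" "\<one>\<^sub>1 Y \<in> arrs C Y Y" "g \<sharp>\<^sub>1 f \<in> arrs C Y Y"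
    using fg XY by (auto simp: arrs_def simp del: XY)
  ultimately obtain \<eta> \<epsilon> where \<eta>: "\<eta> \<in> cells C (\<one>\<^sub>1 X) (f \<sharp>\<^sub>1 g)" "F2 \<eta> = \<eta>D" "invertible_cell C \<eta>"
    and \<epsilon>: "\<epsilon> \<in> cells C (g \<sharp>\<^sub>1 f) (\<one>\<^sub>1 Y)" "F2 \<epsilon> = \<epsilon>D" "invertible_cell C \<epsilon>"
    using lift_invertible_cell \<eta>D(2) \<epsilon>D(2) by metis
  have "F2 ((\<eta> \<sharp>\<^sub>2 \<one>\<^sub>2 f) \<bullet> (\<one>\<^sub>2 f \<sharp>\<^sub>2 \<epsilon>)) = F2 (\<one>\<^sub>2 f)" "F2 ((\<one>\<^sub>2 g \<sharp>\<^sub>2 \<eta>) \<bullet> (\<epsilon> \<sharp>\<^sub>2 \<one>\<^sub>2 g)) = F2 (\<one>\<^sub>2 g)"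
    using \<eta>(1,2) \<epsilon>(1,2) fg t by (auto simp: cell_simps)
  moreover have "(\<eta> \<sharp>\<^sub>2 \<one>\<^sub>2 f) \<bullet> (\<one>\<^sub>2 f \<sharp>\<^sub>2 \<epsilon>) \<in> cells C f f" "\<one>\<^sub>2 f \<in> cells C f f"
    "(\<one>\<^sub>2 g \<sharp>\<^sub>2 \<eta>) \<bullet> (\<epsilon> \<sharp>\<^sub>2 \<one>\<^sub>2 g) \<in> cells C g g" "\<one>\<^sub>2 g \<in> cells C g g"
    using \<eta>(1) \<epsilon>(1) fg by (auto simp: cell_simps)
  ultimately have "(\<eta> \<sharp>\<^sub>2 \<one>\<^sub>2 f) \<bullet> (\<one>\<^sub>2 f \<sharp>\<^sub>2 \<epsilon>) = \<one>\<^sub>2 f" "(\<one>\<^sub>2 g \<sharp>\<^sub>2 \<eta>) \<bullet> (\<epsilon> \<sharp>\<^sub>2 \<one>\<^sub>2 g) = \<one>\<^sub>2 g"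
    by (blast intro: F2_inj)+
  then show ?thesis
    using fg \<eta> \<epsilon> unfolding pseudo_inverse_def by (auto simp: arrs_def)
qed

text \<open>Essential surjectivity on hom categories lifts k and a pseudo-inverse of k separately.
  Transport along the comparison 2-cells makes the images of the two lifts pseudo-inverse to each
  other, and this is then reflected.\<close>

lemma lift_equi_arrow:
  assumes "k \<in> arrs D (F0 X) (F0 Y)" "X \<in> Obj C" "Y \<in> Obj C" "equi_arrow D k"
  obtains f U where "f \<in> arrs C X Y" "equi_arrow C f" "U \<in> cells D (F1 f) k" "invertible_cell D U"
proof -
  obtain h where h: "pseudo_inverse D k h"
    using assms by (auto simp: equi_arrow_def)
  then have "h \<in> arrs D (F0 Y) (F0 X)"
    using assms by (auto simp: pseudo_inverse_def arrs_def)
  then obtain g W where g: "g \<in> arrs C Y X" "W \<in> cells D (F1 g) h" "invertible_cell D W"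
    using lift_arrow assms by metis
  obtain f U where f: "f \<in> arrs C X Y" "U \<in> cells D (F1 f) k" "invertible_cell D U"
    using lift_arrow assms by metis
  have "pseudo_inverse C f g"
    using pseudo_inverse_reflect[OF D.pseudo_inverse_transport[OF h f(2,3) g(2,3)] f(1) g(1)] .
  then show ?thesis
    using that f by (auto simp: equi_arrow_def)
qed

end

section \<open>Unit objects\<close>

context semi_monoidal_2category
begin

section \<open>The tensor product as a strict 2-functor\<close>

lemma tens_simps [simp]:
  shows tens0_Obj: "\<lbrakk>X \<in> Obj C; Y \<in> Obj C\<rbrakk> \<Longrightarrow> X \<otimes>\<^sub>0 Y \<in> Obj C"
    and ide1_tens0: "\<lbrakk>X \<in> Obj C; Y \<in> Obj C\<rbrakk> \<Longrightarrow> \<one>\<^sub>1 (X \<otimes>\<^sub>0 Y) = \<one>\<^sub>1 X \<otimes>\<^sub>1 \<one>\<^sub>1 Y"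
    and tens1_Arr: "\<lbrakk>f \<in> Arr C; g \<in> Arr C\<rbrakk> \<Longrightarrow> f \<otimes>\<^sub>1 g \<in> Arr C"
    and asrc_tens1: "\<lbrakk>f \<in> Arr C; g \<in> Arr C\<rbrakk> \<Longrightarrow> asrc C (f \<otimes>\<^sub>1 g) = asrc C f \<otimes>\<^sub>0 asrc C g"
    and atrg_tens1: "\<lbrakk>f \<in> Arr C; g \<in> Arr C\<rbrakk> \<Longrightarrow> atrg C (f \<otimes>\<^sub>1 g) = atrg C f \<otimes>\<^sub>0 atrg C g"
    and ide2_tens1: "\<lbrakk>f \<in> Arr C; g \<in> Arr C\<rbrakk> \<Longrightarrow> \<one>\<^sub>2 (f \<otimes>\<^sub>1 g) = \<one>\<^sub>2 f \<otimes>\<^sub>2 \<one>\<^sub>2 g"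
    and tens2_Cell: "\<lbrakk>S \<in> Cell C; T \<in> Cell C\<rbrakk> \<Longrightarrow> S \<otimes>\<^sub>2 T \<in> Cell C"
    and csrc_tens2: "\<lbrakk>S \<in> Cell C; T \<in> Cell C\<rbrakk> \<Longrightarrow> csrc C (S \<otimes>\<^sub>2 T) = csrc C S \<otimes>\<^sub>1 csrc C T"
    and ctrg_tens2: "\<lbrakk>S \<in> Cell C; T \<in> Cell C\<rbrakk> \<Longrightarrow> ctrg C (S \<otimes>\<^sub>2 T) = ctrg C S \<otimes>\<^sub>1 ctrg C T"
  using tensor_2functor
  by (auto simp: strict_2functor_def is_functor_def arrow_cat_def vertical_cat_def horizontal_cat_def
      prod_two_cat_def)

lemma tens1_acomp:
  "\<lbrakk>f \<in> Arr C; g \<in> Arr C; f' \<in> Arr C; g' \<in> Arr C; atrg C f = asrc C f'; atrg C g = asrc C g'\<rbrakk>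
    \<Longrightarrow> (f \<otimes>\<^sub>1 g) \<sharp>\<^sub>1 (f' \<otimes>\<^sub>1 g') = (f \<sharp>\<^sub>1 f') \<otimes>\<^sub>1 (g \<sharp>\<^sub>1 g')"
  and tens2_vcomp:
  "\<lbrakk>S \<in> Cell C; T \<in> Cell C; S' \<in> Cell C; T' \<in> Cell C; ctrg C S = csrc C S'; ctrg C T = csrc C T'\<rbrakk>
    \<Longrightarrow> (S \<otimes>\<^sub>2 T) \<bullet> (S' \<otimes>\<^sub>2 T') = (S \<bullet> S') \<otimes>\<^sub>2 (T \<bullet> T')"
  and tens2_hcomp:
  "\<lbrakk>S \<in> Cell C; T \<in> Cell C; S' \<in> Cell C; T' \<in> Cell C;
      atrg C (csrc C S) = asrc C (csrc C S'); atrg C (csrc C T) = asrc C (csrc C T')\<rbrakk>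
    \<Longrightarrow> (S \<otimes>\<^sub>2 T) \<sharp>\<^sub>2 (S' \<otimes>\<^sub>2 T') = (S \<sharp>\<^sub>2 S') \<otimes>\<^sub>2 (T \<sharp>\<^sub>2 T')"
  using tensor_2functor
  by (auto simp: strict_2functor_def is_functor_def arrow_cat_def vertical_cat_def horizontal_cat_def
      prod_two_cat_def)

declare tens0_assoc [simp] tens1_assoc [simp] tens2_assoc [simp]

text \<open>Functoriality after splitting the identity factor as a composite of two identities,
  oriented so as to distribute the tensor product.\<close>

lemma tens_ide_simps:
  shows tens1_ide_acomp: "\<lbrakk>X \<in> Obj C; f \<in> Arr C; g \<in> Arr C; atrg C f = asrc C g\<rbrakk>
      \<Longrightarrow> \<one>\<^sub>1 X \<otimes>\<^sub>1 (f \<sharp>\<^sub>1 g) = (\<one>\<^sub>1 X \<otimes>\<^sub>1 f) \<sharp>\<^sub>1 (\<one>\<^sub>1 X \<otimes>\<^sub>1 g)"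
    and tens1_acomp_ide: "\<lbrakk>X \<in> Obj C; f \<in> Arr C; g \<in> Arr C; atrg C f = asrc C g\<rbrakk>
      \<Longrightarrow> (f \<sharp>\<^sub>1 g) \<otimes>\<^sub>1 \<one>\<^sub>1 X = (f \<otimes>\<^sub>1 \<one>\<^sub>1 X) \<sharp>\<^sub>1 (g \<otimes>\<^sub>1 \<one>\<^sub>1 X)"
    and tens2_ide_vcomp: "\<lbrakk>X \<in> Obj C; S \<in> Cell C; T \<in> Cell C; ctrg C S = csrc C T\<rbrakk>
      \<Longrightarrow> \<one>\<^sub>2 (\<one>\<^sub>1 X) \<otimes>\<^sub>2 (S \<bullet> T) = (\<one>\<^sub>2 (\<one>\<^sub>1 X) \<otimes>\<^sub>2 S) \<bullet> (\<one>\<^sub>2 (\<one>\<^sub>1 X) \<otimes>\<^sub>2 T)"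
    and tens2_vcomp_ide: "\<lbrakk>X \<in> Obj C; S \<in> Cell C; T \<in> Cell C; ctrg C S = csrc C T\<rbrakk>
      \<Longrightarrow> (S \<bullet> T) \<otimes>\<^sub>2 \<one>\<^sub>2 (\<one>\<^sub>1 X) = (S \<otimes>\<^sub>2 \<one>\<^sub>2 (\<one>\<^sub>1 X)) \<bullet> (T \<otimes>\<^sub>2 \<one>\<^sub>2 (\<one>\<^sub>1 X))"
    and tens2_ide_hcomp: "\<lbrakk>X \<in> Obj C; S \<in> Cell C; T \<in> Cell C; atrg C (csrc C S) = asrc C (csrc C T)\<rbrakk>
      \<Longrightarrow> \<one>\<^sub>2 (\<one>\<^sub>1 X) \<otimes>\<^sub>2 (S \<sharp>\<^sub>2 T) = (\<one>\<^sub>2 (\<one>\<^sub>1 X) \<otimes>\<^sub>2 S) \<sharp>\<^sub>2 (\<one>\<^sub>2 (\<one>\<^sub>1 X) \<otimes>\<^sub>2 T)"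
    and tens2_hcomp_ide: "\<lbrakk>X \<in> Obj C; S \<in> Cell C; T \<in> Cell C; atrg C (csrc C S) = asrc C (csrc C T)\<rbrakk>
      \<Longrightarrow> (S \<sharp>\<^sub>2 T) \<otimes>\<^sub>2 \<one>\<^sub>2 (\<one>\<^sub>1 X) = (S \<otimes>\<^sub>2 \<one>\<^sub>2 (\<one>\<^sub>1 X)) \<sharp>\<^sub>2 (T \<otimes>\<^sub>2 \<one>\<^sub>2 (\<one>\<^sub>1 X))"
  by (simp_all add: tens1_acomp tens2_vcomp tens2_hcomp)

lemma tens1_exchange:
  assumes "f \<in> arrs C X X'" "g \<in> arrs C Y Y'"
  shows "(f \<otimes>\<^sub>1 \<one>\<^sub>1 Y) \<sharp>\<^sub>1 (\<one>\<^sub>1 X' \<otimes>\<^sub>1 g) = f \<otimes>\<^sub>1 g" "(\<one>\<^sub>1 X \<otimes>\<^sub>1 g) \<sharp>\<^sub>1 (f \<otimes>\<^sub>1 \<one>\<^sub>1 Y') = f \<otimes>\<^sub>1 g"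
  using assms by (auto simp: tens1_acomp arrs_def)

text \<open>2-cells acting on different tensor factors commute strictly. The later exchange facts,
  such as d or V passing an \<alpha> on other copies of I, are instances.\<close>

lemma tens2_exchange:
  assumes "S \<in> cells C f f'" "f \<in> arrs C X X'" "T \<in> cells C g g'" "g \<in> arrs C Y Y'"
  shows "(S \<otimes>\<^sub>2 \<one>\<^sub>2 (\<one>\<^sub>1 Y)) \<sharp>\<^sub>2 (\<one>\<^sub>2 (\<one>\<^sub>1 X') \<otimes>\<^sub>2 T) = S \<otimes>\<^sub>2 T"
    "(\<one>\<^sub>2 (\<one>\<^sub>1 X) \<otimes>\<^sub>2 T) \<sharp>\<^sub>2 (S \<otimes>\<^sub>2 \<one>\<^sub>2 (\<one>\<^sub>1 Y')) = S \<otimes>\<^sub>2 T"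
  using assms by (auto simp: tens2_hcomp cell_simps)

lemma tensor_left_two_functor:
  "X \<in> Obj C \<Longrightarrow> two_functor C C (\<lambda>Y. X \<otimes>\<^sub>0 Y) (\<lambda>f. \<one>\<^sub>1 X \<otimes>\<^sub>1 f) (\<lambda>S. \<one>\<^sub>2 (\<one>\<^sub>1 X) \<otimes>\<^sub>2 S)"
  by unfold_locales
    (auto simp: strict_2functor_def is_functor_def arrow_cat_def vertical_cat_def horizontal_cat_def
      tens_ide_simps)

lemma tensor_right_two_functor:
  "X \<in> Obj C \<Longrightarrow> two_functor C C (\<lambda>Y. Y \<otimes>\<^sub>0 X) (\<lambda>f. f \<otimes>\<^sub>1 \<one>\<^sub>1 X) (\<lambda>S. S \<otimes>\<^sub>2 \<one>\<^sub>2 (\<one>\<^sub>1 X))"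
  by unfold_locales
    (auto simp: strict_2functor_def is_functor_def arrow_cat_def vertical_cat_def horizontal_cat_def
      tens_ide_simps)

end

locale semi_monoidal_unit = semi_monoidal_2category C
  for C :: "('o, 'a, 'c, 'x) semi_monoidal_2cat_scheme" (structure) +
  fixes I :: 'o and \<alpha> :: 'a
  assumes unit: "unit_object C I \<alpha>"
begin

abbreviation (input) i where "i \<equiv> \<one>\<^sub>2 (\<one>\<^sub>1 I)"

lemma unit_simps [simp]:
  "I \<in> Obj C" "\<alpha> \<in> Arr C" "asrc C \<alpha> = I \<otimes>\<^sub>0 I" "atrg C \<alpha> = I"
  using unit by (auto simp: unit_object_def cancellable_def arrs_def)

section \<open>Existence of left and right constraints\<close>

lemma equi_\<alpha>: "equi_arrow C \<alpha>"
  using unit by (auto simp: unit_object_def)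

lemma left_ff: "fully_faithful_two_functor C C (\<lambda>Y. I \<otimes>\<^sub>0 Y) (\<lambda>f. \<one>\<^sub>1 I \<otimes>\<^sub>1 f) (\<lambda>S. i \<otimes>\<^sub>2 S)"
  and right_ff: "fully_faithful_two_functor C C (\<lambda>Y. Y \<otimes>\<^sub>0 I) (\<lambda>f. f \<otimes>\<^sub>1 \<one>\<^sub>1 I) (\<lambda>S. S \<otimes>\<^sub>2 i)"
  using unit
  by (auto simp: unit_object_def cancellable_def fully_faithful_two_functor_def
      fully_faithful_two_functor_axioms_def intro: two_category_axioms)

lemma equi_tens_left: "X \<in> Obj C \<Longrightarrow> equi_arrow C f \<Longrightarrow> equi_arrow C (\<one>\<^sub>1 X \<otimes>\<^sub>1 f)"
  using two_functor.equi_arrow_F1[OF tensor_left_two_functor] by simp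

lemma equi_tens_right: "X \<in> Obj C \<Longrightarrow> equi_arrow C f \<Longrightarrow> equi_arrow C (f \<otimes>\<^sub>1 \<one>\<^sub>1 X)"
  using two_functor.equi_arrow_F1[OF tensor_right_two_functor] by simp

text \<open>By strict associativity \<alpha>X is an equi-arrow from I(IX) to IX, so it lifts along
  the fully faithful 2-functor that tensors with I on the left.\<close>

lemma left_constraint_exists:
  assumes "X \<in> Obj C"
  shows "\<exists>f S. f \<in> arrs C (I \<otimes>\<^sub>0 X) X \<and> equi_arrow C f \<and>
    S \<in> cells C (\<one>\<^sub>1 I \<otimes>\<^sub>1 f) (\<alpha> \<otimes>\<^sub>1 \<one>\<^sub>1 X) \<and> invertible_cell C S"
proof -
  have k: "\<alpha> \<otimes>\<^sub>1 \<one>\<^sub>1 X \<in> arrs C (I \<otimes>\<^sub>0 (I \<otimes>\<^sub>0 X)) (I \<otimes>\<^sub>0 X)"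
    using assms by (simp add: arrs_def)
  have k': "I \<otimes>\<^sub>0 X \<in> Obj C" "equi_arrow C (\<alpha> \<otimes>\<^sub>1 \<one>\<^sub>1 X)"
    using equi_tens_right[OF assms equi_\<alpha>] assms by simp_all
  obtain f U where "f \<in> arrs C (I \<otimes>\<^sub>0 X) X" "equi_arrow C f"
    "U \<in> cells C (\<one>\<^sub>1 I \<otimes>\<^sub>1 f) (\<alpha> \<otimes>\<^sub>1 \<one>\<^sub>1 X)" "invertible_cell C U"
    using fully_faithful_two_functor.lift_equi_arrow[OF left_ff k k'(1) assms k'(2)] .
  then show ?thesis
    by blast
qed

lemma right_constraint_exists:
  assumes "X \<in> Obj C"
  shows "\<exists>f S. f \<in> arrs C (X \<otimes>\<^sub>0 I) X \<and> equi_arrow C f \<and>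
    S \<in> cells C (\<one>\<^sub>1 X \<otimes>\<^sub>1 \<alpha>) (f \<otimes>\<^sub>1 \<one>\<^sub>1 I) \<and> invertible_cell C S"
proof -
  have k: "\<one>\<^sub>1 X \<otimes>\<^sub>1 \<alpha> \<in> arrs C ((X \<otimes>\<^sub>0 I) \<otimes>\<^sub>0 I) (X \<otimes>\<^sub>0 I)"
    using assms by (simp add: arrs_def)
  have k': "X \<otimes>\<^sub>0 I \<in> Obj C" "equi_arrow C (\<one>\<^sub>1 X \<otimes>\<^sub>1 \<alpha>)"
    using equi_tens_left[OF assms equi_\<alpha>] assms by simp_all
  obtain f U where f: "f \<in> arrs C (X \<otimes>\<^sub>0 I) X" "equi_arrow C f"
    and U: "U \<in> cells C (f \<otimes>\<^sub>1 \<one>\<^sub>1 I) (\<one>\<^sub>1 X \<otimes>\<^sub>1 \<alpha>)" "invertible_cell C U"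
    using fully_faithful_two_functor.lift_equi_arrow[OF right_ff k k'(1) assms k'(2)] .
  \<comment> \<open>The lift comes with a 2-cell into X\<alpha>, whereas a right constraint requires
    one out of X\<alpha>; hence the inverse.\<close>
  obtain T where T: "T \<in> cells C (\<one>\<^sub>1 X \<otimes>\<^sub>1 \<alpha>) (f \<otimes>\<^sub>1 \<one>\<^sub>1 I)" "U \<bullet> T = \<one>\<^sub>2 (f \<otimes>\<^sub>1 \<one>\<^sub>1 I)"
    "T \<bullet> U = \<one>\<^sub>2 (\<one>\<^sub>1 X \<otimes>\<^sub>1 \<alpha>)"
    using invertible_cellE[OF U(2,1)] .
  then show ?thesis
    using f invertible_cellI(1)[OF T(1) U(1) T(3,2)] by blast
qed

lemma constraints_exist:
  "\<exists>l L r R. left_constraints C I \<alpha> l L \<and> right_constraints C I \<alpha> r R"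
proof -
  \<comment> \<open>The restriction to objects stands inside the existential quantifiers so that
    choice yields functions on the whole type.\<close>
  have "\<forall>X. \<exists>f S. X \<in> Obj C \<longrightarrow> f \<in> arrs C (I \<otimes>\<^sub>0 X) X \<and> equi_arrow C f \<and>
    S \<in> cells C (\<one>\<^sub>1 I \<otimes>\<^sub>1 f) (\<alpha> \<otimes>\<^sub>1 \<one>\<^sub>1 X) \<and> invertible_cell C S"
    using left_constraint_exists by blast
  then obtain l L where "left_constraints C I \<alpha> l L"
    unfolding left_constraints_def choice_iff by blast
  moreover have "\<forall>X. \<exists>f S. X \<in> Obj C \<longrightarrow> f \<in> arrs C (X \<otimes>\<^sub>0 I) X \<and> equi_arrow C f \<and>
    S \<in> cells C (\<one>\<^sub>1 X \<otimes>\<^sub>1 \<alpha>) (f \<otimes>\<^sub>1 \<one>\<^sub>1 I) \<and> invertible_cell C S"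
    using right_constraint_exists by blast
  then obtain r R where "right_constraints C I \<alpha> r R"
    unfolding right_constraints_def choice_iff by blast
  ultimately show ?thesis
    by blast
qed

text \<open>\<open>u\<^sub>j\<close>, \<open>t\<^sub>j\<close>, \<open>s\<^sub>j\<close> apply \<open>\<alpha>\<close> with \<open>j\<close> identity factors on its left, starting from
  \<open>III\<close>, \<open>IIII\<close>, \<open>IIIII\<close> respectively.\<close>

definition "u1 = \<one>\<^sub>1 I \<otimes>\<^sub>1 \<alpha>"
definition "u0 = \<alpha> \<otimes>\<^sub>1 \<one>\<^sub>1 I"
definition "t2 = \<one>\<^sub>1 I \<otimes>\<^sub>1 u1"
definition "t1 = \<one>\<^sub>1 I \<otimes>\<^sub>1 u0"
definition "t0 = u0 \<otimes>\<^sub>1 \<one>\<^sub>1 I"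
definition "s3 = \<one>\<^sub>1 I \<otimes>\<^sub>1 t2"
definition "s2 = \<one>\<^sub>1 I \<otimes>\<^sub>1 t1"
definition "s1 = \<one>\<^sub>1 I \<otimes>\<^sub>1 t0"
definition "s0 = t0 \<otimes>\<^sub>1 \<one>\<^sub>1 I"

lemmas arr_defs = u1_def u0_def t2_def t1_def t0_def s3_def s2_def s1_def s0_def

lemma arr_types:
  "u1 \<in> arrs C (I \<otimes>\<^sub>0 (I \<otimes>\<^sub>0 I)) (I \<otimes>\<^sub>0 I)" "u0 \<in> arrs C (I \<otimes>\<^sub>0 (I \<otimes>\<^sub>0 I)) (I \<otimes>\<^sub>0 I)"
  "t2 \<in> arrs C (I \<otimes>\<^sub>0 (I \<otimes>\<^sub>0 (I \<otimes>\<^sub>0 I))) (I \<otimes>\<^sub>0 (I \<otimes>\<^sub>0 I))"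
  "t1 \<in> arrs C (I \<otimes>\<^sub>0 (I \<otimes>\<^sub>0 (I \<otimes>\<^sub>0 I))) (I \<otimes>\<^sub>0 (I \<otimes>\<^sub>0 I))"
  "t0 \<in> arrs C (I \<otimes>\<^sub>0 (I \<otimes>\<^sub>0 (I \<otimes>\<^sub>0 I))) (I \<otimes>\<^sub>0 (I \<otimes>\<^sub>0 I))"
  "s3 \<in> arrs C (I \<otimes>\<^sub>0 (I \<otimes>\<^sub>0 (I \<otimes>\<^sub>0 (I \<otimes>\<^sub>0 I)))) (I \<otimes>\<^sub>0 (I \<otimes>\<^sub>0 (I \<otimes>\<^sub>0 I)))"
  "s2 \<in> arrs C (I \<otimes>\<^sub>0 (I \<otimes>\<^sub>0 (I \<otimes>\<^sub>0 (I \<otimes>\<^sub>0 I)))) (I \<otimes>\<^sub>0 (I \<otimes>\<^sub>0 (I \<otimes>\<^sub>0 I)))"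
  "s1 \<in> arrs C (I \<otimes>\<^sub>0 (I \<otimes>\<^sub>0 (I \<otimes>\<^sub>0 (I \<otimes>\<^sub>0 I)))) (I \<otimes>\<^sub>0 (I \<otimes>\<^sub>0 (I \<otimes>\<^sub>0 I)))"
  "s0 \<in> arrs C (I \<otimes>\<^sub>0 (I \<otimes>\<^sub>0 (I \<otimes>\<^sub>0 (I \<otimes>\<^sub>0 I)))) (I \<otimes>\<^sub>0 (I \<otimes>\<^sub>0 (I \<otimes>\<^sub>0 I)))"
  by (simp_all add: arr_defs arrs_def)

lemma equi_u1: "equi_arrow C u1" and equi_t1: "equi_arrow C t1"
  unfolding arr_defs by (intro equi_tens_left equi_tens_right equi_\<alpha> unit_simps)+

lemma tu: "t2 \<sharp>\<^sub>1 u0 = t0 \<sharp>\<^sub>1 u1"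
  using tens1_exchange[of \<alpha> "I \<otimes>\<^sub>0 I" I \<alpha> "I \<otimes>\<^sub>0 I" I] by (simp add: arr_defs arrs_def)

text \<open>The first equation is \<open>tu\<close> tensored with I on the left. In the other two,
  \<alpha> acts on the first two of five copies of I and \<open>u1\<close> or \<open>u0\<close> on
  the last three.\<close>

lemma st: "s3 \<sharp>\<^sub>1 t1 = s1 \<sharp>\<^sub>1 t2" "s3 \<sharp>\<^sub>1 t0 = s0 \<sharp>\<^sub>1 t2" "s2 \<sharp>\<^sub>1 t0 = s0 \<sharp>\<^sub>1 t1"
proof -
  have "s3 \<sharp>\<^sub>1 t1 = \<one>\<^sub>1 I \<otimes>\<^sub>1 (t2 \<sharp>\<^sub>1 u0)" "s1 \<sharp>\<^sub>1 t2 = \<one>\<^sub>1 I \<otimes>\<^sub>1 (t0 \<sharp>\<^sub>1 u1)"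
    by (simp_all add: arr_defs tens1_ide_acomp)
  then show "s3 \<sharp>\<^sub>1 t1 = s1 \<sharp>\<^sub>1 t2"
    using tu by simp
  show "s3 \<sharp>\<^sub>1 t0 = s0 \<sharp>\<^sub>1 t2" "s2 \<sharp>\<^sub>1 t0 = s0 \<sharp>\<^sub>1 t1"
    using tens1_exchange[of \<alpha> "I \<otimes>\<^sub>0 I" I u1 "I \<otimes>\<^sub>0 (I \<otimes>\<^sub>0 I)" "I \<otimes>\<^sub>0 I"]
      tens1_exchange[of \<alpha> "I \<otimes>\<^sub>0 I" I u0 "I \<otimes>\<^sub>0 (I \<otimes>\<^sub>0 I)" "I \<otimes>\<^sub>0 I"]
    by (simp_all add: arr_defs arrs_def)
qed

lemmas arr_simps [simp] = arr_types[unfolded arrs_def, simplified]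

section \<open>Construction of the 2-cell V\<close>

lemma tens_cells:
  "S \<in> cells C u1 u0 \<Longrightarrow> i \<otimes>\<^sub>2 S \<in> cells C t2 t1" "S \<in> cells C u1 u0 \<Longrightarrow> S \<otimes>\<^sub>2 i \<in> cells C t1 t0"
  "S \<in> cells C u0 u1 \<Longrightarrow> i \<otimes>\<^sub>2 S \<in> cells C t1 t2" "S \<in> cells C u0 u1 \<Longrightarrow> S \<otimes>\<^sub>2 i \<in> cells C t0 t1"
  "S \<in> cells C u1 u0 \<Longrightarrow> i \<otimes>\<^sub>2 (i \<otimes>\<^sub>2 S) \<in> cells C s3 s2"
  "S \<in> cells C u1 u0 \<Longrightarrow> i \<otimes>\<^sub>2 (S \<otimes>\<^sub>2 i) \<in> cells C s2 s1"
  "S \<in> cells C u1 u0 \<Longrightarrow> S \<otimes>\<^sub>2 (i \<otimes>\<^sub>2 i) \<in> cells C s1 s0"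
  by (auto simp: cells_def arr_defs)

lemma invertible_tens:
  assumes "invertible_cell C S" "S \<in> cells C f g"
  shows "invertible_cell C (i \<otimes>\<^sub>2 S)" "invertible_cell C (S \<otimes>\<^sub>2 i)"
  using two_functor.F2_invertible[OF tensor_left_two_functor assms]
    two_functor.F2_invertible[OF tensor_right_two_functor assms] by simp_all

text \<open>The composite that defines A from the given constraints is built from invertible
  2-cells, and lifting along the equi-arrow I\<alpha>I keeps it invertible. At this point the cell
  may still depend on the constraints.\<close>

lemma constraint_cell_exists:
  assumes l: "l \<in> arrs C (I \<otimes>\<^sub>0 I) I" and r: "r \<in> arrs C (I \<otimes>\<^sub>0 I) I"
    and L: "L \<in> cells C (\<one>\<^sub>1 I \<otimes>\<^sub>1 l) u0" "invertible_cell C L"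
    and R: "R \<in> cells C u1 (r \<otimes>\<^sub>1 \<one>\<^sub>1 I)" "invertible_cell C R"
  obtains A where "A \<in> cells C u1 u0" "invertible_cell C A"
proof -
  obtain L' where L': "L' \<in> cells C u0 (\<one>\<^sub>1 I \<otimes>\<^sub>1 l)" "invertible_cell C L'"
    using invertible_cellE[OF L(2,1)] invertible_cellI(1)[OF _ L(1)] by metis
  obtain R' where R': "R' \<in> cells C (r \<otimes>\<^sub>1 \<one>\<^sub>1 I) u1" "invertible_cell C R'"
    using invertible_cellE[OF R(2,1)] invertible_cellI(1)[OF _ R(1)] by metis
  have 1: "i \<otimes>\<^sub>2 L' \<in> cells C t1 (\<one>\<^sub>1 (I \<otimes>\<^sub>0 I) \<otimes>\<^sub>1 l)"
    "R' \<otimes>\<^sub>2 i \<in> cells C (r \<otimes>\<^sub>1 \<one>\<^sub>1 (I \<otimes>\<^sub>0 I)) t1"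
    using L' R' l r by (auto simp: cell_simps arr_defs)
  have 2: "(i \<otimes>\<^sub>2 L') \<sharp>\<^sub>2 R \<in> cells C (t1 \<sharp>\<^sub>1 u1) (r \<otimes>\<^sub>1 l)"
    "(R' \<otimes>\<^sub>2 i) \<sharp>\<^sub>2 L \<in> cells C (r \<otimes>\<^sub>1 l) (t1 \<sharp>\<^sub>1 u0)"
    using 1 L(1) R(1) l r tens1_exchange[OF r l] by (auto simp: cell_simps)
  have "invertible_cell C ((i \<otimes>\<^sub>2 L') \<sharp>\<^sub>2 R)" "invertible_cell C ((R' \<otimes>\<^sub>2 i) \<sharp>\<^sub>2 L)"
    using invertible_hcomp[OF invertible_tens(1)[OF L'(2,1)] R(2) 1(1) R(1)]
      invertible_hcomp[OF invertible_tens(2)[OF R'(2,1)] L(2) 1(2) L(1)] l r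
    by (auto simp: arrs_def)
  then have "invertible_cell C (((i \<otimes>\<^sub>2 L') \<sharp>\<^sub>2 R) \<bullet> ((R' \<otimes>\<^sub>2 i) \<sharp>\<^sub>2 L))"
    "((i \<otimes>\<^sub>2 L') \<sharp>\<^sub>2 R) \<bullet> ((R' \<otimes>\<^sub>2 i) \<sharp>\<^sub>2 L) \<in> cells C (t1 \<sharp>\<^sub>1 u1) (t1 \<sharp>\<^sub>1 u0)"
    using invertible_vcomp[OF _ _ 2] 2 by (auto simp: cells_def)
  then show ?thesis
    using equi_whisker_left_lift_invertible[OF equi_t1, of _ u1 u0 "I \<otimes>\<^sub>0 I"] that
    by (auto simp: arrs_def)
qed

text \<open>Although \<open>V\<close> is defined from \<open>A\<close>, it does not change when \<open>A\<close> is replaced by \<open>A \<bullet> (d \<otimes> i)\<close>;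
  taking \<open>A = V\<close> gives the equation below.\<close>

lemma associator_exists:
  assumes A: "A \<in> cells C u1 u0" "invertible_cell C A"
  obtains V where "V \<in> cells C u1 u0" "invertible_cell C V"
    "((i \<otimes>\<^sub>2 V) \<sharp>\<^sub>2 \<one>\<^sub>2 u1) \<bullet> ((V \<otimes>\<^sub>2 i) \<sharp>\<^sub>2 \<one>\<^sub>2 u1) = \<one>\<^sub>2 t2 \<sharp>\<^sub>2 V"
proof -
  obtain A' where A': "A' \<in> cells C u0 u1" "A \<bullet> A' = \<one>\<^sub>2 u1" "A' \<bullet> A = \<one>\<^sub>2 u0"
    using invertible_cellE[OF A(2,1)] .
  have invA': "invertible_cell C A'"
    using invertible_cellI(1) A A' by blast
  \<comment> \<open>The desired equation, with A and AI in the places of V and VI, solved for the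
    whiskered unknown \<open>V1 \<sharp>\<^sub>2 \<one>\<^sub>2 u1\<close>. The two factors of
    \<open>W\<close> meet because of \<open>tu\<close>.\<close>
  define W where "W = (\<one>\<^sub>2 t2 \<sharp>\<^sub>2 A) \<bullet> ((A' \<otimes>\<^sub>2 i) \<sharp>\<^sub>2 \<one>\<^sub>2 u1)"
  have W12: "\<one>\<^sub>2 t2 \<sharp>\<^sub>2 A \<in> cells C (t2 \<sharp>\<^sub>1 u1) (t2 \<sharp>\<^sub>1 u0)"
    "(A' \<otimes>\<^sub>2 i) \<sharp>\<^sub>2 \<one>\<^sub>2 u1 \<in> cells C (t2 \<sharp>\<^sub>1 u0) (t1 \<sharp>\<^sub>1 u1)"
    using A tens_cells(4)[OF A'(1)] tu by (auto simp: cells_def)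
  have "invertible_cell C (\<one>\<^sub>2 t2 \<sharp>\<^sub>2 A)" "invertible_cell C ((A' \<otimes>\<^sub>2 i) \<sharp>\<^sub>2 \<one>\<^sub>2 u1)"
    using invertible_hcomp[OF invertible_ide2[of t2] A(2) _ A(1), of t2]
      invertible_hcomp[OF invertible_tens(2)[OF invA' A'(1)] invertible_ide2[of u1] tens_cells(4)[OF A'(1)], of u1 u1]
    by (auto simp: cells_def)
  then have "invertible_cell C W" "W \<in> cells C (t2 \<sharp>\<^sub>1 u1) (t1 \<sharp>\<^sub>1 u1)"
    unfolding W_def using invertible_vcomp[OF _ _ W12] W12 by (auto simp: cells_def)
  then obtain V1 where V1: "V1 \<in> cells C t2 t1" "V1 \<sharp>\<^sub>2 \<one>\<^sub>2 u1 = W" "invertible_cell C V1"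
    using equi_whisker_right_lift_invertible[OF equi_u1, of W t2 t1 "I \<otimes>\<^sub>0 (I \<otimes>\<^sub>0 (I \<otimes>\<^sub>0 I))"]
    by (auto simp: arrs_def)
  \<comment> \<open>The whisker by \<open>u1\<close> has been removed using that it is an
    equi-arrow; the factor I on the left is removed using that I is cancellable.\<close>
  obtain V where V: "V \<in> cells C u1 u0" "i \<otimes>\<^sub>2 V = V1" "invertible_cell C V"
    using fully_faithful_two_functor.lift_invertible_cell[OF left_ff _ V1(3)] V1(1) arr_types(1,2)
    unfolding t2_def t1_def by metis
  \<comment> \<open>A and V differ by an endo-2-cell of \<alpha>I, which cancellability on the right
    reduces to an endo-2-cell d of \<alpha>.\<close>
  have "A' \<bullet> V \<in> cells C (\<alpha> \<otimes>\<^sub>1 \<one>\<^sub>1 I) (\<alpha> \<otimes>\<^sub>1 \<one>\<^sub>1 I)" "\<alpha> \<in> arrs C (I \<otimes>\<^sub>0 I) I"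
    using V(1) A' unfolding u0_def by (auto simp: cell_simps)
  then obtain d where d: "d \<in> cells C \<alpha> \<alpha>" "d \<otimes>\<^sub>2 i = A' \<bullet> V"
    using fully_faithful_two_functor.lift_cell[OF right_ff] by metis
  have "A \<bullet> (d \<otimes>\<^sub>2 i) = (A \<bullet> A') \<bullet> V"
    unfolding d using A A'(1) V(1) by (auto simp: cells_def vcomp_assoc)
  then have V_eq: "V = A \<bullet> (d \<otimes>\<^sub>2 i)"
    unfolding A' using V(1) by (auto simp: cells_def)
  have di: "d \<otimes>\<^sub>2 i \<in> cells C u0 u0" "d \<otimes>\<^sub>2 (i \<otimes>\<^sub>2 i) \<in> cells C t0 t0"
    using d(1) by (auto simp: cells_def arr_defs)
  \<comment> \<open>Both sides are d \<otimes> \<alpha>: d acts on the first two of four copies of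
    I, \<alpha> on the last two. Thus replacing A by V appends the same 2-cell to both sides of the
    equation.\<close>
  have ex: "(d \<otimes>\<^sub>2 (i \<otimes>\<^sub>2 i)) \<sharp>\<^sub>2 \<one>\<^sub>2 u1 = \<one>\<^sub>2 t2 \<sharp>\<^sub>2 (d \<otimes>\<^sub>2 i)"
    using tens2_exchange[OF d(1), of "I \<otimes>\<^sub>0 I" I "\<one>\<^sub>2 \<alpha>" \<alpha> \<alpha> "I \<otimes>\<^sub>0 I" I]
    by (simp add: cell_simps arr_defs)
  have "(V \<otimes>\<^sub>2 i) \<sharp>\<^sub>2 \<one>\<^sub>2 u1 = ((A \<otimes>\<^sub>2 i) \<sharp>\<^sub>2 \<one>\<^sub>2 u1) \<bullet> (\<one>\<^sub>2 t2 \<sharp>\<^sub>2 (d \<otimes>\<^sub>2 i))"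
    unfolding V_eq ex[symmetric] using A(1) di tens_cells(2)[OF A(1)] d(1)
    by (auto simp: cells_def tens2_vcomp_ide whisker_right_vcomp)
  then have "((i \<otimes>\<^sub>2 V) \<sharp>\<^sub>2 \<one>\<^sub>2 u1) \<bullet> ((V \<otimes>\<^sub>2 i) \<sharp>\<^sub>2 \<one>\<^sub>2 u1) =
      (\<one>\<^sub>2 t2 \<sharp>\<^sub>2 A) \<bullet> ((((A' \<otimes>\<^sub>2 i) \<sharp>\<^sub>2 \<one>\<^sub>2 u1) \<bullet> ((A \<otimes>\<^sub>2 i) \<sharp>\<^sub>2 \<one>\<^sub>2 u1)) \<bullet> (\<one>\<^sub>2 t2 \<sharp>\<^sub>2 (d \<otimes>\<^sub>2 i)))"
    unfolding V(2) V1(2) W_def using W12 A(1) di tens_cells(2)[OF A(1)] tens_cells(4)[OF A'(1)] tu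
    by (auto simp: cells_def vcomp_assoc)
  also have "((A' \<otimes>\<^sub>2 i) \<sharp>\<^sub>2 \<one>\<^sub>2 u1) \<bullet> ((A \<otimes>\<^sub>2 i) \<sharp>\<^sub>2 \<one>\<^sub>2 u1) = ((A' \<bullet> A) \<otimes>\<^sub>2 i) \<sharp>\<^sub>2 \<one>\<^sub>2 u1"
    using A(1) A'(1) tens_cells(2)[OF A(1)] tens_cells(4)[OF A'(1)]
    by (auto simp: cells_def tens2_vcomp_ide whisker_right_vcomp)
  also have "\<dots> = \<one>\<^sub>2 (t2 \<sharp>\<^sub>1 u0)"
    unfolding A' tu by (simp add: ide2_acomp) (simp add: arr_defs)
  also have "(\<one>\<^sub>2 t2 \<sharp>\<^sub>2 A) \<bullet> (\<one>\<^sub>2 (t2 \<sharp>\<^sub>1 u0) \<bullet> (\<one>\<^sub>2 t2 \<sharp>\<^sub>2 (d \<otimes>\<^sub>2 i))) = \<one>\<^sub>2 t2 \<sharp>\<^sub>2 V"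
    unfolding V_eq using A(1) di by (auto simp: cells_def whisker_left_vcomp)
  finally show ?thesis
    using that V by blast
qed

text \<open>This is the pentagon with the last \<alpha> removed from every term. Tensoring with I on
  the left and whiskering by I\<alpha> turn it into \<open>pentagon_core\<close>, whose hypotheses
  \<open>HV\<close> and \<open>HW\<close> are \<open>H\<close> and \<open>H\<close> tensored with I
  on the right. Both operations are injective on 2-cells.\<close>

lemma pentagon_before_unit:
  assumes V: "V \<in> cells C u1 u0" "invertible_cell C V"
    and H: "((i \<otimes>\<^sub>2 V) \<sharp>\<^sub>2 \<one>\<^sub>2 u1) \<bullet> ((V \<otimes>\<^sub>2 i) \<sharp>\<^sub>2 \<one>\<^sub>2 u1) = \<one>\<^sub>2 t2 \<sharp>\<^sub>2 V"
  shows "((i \<otimes>\<^sub>2 V) \<sharp>\<^sub>2 \<one>\<^sub>2 u1) \<bullet> ((\<one>\<^sub>2 t1 \<sharp>\<^sub>2 V) \<bullet> ((V \<otimes>\<^sub>2 i) \<sharp>\<^sub>2 \<one>\<^sub>2 u0)) =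
    (\<one>\<^sub>2 t2 \<sharp>\<^sub>2 V) \<bullet> (\<one>\<^sub>2 t0 \<sharp>\<^sub>2 V)" (is "?L = ?R")
proof -
  note V' = tens_cells(1,2,5-7)[OF V(1)]
  have inv: "invertible_cell C (V \<otimes>\<^sub>2 (i \<otimes>\<^sub>2 i))"
    using two_functor.F2_invertible[OF tensor_right_two_functor[of "I \<otimes>\<^sub>0 I"] V(2,1)] by simp
  have ex1: "(i \<otimes>\<^sub>2 (i \<otimes>\<^sub>2 V)) \<sharp>\<^sub>2 \<one>\<^sub>2 t0 = \<one>\<^sub>2 s0 \<sharp>\<^sub>2 (i \<otimes>\<^sub>2 V)"
    using tens2_exchange[of "\<one>\<^sub>2 \<alpha>" \<alpha> \<alpha> "I \<otimes>\<^sub>0 I" I V u1 u0 "I \<otimes>\<^sub>0 (I \<otimes>\<^sub>0 I)" "I \<otimes>\<^sub>0 I"] V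
    by (simp add: cell_simps arr_defs)
  \<comment> \<open>In terms of naturality cells: the cell at I\<alpha> is an identity.\<close>
  have ex2: "(V \<otimes>\<^sub>2 (i \<otimes>\<^sub>2 i)) \<sharp>\<^sub>2 \<one>\<^sub>2 t2 = \<one>\<^sub>2 s3 \<sharp>\<^sub>2 (V \<otimes>\<^sub>2 i)"
    using tens2_exchange[of V u1 u0 "I \<otimes>\<^sub>0 (I \<otimes>\<^sub>0 I)" "I \<otimes>\<^sub>0 I" "\<one>\<^sub>2 \<alpha>" \<alpha> \<alpha> "I \<otimes>\<^sub>0 I" I] V
    by (simp add: cell_simps arr_defs)
  \<comment> \<open>Tensoring \<open>H\<close> with I on the right gives the characterisation of the
    naturality cell at \<alpha>I.\<close>
  have "(((i \<otimes>\<^sub>2 V) \<sharp>\<^sub>2 \<one>\<^sub>2 u1) \<bullet> ((V \<otimes>\<^sub>2 i) \<sharp>\<^sub>2 \<one>\<^sub>2 u1)) \<otimes>\<^sub>2 i =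
      ((i \<otimes>\<^sub>2 (V \<otimes>\<^sub>2 i)) \<sharp>\<^sub>2 \<one>\<^sub>2 t1) \<bullet> ((V \<otimes>\<^sub>2 (i \<otimes>\<^sub>2 i)) \<sharp>\<^sub>2 \<one>\<^sub>2 t1)"
    "(\<one>\<^sub>2 t2 \<sharp>\<^sub>2 V) \<otimes>\<^sub>2 i = \<one>\<^sub>2 s2 \<sharp>\<^sub>2 (V \<otimes>\<^sub>2 i)"
    using V by (auto simp: cell_simps arr_defs tens2_vcomp_ide tens2_hcomp_ide)
  then have HW: "((i \<otimes>\<^sub>2 (V \<otimes>\<^sub>2 i)) \<sharp>\<^sub>2 \<one>\<^sub>2 t1) \<bullet> ((V \<otimes>\<^sub>2 (i \<otimes>\<^sub>2 i)) \<sharp>\<^sub>2 \<one>\<^sub>2 t1) = \<one>\<^sub>2 s2 \<sharp>\<^sub>2 (V \<otimes>\<^sub>2 i)"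
    using H by simp
  have L: "?L \<in> cells C (t2 \<sharp>\<^sub>1 u1) (t0 \<sharp>\<^sub>1 u0)" and R: "?R \<in> cells C (t2 \<sharp>\<^sub>1 u1) (t0 \<sharp>\<^sub>1 u0)"
    using V V'(1,2) tu by (auto simp: cells_def)
  have "i \<otimes>\<^sub>2 ?L = ((i \<otimes>\<^sub>2 (i \<otimes>\<^sub>2 V)) \<sharp>\<^sub>2 \<one>\<^sub>2 t2) \<bullet> ((\<one>\<^sub>2 s2 \<sharp>\<^sub>2 (i \<otimes>\<^sub>2 V)) \<bullet> ((i \<otimes>\<^sub>2 (V \<otimes>\<^sub>2 i)) \<sharp>\<^sub>2 \<one>\<^sub>2 t1))"
    using V(1) by (auto simp: cell_simps arr_defs tens2_ide_vcomp tens2_ide_hcomp)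
  moreover have "i \<otimes>\<^sub>2 ?R = (\<one>\<^sub>2 s3 \<sharp>\<^sub>2 (i \<otimes>\<^sub>2 V)) \<bullet> (\<one>\<^sub>2 s1 \<sharp>\<^sub>2 (i \<otimes>\<^sub>2 V))"
  proof -
    \<comment> \<open>The two factors meet at t2 # u0 and t0 # u1, which coincide only through
      \<open>tu\<close>; this has to be settled before the abbreviations are unfolded.\<close>
    have "ctrg C (\<one>\<^sub>2 t2 \<sharp>\<^sub>2 V) = csrc C (\<one>\<^sub>2 t0 \<sharp>\<^sub>2 V)"
      using V(1) tu by (simp add: cells_def)
    then have "i \<otimes>\<^sub>2 ?R = (i \<otimes>\<^sub>2 (\<one>\<^sub>2 t2 \<sharp>\<^sub>2 V)) \<bullet> (i \<otimes>\<^sub>2 (\<one>\<^sub>2 t0 \<sharp>\<^sub>2 V))"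
      using V(1) by (intro tens2_ide_vcomp) (simp_all add: cells_def)
    also have "\<dots> = (\<one>\<^sub>2 s3 \<sharp>\<^sub>2 (i \<otimes>\<^sub>2 V)) \<bullet> (\<one>\<^sub>2 s1 \<sharp>\<^sub>2 (i \<otimes>\<^sub>2 V))"
      using V(1) by (simp add: cells_def arr_defs tens2_ide_hcomp)
    finally show ?thesis .
  qed
  ultimately have "(i \<otimes>\<^sub>2 ?L) \<sharp>\<^sub>2 \<one>\<^sub>2 u1 = (i \<otimes>\<^sub>2 ?R) \<sharp>\<^sub>2 \<one>\<^sub>2 u1"
    using pentagon_core[OF arr_types(6-9,3-5,1,2) V(1) V' st tu inv H HW ex1 ex2] by simp
  moreover have "i \<otimes>\<^sub>2 ?L \<in> cells C (\<one>\<^sub>1 I \<otimes>\<^sub>1 (t2 \<sharp>\<^sub>1 u1)) (\<one>\<^sub>1 I \<otimes>\<^sub>1 (t0 \<sharp>\<^sub>1 u0))"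
    "i \<otimes>\<^sub>2 ?R \<in> cells C (\<one>\<^sub>1 I \<otimes>\<^sub>1 (t2 \<sharp>\<^sub>1 u1)) (\<one>\<^sub>1 I \<otimes>\<^sub>1 (t0 \<sharp>\<^sub>1 u0))"
    using two_functor.F2_cells[OF tensor_left_two_functor] L R by auto
  ultimately have "i \<otimes>\<^sub>2 ?L = i \<otimes>\<^sub>2 ?R"
    using equi_whisker_right_inj[OF equi_u1] by auto
  then show ?thesis
    using fully_faithful_two_functor.F2_inj[OF left_ff _ L R] by simp
qed

text \<open>On the right-hand side of the pentagon \<open>H\<close> replaces II\<alpha> # V by a
  whisker of IV \<bullet> VI, which is exchanged with the other V; then \<open>H\<close> is applied
  once more. Now both sides start with IV # I\<alpha> and end with VI # \<alpha>I, and these are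
  invertible.\<close>

lemma associator_coherence:
  assumes V: "V \<in> cells C u1 u0" "invertible_cell C V"
    and H: "((i \<otimes>\<^sub>2 V) \<sharp>\<^sub>2 \<one>\<^sub>2 u1) \<bullet> ((V \<otimes>\<^sub>2 i) \<sharp>\<^sub>2 \<one>\<^sub>2 u1) = \<one>\<^sub>2 t2 \<sharp>\<^sub>2 V"
  shows "\<one>\<^sub>2 t1 \<sharp>\<^sub>2 V = ((V \<otimes>\<^sub>2 i) \<sharp>\<^sub>2 \<one>\<^sub>2 u1) \<bullet> ((i \<otimes>\<^sub>2 V) \<sharp>\<^sub>2 \<one>\<^sub>2 u0)"
proof -
  define V1 V0 where "V1 = i \<otimes>\<^sub>2 V" and "V0 = V \<otimes>\<^sub>2 i"
  have V1: "V1 \<in> cells C t2 t1" "invertible_cell C V1" and V0: "V0 \<in> cells C t1 t0" "invertible_cell C V0"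
    using tens_cells(1,2)[OF V(1)] invertible_tens[OF V(2,1)] by (auto simp: V1_def V0_def)
  have H': "(V1 \<sharp>\<^sub>2 \<one>\<^sub>2 u1) \<bullet> (V0 \<sharp>\<^sub>2 \<one>\<^sub>2 u1) = \<one>\<^sub>2 t2 \<sharp>\<^sub>2 V"
    using H by (simp add: V1_def V0_def)
  have V1w: "V1 \<sharp>\<^sub>2 \<one>\<^sub>2 u1 \<in> cells C (t2 \<sharp>\<^sub>1 u1) (t1 \<sharp>\<^sub>1 u1)" "invertible_cell C (V1 \<sharp>\<^sub>2 \<one>\<^sub>2 u1)"
    and V0w: "V0 \<sharp>\<^sub>2 \<one>\<^sub>2 u0 \<in> cells C (t1 \<sharp>\<^sub>1 u0) (t0 \<sharp>\<^sub>1 u0)" "invertible_cell C (V0 \<sharp>\<^sub>2 \<one>\<^sub>2 u0)"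
    using V1 V0 invertible_hcomp[OF V1(2) invertible_ide2[of u1] V1(1), of u1 u1]
      invertible_hcomp[OF V0(2) invertible_ide2[of u0] V0(1), of u0 u0] by (auto simp: cells_def)
  have tu': "ctrg C (V0 \<sharp>\<^sub>2 \<one>\<^sub>2 u1) = csrc C (V1 \<sharp>\<^sub>2 \<one>\<^sub>2 u0)"
    using V0 V1 tu by (simp add: cells_def)
  note simps = cells_def vcomp_assoc tu
  have "(V1 \<sharp>\<^sub>2 \<one>\<^sub>2 u1) \<bullet> ((\<one>\<^sub>2 t1 \<sharp>\<^sub>2 V) \<bullet> (V0 \<sharp>\<^sub>2 \<one>\<^sub>2 u0)) = (\<one>\<^sub>2 t2 \<sharp>\<^sub>2 V) \<bullet> (\<one>\<^sub>2 t0 \<sharp>\<^sub>2 V)"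
    unfolding V1_def V0_def by (rule pentagon_before_unit[OF V H])
  also have "\<dots> = ((V1 \<bullet> V0) \<sharp>\<^sub>2 \<one>\<^sub>2 u1) \<bullet> (\<one>\<^sub>2 t0 \<sharp>\<^sub>2 V)"
    unfolding H'[symmetric] using V1 V0 by (simp add: cells_def whisker_right_vcomp)
  also have "\<dots> = (\<one>\<^sub>2 t2 \<sharp>\<^sub>2 V) \<bullet> ((V1 \<bullet> V0) \<sharp>\<^sub>2 \<one>\<^sub>2 u0)"
    using hcomp_eq_left_right[of "V1 \<bullet> V0" t2 t0 V u1 u0] V V1 V0 by (simp add: cells_def)
  also have "\<dots> = (V1 \<sharp>\<^sub>2 \<one>\<^sub>2 u1) \<bullet> (((V0 \<sharp>\<^sub>2 \<one>\<^sub>2 u1) \<bullet> (V1 \<sharp>\<^sub>2 \<one>\<^sub>2 u0)) \<bullet> (V0 \<sharp>\<^sub>2 \<one>\<^sub>2 u0))"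
    unfolding H'[symmetric] using V1 V0 by (simp add: simps whisker_right_vcomp)
  finally have 1: "(V1 \<sharp>\<^sub>2 \<one>\<^sub>2 u1) \<bullet> ((\<one>\<^sub>2 t1 \<sharp>\<^sub>2 V) \<bullet> (V0 \<sharp>\<^sub>2 \<one>\<^sub>2 u0)) = \<dots>" .
  have types: "\<one>\<^sub>2 t1 \<sharp>\<^sub>2 V \<in> cells C (t1 \<sharp>\<^sub>1 u1) (t1 \<sharp>\<^sub>1 u0)"
    "(V0 \<sharp>\<^sub>2 \<one>\<^sub>2 u1) \<bullet> (V1 \<sharp>\<^sub>2 \<one>\<^sub>2 u0) \<in> cells C (t1 \<sharp>\<^sub>1 u1) (t1 \<sharp>\<^sub>1 u0)"
    using V V1 V0 tu' by (simp_all add: cells_def)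
  then have "(\<one>\<^sub>2 t1 \<sharp>\<^sub>2 V) \<bullet> (V0 \<sharp>\<^sub>2 \<one>\<^sub>2 u0) = ((V0 \<sharp>\<^sub>2 \<one>\<^sub>2 u1) \<bullet> (V1 \<sharp>\<^sub>2 \<one>\<^sub>2 u0)) \<bullet> (V0 \<sharp>\<^sub>2 \<one>\<^sub>2 u0)"
    using invertible_cancel_left[OF V1w(2) _ _ V1w(1) 1, of "t0 \<sharp>\<^sub>1 u0"] V0w(1)
    by (simp add: cells_def)
  then show ?thesis
    using invertible_cancel_right[OF V0w(2) types V0w(1)] by (simp add: V1_def V0_def)
qed

text \<open>One equivalence covers existence, uniqueness and independence of the constraints: for
  any choice, the composite in the definition collapses to I\<alpha>I # V, and whiskering by the
  equi-arrow I\<alpha>I is injective.\<close>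

lemma is_associator_cell_iff:
  assumes V: "V \<in> cells C u1 u0" "invertible_cell C V"
    and H: "((i \<otimes>\<^sub>2 V) \<sharp>\<^sub>2 \<one>\<^sub>2 u1) \<bullet> ((V \<otimes>\<^sub>2 i) \<sharp>\<^sub>2 \<one>\<^sub>2 u1) = \<one>\<^sub>2 t2 \<sharp>\<^sub>2 V"
    and "left_constraints C I \<alpha> l L" "right_constraints C I \<alpha> r R"
  shows "is_associator_cell C I \<alpha> L R B \<longleftrightarrow> B = V"
proof -
  have l: "l I \<in> arrs C (I \<otimes>\<^sub>0 I) I" and L: "L I \<in> cells C (\<one>\<^sub>1 I \<otimes>\<^sub>1 l I) u0" "invertible_cell C (L I)"
    and r: "r I \<in> arrs C (I \<otimes>\<^sub>0 I) I" and R: "R I \<in> cells C u1 (r I \<otimes>\<^sub>1 \<one>\<^sub>1 I)" "invertible_cell C (R I)"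
    using assms(4,5) by (auto simp: left_constraints_def right_constraints_def u1_def u0_def)
  obtain V' where V': "V' \<in> cells C u0 u1" "V \<bullet> V' = \<one>\<^sub>2 u1" "V' \<bullet> V = \<one>\<^sub>2 u0"
    using invertible_cellE[OF V(2,1)] .
  have invV': "invertible_cell C V'"
    using invertible_cellI(1)[OF V'(1) V(1) V'(3,2)] .
  have \<alpha>: "\<alpha> \<in> arrs C (I \<otimes>\<^sub>0 I) I"
    by (simp add: arrs_def)
  \<comment> \<open>The given constraints are compared with \<lambda> = \<rho> = \<alpha>, L = R =
    V. Cancellability turns the two differences into invertible 2-cells u from \<open>l I\<close> to
    \<alpha> and v from \<alpha> to \<open>r I\<close>.\<close>
  have "L I \<bullet> V' \<in> cells C (\<one>\<^sub>1 I \<otimes>\<^sub>1 l I) (\<one>\<^sub>1 I \<otimes>\<^sub>1 \<alpha>)" "invertible_cell C (L I \<bullet> V')"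
    using invertible_vcomp[OF L(2) invV' L(1) V'(1)] L(1) V'(1) by (auto simp: cells_def u1_def)
  then obtain u where u: "u \<in> cells C (l I) \<alpha>" "i \<otimes>\<^sub>2 u = L I \<bullet> V'" "invertible_cell C u"
    using fully_faithful_two_functor.lift_invertible_cell[OF left_ff _ _ l \<alpha>] by metis
  have "V' \<bullet> R I \<in> cells C (\<alpha> \<otimes>\<^sub>1 \<one>\<^sub>1 I) (r I \<otimes>\<^sub>1 \<one>\<^sub>1 I)" "invertible_cell C (V' \<bullet> R I)"
    using invertible_vcomp[OF invV' R(2) V'(1) R(1)] R(1) V'(1) by (auto simp: cells_def u0_def)
  then obtain v where v: "v \<in> cells C \<alpha> (r I)" "v \<otimes>\<^sub>2 i = V' \<bullet> R I" "invertible_cell C v"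
    using fully_faithful_two_functor.lift_invertible_cell[OF right_ff _ _ \<alpha> r] by metis
  obtain u' where u': "u' \<in> cells C \<alpha> (l I)" "u \<bullet> u' = \<one>\<^sub>2 (l I)" "u' \<bullet> u = \<one>\<^sub>2 \<alpha>"
    using invertible_cellE[OF u(3,1)] .
  obtain v' where v': "v' \<in> cells C (r I) \<alpha>" "v \<bullet> v' = \<one>\<^sub>2 \<alpha>" "v' \<bullet> v = \<one>\<^sub>2 (r I)"
    using invertible_cellE[OF v(3,1)] .
  have lr: "l I \<in> Arr C" "asrc C (l I) = I \<otimes>\<^sub>0 I" "atrg C (l I) = I"
    "r I \<in> Arr C" "asrc C (r I) = I \<otimes>\<^sub>0 I" "atrg C (r I) = I"
    using l r by (auto simp: arrs_def)
  have ui: "i \<otimes>\<^sub>2 u \<in> cells C (\<one>\<^sub>1 I \<otimes>\<^sub>1 l I) u1" "i \<otimes>\<^sub>2 u' \<in> cells C u1 (\<one>\<^sub>1 I \<otimes>\<^sub>1 l I)"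
    "v \<otimes>\<^sub>2 i \<in> cells C u0 (r I \<otimes>\<^sub>1 \<one>\<^sub>1 I)" "v' \<otimes>\<^sub>2 i \<in> cells C (r I \<otimes>\<^sub>1 \<one>\<^sub>1 I) u0"
    using u(1) u'(1) v(1) v'(1) by (auto simp: cells_def arr_defs)
  have ui_inv: "(i \<otimes>\<^sub>2 u) \<bullet> (i \<otimes>\<^sub>2 u') = \<one>\<^sub>2 (\<one>\<^sub>1 I \<otimes>\<^sub>1 l I)" "(i \<otimes>\<^sub>2 u') \<bullet> (i \<otimes>\<^sub>2 u) = \<one>\<^sub>2 u1"
    "(v \<otimes>\<^sub>2 i) \<bullet> (v' \<otimes>\<^sub>2 i) = \<one>\<^sub>2 u0" "(v' \<otimes>\<^sub>2 i) \<bullet> (v \<otimes>\<^sub>2 i) = \<one>\<^sub>2 (r I \<otimes>\<^sub>1 \<one>\<^sub>1 I)"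
    using u(1) u' v(1) v' lr by (simp_all add: tens2_vcomp cells_def arr_defs)
  have L_eq: "L I = (i \<otimes>\<^sub>2 u) \<bullet> V"
  proof -
    have "(i \<otimes>\<^sub>2 u) \<bullet> V = L I \<bullet> (V' \<bullet> V)"
      unfolding u(2) using L(1) V(1) V'(1) by (simp add: cells_def vcomp_assoc)
    then show ?thesis
      unfolding V' using L(1) by (simp add: cells_def)
  qed
  have R_eq: "R I = V \<bullet> (v \<otimes>\<^sub>2 i)"
  proof -
    have "V \<bullet> (v \<otimes>\<^sub>2 i) = (V \<bullet> V') \<bullet> R I"
      unfolding v(2) using R(1) V(1) V'(1) by (simp add: cells_def vcomp_assoc)
    then show ?thesis
      unfolding V' using R(1) by (simp add: cells_def)
  qed
  \<comment> \<open>\<open>inverse_cell\<close> is a definite description, so its value is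
    determined by exhibiting a two-sided inverse.\<close>
  have "L I \<bullet> (V' \<bullet> (i \<otimes>\<^sub>2 u')) = (i \<otimes>\<^sub>2 u) \<bullet> ((V \<bullet> V') \<bullet> (i \<otimes>\<^sub>2 u'))"
    "(V' \<bullet> (i \<otimes>\<^sub>2 u')) \<bullet> L I = V' \<bullet> (((i \<otimes>\<^sub>2 u') \<bullet> (i \<otimes>\<^sub>2 u)) \<bullet> V)"
    unfolding L_eq using ui V(1) V'(1) by (simp_all add: cells_def vcomp_assoc)
  then have L'_eq: "inverse_cell C (L I) = V' \<bullet> (i \<otimes>\<^sub>2 u')"
    unfolding V' ui_inv using ui V(1) V' L(1) ui_inv(1)
    by (intro invertible_cellI(2)[OF L(1)]) (simp_all add: cells_def)
  have "R I \<bullet> ((v' \<otimes>\<^sub>2 i) \<bullet> V') = V \<bullet> (((v \<otimes>\<^sub>2 i) \<bullet> (v' \<otimes>\<^sub>2 i)) \<bullet> V')"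
    "((v' \<otimes>\<^sub>2 i) \<bullet> V') \<bullet> R I = (v' \<otimes>\<^sub>2 i) \<bullet> ((V' \<bullet> V) \<bullet> (v \<otimes>\<^sub>2 i))"
    unfolding R_eq using ui V(1) V'(1) by (simp_all add: cells_def vcomp_assoc)
  then have R'_eq: "inverse_cell C (R I) = (v' \<otimes>\<^sub>2 i) \<bullet> V'"
    unfolding V' ui_inv using ui V(1) V' R(1) ui_inv(4)
    by (intro invertible_cellI(2)[OF R(1)]) (simp_all add: cells_def)
  define V1 V1' V0 V0' where "V1 = i \<otimes>\<^sub>2 V" "V1' = i \<otimes>\<^sub>2 V'" "V0 = V \<otimes>\<^sub>2 i" "V0' = V' \<otimes>\<^sub>2 i"
  note V_defs = this
  have V10: "V1 \<in> cells C t2 t1" "V1' \<in> cells C t1 t2" "V0 \<in> cells C t1 t0" "V0' \<in> cells C t0 t1"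
    using tens_cells V(1) V'(1) unfolding V_defs by blast+
  have V10_inv: "V1' \<bullet> V1 = \<one>\<^sub>2 t1" "V0' \<bullet> V0 = \<one>\<^sub>2 t0"
    unfolding V_defs using V(1) V' by (simp_all add: tens2_vcomp cells_def) (simp_all add: arr_defs)
  have iuv: "i \<otimes>\<^sub>2 (i \<otimes>\<^sub>2 u') \<in> cells C t2 (\<one>\<^sub>1 I \<otimes>\<^sub>1 (\<one>\<^sub>1 I \<otimes>\<^sub>1 l I))"
    "v' \<otimes>\<^sub>2 (i \<otimes>\<^sub>2 i) \<in> cells C (r I \<otimes>\<^sub>1 (\<one>\<^sub>1 I \<otimes>\<^sub>1 \<one>\<^sub>1 I)) t0"
    using u'(1) v'(1) by (auto simp: cells_def arr_defs)
  \<comment> \<open>The contributions of u and v are separated from those of V. Acting on different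
    tensor factors, v and \<open>u'\<close> merge into v \<otimes> u', which will meet v' \<otimes>
    u from the second half and cancel.\<close>
  have "(i \<otimes>\<^sub>2 inverse_cell C (L I)) \<sharp>\<^sub>2 R I = (V1' \<bullet> (i \<otimes>\<^sub>2 (i \<otimes>\<^sub>2 u'))) \<sharp>\<^sub>2 (V \<bullet> (v \<otimes>\<^sub>2 i))"
    unfolding L'_eq R_eq V_defs using ui V'(1) by (simp add: tens2_ide_vcomp cells_def)
  also have "\<dots> = (V1' \<sharp>\<^sub>2 V) \<bullet> ((i \<otimes>\<^sub>2 (i \<otimes>\<^sub>2 u')) \<sharp>\<^sub>2 (v \<otimes>\<^sub>2 i))"
    using V10 iuv V(1) ui by (intro interchange) (simp_all add: cells_def)
  also have "(i \<otimes>\<^sub>2 (i \<otimes>\<^sub>2 u')) \<sharp>\<^sub>2 (v \<otimes>\<^sub>2 i) = v \<otimes>\<^sub>2 u'"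
    using tens2_exchange(2)[OF v(1) \<alpha> u'(1) \<alpha>] u'(1) by (simp add: cells_def)
  finally have 1: "(i \<otimes>\<^sub>2 inverse_cell C (L I)) \<sharp>\<^sub>2 R I = (V1' \<sharp>\<^sub>2 V) \<bullet> (v \<otimes>\<^sub>2 u')" .
  have "(inverse_cell C (R I) \<otimes>\<^sub>2 i) \<sharp>\<^sub>2 L I = ((v' \<otimes>\<^sub>2 (i \<otimes>\<^sub>2 i)) \<bullet> V0') \<sharp>\<^sub>2 ((i \<otimes>\<^sub>2 u) \<bullet> V)"
    unfolding R'_eq L_eq V_defs using ui V'(1) v'(1) by (simp add: tens2_vcomp_ide cells_def)
  also have "\<dots> = ((v' \<otimes>\<^sub>2 (i \<otimes>\<^sub>2 i)) \<sharp>\<^sub>2 (i \<otimes>\<^sub>2 u)) \<bullet> (V0' \<sharp>\<^sub>2 V)"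
    using V10 iuv V(1) ui lr by (intro interchange) (simp_all add: cells_def)
  also have "(v' \<otimes>\<^sub>2 (i \<otimes>\<^sub>2 i)) \<sharp>\<^sub>2 (i \<otimes>\<^sub>2 u) = v' \<otimes>\<^sub>2 u"
    using tens2_exchange(1)[OF v'(1) r u(1) l] u(1) by (simp add: cells_def)
  finally have 2: "(inverse_cell C (R I) \<otimes>\<^sub>2 i) \<sharp>\<^sub>2 L I = (v' \<otimes>\<^sub>2 u) \<bullet> (V0' \<sharp>\<^sub>2 V)" .
  have aa: "t2 \<sharp>\<^sub>1 u0 = \<alpha> \<otimes>\<^sub>1 \<alpha>" "t0 \<sharp>\<^sub>1 u1 = \<alpha> \<otimes>\<^sub>1 \<alpha>"
    using tens1_exchange[OF \<alpha> \<alpha>] by (simp_all add: arr_defs)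
  have 3: "(v \<otimes>\<^sub>2 u') \<bullet> (v' \<otimes>\<^sub>2 u) = \<one>\<^sub>2 (t0 \<sharp>\<^sub>1 u1)"
    unfolding aa using u(1) u' v(1) v' by (simp add: tens2_vcomp cells_def)
  have vu: "v \<otimes>\<^sub>2 u' \<in> cells C (t0 \<sharp>\<^sub>1 u1) (r I \<otimes>\<^sub>1 l I)" "v' \<otimes>\<^sub>2 u \<in> cells C (r I \<otimes>\<^sub>1 l I) (t0 \<sharp>\<^sub>1 u1)"
    unfolding aa using u(1) u'(1) v(1) v'(1) by (auto simp: cells_def)
  have VV: "V1' \<sharp>\<^sub>2 V \<in> cells C (t1 \<sharp>\<^sub>1 u1) (t0 \<sharp>\<^sub>1 u1)" "V0' \<sharp>\<^sub>2 V \<in> cells C (t0 \<sharp>\<^sub>1 u1) (t1 \<sharp>\<^sub>1 u0)"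
    using V10 V(1) tu by (auto simp: cells_def)
  have "((i \<otimes>\<^sub>2 inverse_cell C (L I)) \<sharp>\<^sub>2 R I) \<bullet> ((inverse_cell C (R I) \<otimes>\<^sub>2 i) \<sharp>\<^sub>2 L I) =
      (V1' \<sharp>\<^sub>2 V) \<bullet> (((v \<otimes>\<^sub>2 u') \<bullet> (v' \<otimes>\<^sub>2 u)) \<bullet> (V0' \<sharp>\<^sub>2 V))"
    unfolding 1 2 using vu VV by (simp add: cells_def vcomp_assoc)
  also have "\<dots> = (V1' \<sharp>\<^sub>2 V) \<bullet> (V0' \<sharp>\<^sub>2 V)"
    unfolding 3 using VV by (simp add: cells_def)
  \<comment> \<open>From here only V is involved. The two horizontal composites are split in
    opposite orders, and the I\<alpha>I # V in the second one is rewritten by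
    \<open>associator_coherence\<close>, so that \<open>V0'\<close> meets \<open>V0\<close> and
    \<open>V1'\<close> then meets \<open>V1\<close>.\<close>
  also have "V1' \<sharp>\<^sub>2 V = (\<one>\<^sub>2 t1 \<sharp>\<^sub>2 V) \<bullet> (V1' \<sharp>\<^sub>2 \<one>\<^sub>2 u0)"
    using hcomp_eq_left_right(2)[OF V10(2) V(1)] by simp
  also have "V0' \<sharp>\<^sub>2 V = (V0' \<sharp>\<^sub>2 \<one>\<^sub>2 u1) \<bullet> ((V0 \<sharp>\<^sub>2 \<one>\<^sub>2 u1) \<bullet> (V1 \<sharp>\<^sub>2 \<one>\<^sub>2 u0))"
    using hcomp_eq_left_right(1)[OF V10(4) V(1)] associator_coherence[OF V H] by (simp add: V_defs)
  also have "((\<one>\<^sub>2 t1 \<sharp>\<^sub>2 V) \<bullet> (V1' \<sharp>\<^sub>2 \<one>\<^sub>2 u0)) \<bullet> ((V0' \<sharp>\<^sub>2 \<one>\<^sub>2 u1) \<bullet> ((V0 \<sharp>\<^sub>2 \<one>\<^sub>2 u1) \<bullet> (V1 \<sharp>\<^sub>2 \<one>\<^sub>2 u0))) =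
      (\<one>\<^sub>2 t1 \<sharp>\<^sub>2 V) \<bullet> ((V1' \<sharp>\<^sub>2 \<one>\<^sub>2 u0) \<bullet> (((V0' \<bullet> V0) \<sharp>\<^sub>2 \<one>\<^sub>2 u1) \<bullet> (V1 \<sharp>\<^sub>2 \<one>\<^sub>2 u0)))"
    using V10 V(1) tu by (simp add: cells_def vcomp_assoc whisker_right_vcomp)
  also have "(V0' \<bullet> V0) \<sharp>\<^sub>2 \<one>\<^sub>2 u1 = \<one>\<^sub>2 (t2 \<sharp>\<^sub>1 u0)"
    unfolding V10_inv tu by (simp add: ide2_acomp)
  also have "(V1' \<sharp>\<^sub>2 \<one>\<^sub>2 u0) \<bullet> (\<one>\<^sub>2 (t2 \<sharp>\<^sub>1 u0) \<bullet> (V1 \<sharp>\<^sub>2 \<one>\<^sub>2 u0)) = (V1' \<bullet> V1) \<sharp>\<^sub>2 \<one>\<^sub>2 u0"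
    using V10 by (simp add: cells_def whisker_right_vcomp)
  also have "\<dots> = \<one>\<^sub>2 (t1 \<sharp>\<^sub>1 u0)"
    unfolding V10_inv by (simp add: ide2_acomp)
  also have "(\<one>\<^sub>2 t1 \<sharp>\<^sub>2 V) \<bullet> \<one>\<^sub>2 (t1 \<sharp>\<^sub>1 u0) = \<one>\<^sub>2 t1 \<sharp>\<^sub>2 V"
    using V(1) by (simp add: cells_def)
  finally have E: "((i \<otimes>\<^sub>2 inverse_cell C (L I)) \<sharp>\<^sub>2 R I) \<bullet> ((inverse_cell C (R I) \<otimes>\<^sub>2 i) \<sharp>\<^sub>2 L I) =
      \<one>\<^sub>2 t1 \<sharp>\<^sub>2 V" .
  have t1': "u1 \<otimes>\<^sub>1 \<one>\<^sub>1 I = t1"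
    by (simp add: arr_defs)
  show ?thesis
    unfolding is_associator_cell_def E t1' u1_def[symmetric] u0_def[symmetric]
    using equi_whisker_left_inj[OF equi_t1 V(1), of B] V(1) by auto
qed

text \<open>Tensoring V # \<alpha> with I turns the whisker into I\<alpha> or \<alpha>I, so every
  term is the corresponding term of \<open>pentagon_before_unit\<close> followed by
  \<alpha>.\<close>

lemma pentagon:
  assumes V: "V \<in> cells C u1 u0" "invertible_cell C V"
    and H: "((i \<otimes>\<^sub>2 V) \<sharp>\<^sub>2 \<one>\<^sub>2 u1) \<bullet> ((V \<otimes>\<^sub>2 i) \<sharp>\<^sub>2 \<one>\<^sub>2 u1) = \<one>\<^sub>2 t2 \<sharp>\<^sub>2 V"
    and W: "W = V \<sharp>\<^sub>2 \<one>\<^sub>2 \<alpha>"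
  shows "((i \<otimes>\<^sub>2 W) \<sharp>\<^sub>2 \<one>\<^sub>2 \<alpha>) \<bullet> (\<one>\<^sub>2 t1 \<sharp>\<^sub>2 W) \<bullet> ((W \<otimes>\<^sub>2 i) \<sharp>\<^sub>2 \<one>\<^sub>2 \<alpha>) =
    (\<one>\<^sub>2 t2 \<sharp>\<^sub>2 W) \<bullet> (\<one>\<^sub>2 t0 \<sharp>\<^sub>2 W)"
proof -
  note V' = tens_cells(1,2)[OF V(1)]
  have "i \<otimes>\<^sub>2 W = (i \<otimes>\<^sub>2 V) \<sharp>\<^sub>2 \<one>\<^sub>2 u1" "W \<otimes>\<^sub>2 i = (V \<otimes>\<^sub>2 i) \<sharp>\<^sub>2 \<one>\<^sub>2 u0"
    unfolding W using V(1) by (simp_all add: cells_def tens2_ide_hcomp tens2_hcomp_ide)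
      (simp_all add: arr_defs)
  moreover have "\<one>\<^sub>2 t \<sharp>\<^sub>2 W = (\<one>\<^sub>2 t \<sharp>\<^sub>2 V) \<sharp>\<^sub>2 \<one>\<^sub>2 \<alpha>" if "t \<in> {t2, t1, t0}" for t
    unfolding W using V(1) that by (auto simp: cells_def hcomp_assoc)
  moreover have "(((i \<otimes>\<^sub>2 V) \<sharp>\<^sub>2 \<one>\<^sub>2 u1) \<sharp>\<^sub>2 \<one>\<^sub>2 \<alpha>) \<bullet> ((\<one>\<^sub>2 t1 \<sharp>\<^sub>2 V) \<sharp>\<^sub>2 \<one>\<^sub>2 \<alpha>) \<bullet>
      (((V \<otimes>\<^sub>2 i) \<sharp>\<^sub>2 \<one>\<^sub>2 u0) \<sharp>\<^sub>2 \<one>\<^sub>2 \<alpha>) =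
      (((i \<otimes>\<^sub>2 V) \<sharp>\<^sub>2 \<one>\<^sub>2 u1) \<bullet> ((\<one>\<^sub>2 t1 \<sharp>\<^sub>2 V) \<bullet> ((V \<otimes>\<^sub>2 i) \<sharp>\<^sub>2 \<one>\<^sub>2 u0))) \<sharp>\<^sub>2 \<one>\<^sub>2 \<alpha>"
    using V(1) V' by (simp add: cells_def whisker_right_vcomp vcomp_assoc)
  moreover have "ctrg C (\<one>\<^sub>2 t2 \<sharp>\<^sub>2 V) = csrc C (\<one>\<^sub>2 t0 \<sharp>\<^sub>2 V)"
    using V(1) tu by (simp add: cells_def)
  then have "((\<one>\<^sub>2 t2 \<sharp>\<^sub>2 V) \<sharp>\<^sub>2 \<one>\<^sub>2 \<alpha>) \<bullet> ((\<one>\<^sub>2 t0 \<sharp>\<^sub>2 V) \<sharp>\<^sub>2 \<one>\<^sub>2 \<alpha>) =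
      ((\<one>\<^sub>2 t2 \<sharp>\<^sub>2 V) \<bullet> (\<one>\<^sub>2 t0 \<sharp>\<^sub>2 V)) \<sharp>\<^sub>2 \<one>\<^sub>2 \<alpha>"
    using V(1) by (intro whisker_right_vcomp[symmetric]) (simp_all add: cells_def)
  ultimately show ?thesis
    using pentagon_before_unit[OF V H] by simp
qed

end

theorem theoremA:
  fixes C :: "('o, 'a, 'c, 'x) semi_monoidal_2cat_scheme" (structure)
    and I :: 'o and \<alpha> :: 'a
  assumes "semi_monoidal_2category C"
    and "unit_object C I \<alpha>"
  shows "(\<exists>l L r R. left_constraints C I \<alpha> l L \<and> right_constraints C I \<alpha> r R) \<and>
    (\<exists>A. (\<forall>l L r R. left_constraints C I \<alpha> l L \<and> right_constraints C I \<alpha> r R \<longrightarrow>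
            (\<forall>B. is_associator_cell C I \<alpha> L R B \<longleftrightarrow> B = A)) \<and>
      (let A' = A \<sharp>\<^sub>2 \<one>\<^sub>2 \<alpha>; i = \<one>\<^sub>2 (\<one>\<^sub>1 I) in
         A' \<in> cells C ((\<one>\<^sub>1 I \<otimes>\<^sub>1 \<alpha>) \<sharp>\<^sub>1 \<alpha>) ((\<alpha> \<otimes>\<^sub>1 \<one>\<^sub>1 I) \<sharp>\<^sub>1 \<alpha>) \<and>
         invertible_cell C A' \<and>
         ((i \<otimes>\<^sub>2 A') \<sharp>\<^sub>2 \<one>\<^sub>2 \<alpha>) \<bullet> (\<one>\<^sub>2 (\<one>\<^sub>1 I \<otimes>\<^sub>1 \<alpha> \<otimes>\<^sub>1 \<one>\<^sub>1 I) \<sharp>\<^sub>2 A') \<bullet> ((A' \<otimes>\<^sub>2 i) \<sharp>\<^sub>2 \<one>\<^sub>2 \<alpha>)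
         = (\<one>\<^sub>2 (\<one>\<^sub>1 (I \<otimes>\<^sub>0 I) \<otimes>\<^sub>1 \<alpha>) \<sharp>\<^sub>2 A') \<bullet> (\<one>\<^sub>2 (\<alpha> \<otimes>\<^sub>1 \<one>\<^sub>1 (I \<otimes>\<^sub>0 I)) \<sharp>\<^sub>2 A')))"
proof -
  interpret semi_monoidal_unit C I \<alpha>
    using assms by (simp add: semi_monoidal_unit_def semi_monoidal_unit_axioms_def)
  \<comment> \<open>These arbitrary constraints only produce a starting 2-cell A. The V made from it
    satisfies an equation in which they do not occur.\<close>
  obtain l L r R where "left_constraints C I \<alpha> l L" "right_constraints C I \<alpha> r R"
    using constraints_exist by blast
  then have "l I \<in> arrs C (I \<otimes>\<^sub>0 I) I" "r I \<in> arrs C (I \<otimes>\<^sub>0 I) I"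
    "L I \<in> cells C (\<one>\<^sub>1 I \<otimes>\<^sub>1 l I) u0" "invertible_cell C (L I)"
    "R I \<in> cells C u1 (r I \<otimes>\<^sub>1 \<one>\<^sub>1 I)" "invertible_cell C (R I)"
    by (auto simp: left_constraints_def right_constraints_def u1_def u0_def)
  then obtain A where "A \<in> cells C u1 u0" "invertible_cell C A"
    by (rule constraint_cell_exists)
  then obtain V where V: "V \<in> cells C u1 u0" "invertible_cell C V"
    "((\<one>\<^sub>2 (\<one>\<^sub>1 I) \<otimes>\<^sub>2 V) \<sharp>\<^sub>2 \<one>\<^sub>2 u1) \<bullet> ((V \<otimes>\<^sub>2 \<one>\<^sub>2 (\<one>\<^sub>1 I)) \<sharp>\<^sub>2 \<one>\<^sub>2 u1) = \<one>\<^sub>2 t2 \<sharp>\<^sub>2 V"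
    by (rule associator_exists)
  have ts: "u1 \<otimes>\<^sub>1 \<one>\<^sub>1 I = t1" "\<one>\<^sub>1 (I \<otimes>\<^sub>0 I) \<otimes>\<^sub>1 \<alpha> = t2" "\<alpha> \<otimes>\<^sub>1 \<one>\<^sub>1 (I \<otimes>\<^sub>0 I) = t0"
    by (simp_all add: arr_defs)
  have "V \<sharp>\<^sub>2 \<one>\<^sub>2 \<alpha> \<in> cells C (u1 \<sharp>\<^sub>1 \<alpha>) (u0 \<sharp>\<^sub>1 \<alpha>)"
    using V(1) by (simp add: cells_def)
  moreover have "invertible_cell C (V \<sharp>\<^sub>2 \<one>\<^sub>2 \<alpha>)"
    using invertible_hcomp[OF V(2) invertible_ide2 V(1), of \<alpha> \<alpha> \<alpha>] by (simp add: cells_def)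
  moreover have "\<forall>l L r R. left_constraints C I \<alpha> l L \<and> right_constraints C I \<alpha> r R \<longrightarrow>
      (\<forall>B. is_associator_cell C I \<alpha> L R B \<longleftrightarrow> B = V)"
    using is_associator_cell_iff[OF V] by blast
  ultimately show ?thesis
    unfolding Let_def ts u1_def[symmetric] u0_def[symmetric]
    by (intro conjI constraints_exist exI[of _ V] pentagon[OF V refl])
qed

end
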